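(* Let $\rho$ be a $g$-measure on $A^{\mathbb N}$ associated to $\phi=\log g$, let $x_1^n$ be a sample path distributed according to $\rho$, and suppose that the sequence of positive integers $(k(n))_{n\in\mathbb N}$ diverges and eventually satisfies $k(n)\leq\frac{1-\epsilon}{\log|A|}\log n$ for some $0<\epsilon<1$. Let $$\mathbf J(u)=u\ \text{ if } u\in\big[0,-\inf\{\mathbb E_\eta[\phi]:\eta\in\mathcal E\}\big],\qquad \mathbf J(u)=+\infty\ \text{ otherwise.}$$ Then $\mathbf J$ is in Legendre duality with the convex function $t\mapsto\mathbf P^\Delta(t)$, $t\in\mathbb R$, defined by $$\mathbf P^\Delta(t)=(1-t)\,\inf\{\mathbb E_\nu[\phi]:\nu\in\mathcal E\}\ \text{ for } t>1,\qquad \mathbf P^\Delta(t)=0\ \text{ for } t\leq1.$$ Moreover, for every $t\in\mathbb R$, $$\lim_{n\to\infty}\frac1n\log\mathbb E_\rho\left[e^{nt\hat\Delta_{k(n)}(x_1^n|\rho)}\right]=\lim_{n\to\infty}\frac1n\log\mathbb E_\rho\left[e^{nt\frac{\hat D_{k(n)}(x_1^n|\rho)}{k(n)}}\right]=\mathbf P^\Delta(t).$$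
   Context: $A$ is a finite alphabet; $a_1^k$ denotes the string $(a_1,\dots,a_k)\in A^k$; $T$ is the shift on $A^{\mathbb N}$, $Tx_1^\infty=x_2^\infty$; $[a_1^n]$ is the cylinder of infinite strings beginning with $a_1^n$. $\mathcal M_s$ is the set of shift-invariant Borel probability measures on $A^{\mathbb N}$ and $\mathcal E\subset\mathcal M_s$ the ergodic ones; $\mathbb E_\nu$ is expectation with respect to $\nu$; $h(\nu)$ is the Shannon-Kolmogorov-Sinai entropy of $\nu\in\mathcal M_s$. $g$-measures: $g:A^{\mathbb N}\to(0,1)$ is a continuous, strictly positive function with $\sum_{b_1^\infty:Tb_1^\infty=a_1^\infty}g(b_1^\infty)=1$ for all $a_1^\infty$; $\phi=\log g$. An equilibrium state of a continuous $\psi:A^{\mathbb N}\to\mathbb R$ is a measure in $\mathcal M_s$ attaining $\sup\{\mathbb E_\eta[\psi]+h(\eta):\eta\in\mathcal M_s\}$. A $g$-measure is an equilibrium state of $\phi=\log g$ (not assumed unique); $\rho$ is one fixed such measure and $\rho_k(a_1^k)=\rho([a_1^k])$. Empirical relative entropies: for $x_1^n\in A^n$ let $\tilde x_1^\infty$ be its $n$-periodic extension $x_1^nx_1^nx_1^n\cdots$ and $\pi_k(a_1^k;x_1^n)=\frac1n\#\{1\le i\le n:\tilde x_i^{i+k-1}=a_1^k\}$. For a probability measure $\nu_k$ on $A^k$, with $\nu_{k-1}(a_1^{k-1})=\sum_b\nu_k(a_1^{k-1}b)$, let $D_k(\nu_k|\rho_k)=\sum_{a_1^k}\nu_k(a_1^k)\log\frac{\nu_k(a_1^k)}{\rho_k(a_1^k)}$,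 $D_0=0$, and $\Delta_k(\nu_k|\rho_k)=D_k(\nu_k|\rho_k)-D_{k-1}(\nu_{k-1}|\rho_{k-1})$ (convention $0\log 0=0$). Then $\hat D_k(x_1^n|\rho)=D_k(\pi_k(\cdot;x_1^n)|\rho_k)$ and $\hat\Delta_k(x_1^n|\rho)=\Delta_k(\pi_k(\cdot;x_1^n)|\rho_k)$. Legendre duality of $\mathbf J$ and $\mathbf P^\Delta$ means $\mathbf P^\Delta(t)=\sup_{u\in\mathbb R}\{tu-\mathbf J(u)\}$ for all $t$ and $\mathbf J(u)=\sup_{t\in\mathbb R}\{tu-\mathbf P^\Delta(t)\}$ for all $u$. *)

theory Defs
  imports "HOL-Probability.Probability"
begin

text \<open>
  The alphabet is a type \<open>'a :: finite\<close>; infinite strings are functions \<open>nat \<Rightarrow> 'a\<close> (the first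
  symbol has index 0) and strings of length \<open>k\<close> are lists of length \<open>k\<close>.
\<close>

definition shift :: "(nat \<Rightarrow> 'a) \<Rightarrow> nat \<Rightarrow> 'a" where
  "shift x = (\<lambda>i. x (Suc i))"

definition prefix_of :: "(nat \<Rightarrow> 'a) \<Rightarrow> nat \<Rightarrow> 'a list" where
  "prefix_of x n = map x [0..<n]"

definition cylinder :: "'a list \<Rightarrow> (nat \<Rightarrow> 'a) set" where
  "cylinder a = {x. prefix_of x (length a) = a}"

definition seq_topology :: "(nat \<Rightarrow> 'a) topology" where
  "seq_topology = product_topology (\<lambda>_. discrete_topology UNIV) UNIV"

definition seq_borel :: "(nat \<Rightarrow> 'a) measure" where
  "seq_borel = sigma UNIV {U. openin seq_topology U}"

definition invariant_measures :: "(nat \<Rightarrow> 'a) measure set" where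
  "invariant_measures =
     {\<nu>. prob_space \<nu> \<and> sets \<nu> = sets seq_borel \<and> distr \<nu> \<nu> shift = \<nu>}"

definition ergodic_measures :: "(nat \<Rightarrow> 'a) measure set" where
  "ergodic_measures =
     {\<nu> \<in> invariant_measures.
        \<forall>B \<in> sets \<nu>. shift -` B = B \<longrightarrow> measure \<nu> B = 0 \<or> measure \<nu> B = 1}"


section \<open>Kolmogorov-Sinai entropy of the shift\<close>

text \<open>
  A finite measurable partition is given by the function \<open>p\<close> sending a point to the label (a natural
  number) of its cell, i.e. by a simple function.  The cells of the join of the pullbacks of the
  partition under the first \<open>n\<close> iterates of the shift are then the nonempty fibres of
  \<open>itinerary p n\<close>.
\<close>

definition itinerary :: "((nat \<Rightarrow> 'a) \<Rightarrow> nat) \<Rightarrow> nat \<Rightarrow> (nat \<Rightarrow> 'a) \<Rightarrow> nat list" where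
  "itinerary p n x = map (\<lambda>i. p ((shift ^^ i) x)) [0..<n]"

definition join_entropy :: "(nat \<Rightarrow> 'a) measure \<Rightarrow> ((nat \<Rightarrow> 'a) \<Rightarrow> nat) \<Rightarrow> nat \<Rightarrow> real" where
  "join_entropy \<nu> p n =
     - (\<Sum>w \<in> range (itinerary p n).
          measure \<nu> (itinerary p n -` {w}) * ln (measure \<nu> (itinerary p n -` {w})))"

definition partition_entropy :: "(nat \<Rightarrow> 'a) measure \<Rightarrow> ((nat \<Rightarrow> 'a) \<Rightarrow> nat) \<Rightarrow> real" where
  "partition_entropy \<nu> p = lim (\<lambda>n. join_entropy \<nu> p n / real n)"

definition KS_entropy :: "(nat \<Rightarrow> 'a) measure \<Rightarrow> ereal" where
  "KS_entropy \<nu> = (SUP p \<in> {p. simple_function \<nu> p}. ereal (partition_entropy \<nu> p))"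


section \<open>Equilibrium states and g-measures\<close>

definition equilibrium_state :: "((nat \<Rightarrow> 'a) \<Rightarrow> real) \<Rightarrow> (nat \<Rightarrow> 'a) measure \<Rightarrow> bool" where
  "equilibrium_state \<psi> \<nu> \<longleftrightarrow>
     \<nu> \<in> invariant_measures \<and>
     ereal (integral\<^sup>L \<nu> \<psi>) + KS_entropy \<nu>
       = (SUP \<eta> \<in> invariant_measures. ereal (integral\<^sup>L \<eta> \<psi>) + KS_entropy \<eta>)"

definition g_function :: "((nat \<Rightarrow> 'a::finite) \<Rightarrow> real) \<Rightarrow> bool" where
  "g_function g \<longleftrightarrow>
     continuous_map seq_topology euclideanreal g \<and>
     (\<forall>x. 0 < g x \<and> g x < 1) \<and>
     (\<forall>a. (\<Sum>b | shift b = a. g b) = 1)"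

definition g_measure :: "((nat \<Rightarrow> 'a::finite) \<Rightarrow> real) \<Rightarrow> (nat \<Rightarrow> 'a) measure \<Rightarrow> bool" where
  "g_measure g \<rho> \<longleftrightarrow> g_function g \<and> equilibrium_state (\<lambda>x. ln (g x)) \<rho>"


section \<open>Empirical relative entropies\<close>

definition periodic_ext :: "'a list \<Rightarrow> nat \<Rightarrow> 'a" where
  "periodic_ext x = (\<lambda>i. x ! (i mod length x))"

definition empirical :: "'a list \<Rightarrow> nat \<Rightarrow> 'a list \<Rightarrow> real" where
  "empirical x k a =
     real (card {i. i < length x \<and> map (periodic_ext x) [i..<i + k] = a}) / real (length x)"

text \<open>
  A family \<open>(\<nu>\<^sub>k)\<close> of marginals is a function on lists.  The convention \<open>0 log 0 = 0\<close> holds because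
  \<open>0 * y = 0\<close>.  The real-valued formula is meaningful only if \<open>r a > 0\<close> whenever \<open>\<nu> a > 0\<close>; a
  g-measure has full support, so this holds for its marginals.
\<close>

definition rel_entropy :: "nat \<Rightarrow> ('a::finite list \<Rightarrow> real) \<Rightarrow> ('a list \<Rightarrow> real) \<Rightarrow> real" where
  "rel_entropy k \<nu> r = (if k = 0 then 0 else (\<Sum>a | length a = k. \<nu> a * ln (\<nu> a / r a)))"

definition marginal :: "('a::finite list \<Rightarrow> real) \<Rightarrow> 'a list \<Rightarrow> real" where
  "marginal \<nu> a = (\<Sum>b\<in>UNIV. \<nu> (a @ [b]))"

definition cond_rel_entropy :: "nat \<Rightarrow> ('a::finite list \<Rightarrow> real) \<Rightarrow> ('a list \<Rightarrow> real) \<Rightarrow> real" where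
  "cond_rel_entropy k \<nu> r = rel_entropy k \<nu> r - rel_entropy (k - 1) (marginal \<nu>) r"

definition cyl_prob :: "(nat \<Rightarrow> 'a) measure \<Rightarrow> 'a list \<Rightarrow> real" where
  "cyl_prob \<rho> a = measure \<rho> (cylinder a)"

definition D_hat :: "nat \<Rightarrow> 'a::finite list \<Rightarrow> (nat \<Rightarrow> 'a) measure \<Rightarrow> real" where
  "D_hat k x \<rho> = rel_entropy k (empirical x k) (cyl_prob \<rho>)"

definition Delta_hat :: "nat \<Rightarrow> 'a::finite list \<Rightarrow> (nat \<Rightarrow> 'a) measure \<Rightarrow> real" where
  "Delta_hat k x \<rho> = cond_rel_entropy k (empirical x k) (cyl_prob \<rho>)"


section \<open>Rate function and free energy\<close>

text \<open>
  The infimum is a real infimum: \<open>ln g\<close> is bounded by compactness, and ergodic measures exist.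
\<close>

definition inf_ergodic :: "((nat \<Rightarrow> 'a::finite) \<Rightarrow> real) \<Rightarrow> real" where
  "inf_ergodic g = (INF \<eta> \<in> ergodic_measures. integral\<^sup>L \<eta> (\<lambda>x. ln (g x)))"

definition J_fun :: "((nat \<Rightarrow> 'a::finite) \<Rightarrow> real) \<Rightarrow> real \<Rightarrow> ereal" where
  "J_fun g u = (if u \<in> {0 .. - inf_ergodic g} then ereal u else \<infinity>)"

definition P_Delta :: "((nat \<Rightarrow> 'a::finite) \<Rightarrow> real) \<Rightarrow> real \<Rightarrow> real" where
  "P_Delta g t = (if t > 1 then (1 - t) * inf_ergodic g else 0)"

definition legendre_dual :: "(real \<Rightarrow> ereal) \<Rightarrow> (real \<Rightarrow> real) \<Rightarrow> bool" where
  "legendre_dual J P \<longleftrightarrow>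
     (\<forall>t. ereal (P t) = (SUP u. ereal (t * u) - J u)) \<and>
     (\<forall>u. J u = (SUP t. ereal (t * u - P t)))"

end

theory Submission
  imports Defs
begin

text \<open>
  Write \<open>\<phi> = ln g\<close>.  The proof has two halves.

  The first half shows that an equilibrium state \<open>\<rho>\<close> of \<open>\<phi>\<close> is a Gibbs law: putting a letter in front of a
  word multiplies its probability by the value of \<open>g\<close>, up to the oscillation of \<open>\<phi>\<close> on the cylinder.
  Hence \<open>ln \<rho>[x]\<close> is a Birkhoff sum of \<open>\<phi>\<close> up to \<open>o(n)\<close>, uniformly in \<open>x\<close>.  The reason is the variational
  principle.  Averages of the iterates of the dual transfer operator have an invariant Gibbs law as a limit
  point (\<open>stationary_gibbs_law_exists\<close>), and for such a law entropy and energy cancel, so the pressure of \<open>\<phi>\<close> is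
  at least \<open>0\<close>.  On the other hand the Kolmogorov-Sinai entropy is at most every increment
  \<open>h k = H (k + 1) - H k\<close> of the block entropies (\<open>KS_entropy_le_increment\<close>), and the sum of \<open>h k\<close> and the
  energy is, up to an oscillation, minus the relative entropy between the \<open>\<rho>\<close>-law of words of length
  \<open>k + 1\<close> and the law obtained from \<open>\<rho>\<close> by prepending a letter with probability \<open>g\<close>.  Nonnegative pressure
  therefore makes the total variation distance of these laws vanish as \<open>k\<close> grows.  Since this distance
  increases with \<open>k\<close>, it is zero for all \<open>k\<close> (\<open>gibbs_law_of_nonneg_pressure\<close>).

  The second half is combinatorial.  The empirical frequencies of a word \<open>x\<close> of length \<open>n\<close> are the cylinder
  probabilities of the uniform measure on the orbit of its periodic extension, which is ergodic.  Let
  \<open>H k\<close> and \<open>h k\<close> now denote its block entropies and their increments.  By the Gibbs property, uniformly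
  in \<open>x\<close>, the numbers \<open>n \<Delta>\<close> and \<open>n D / k\<close> are both of the form \<open>- n c(x) - ln \<rho>[x] + o(n)\<close>, with
  \<open>c = h (k - 1)\<close> and \<open>c = H k / k\<close> respectively, and \<open>h (k - 1) \<le> H k / k\<close>.  Four facts then determine the
  exponential moments.

  \<^item> The sum of \<open>exp (- n h (k - 1))\<close> over all words is \<open>exp (o(n))\<close>: the words of one type
    contribute at most \<open>CARD('a) ^ (k - 1)\<close>, and the bound on \<open>k(n)\<close> makes the number of types
    subexponential (\<open>sum_exp_empirical_increment_le\<close>).
  \<^item> \<open>n H k / k \<le> - ln \<rho>[x] + o(n)\<close>, because relative entropies are nonnegative.
  \<^item> \<open>ln \<rho>[x] \<ge> n I - o(n)\<close>, where \<open>I\<close> is the infimum of the energy over ergodic measures, because the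
    orbit measure is one of them.
  \<^item> Words with a fixed period and with \<open>ln \<rho>[x]\<close> close to \<open>n I\<close> exist, and since they have few subwords
    their \<open>H k / k\<close> tends to \<open>0\<close> (\<open>near_minimal_words\<close>).

  The first and third fact give the upper bound \<open>(1 - t) I\<close> for \<open>t > 1\<close>, and the periodic words attain it.
  For \<open>0 \<le> t \<le> 1\<close> the moments are bounded from above by interpolation between the total mass and the first
  sum, and from below by the second fact.  For \<open>t < 0\<close> the second fact bounds them from above, and
  convexity in \<open>t\<close> bounds them from below in terms of their value at \<open>t = 1\<close>.  All of this is
  \<open>tilted_sum_limit\<close>.  The free energy is thus the positive part of an affine function of \<open>t\<close>, which makes the Legendre duality elementary.
\<close>

section \<open>Entropy of stationary laws on words\<close>

lemma cesaro_mean: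
  fixes f :: "nat \<Rightarrow> real"
  assumes "f \<longlonglongrightarrow> l"
  shows "(\<lambda>n. (\<Sum>j<n. f j) / real n) \<longlonglongrightarrow> l"
proof (rule LIMSEQ_I)
  fix r :: real assume "r > 0"
  then obtain N where N: "\<And>n. n \<ge> N \<Longrightarrow> \<bar>f n - l\<bar> < r / 2"
    using LIMSEQ_D[OF assms, of "r/2"] by auto
  define C where "C = (\<Sum>j<N. \<bar>f j - l\<bar>)"
  have C: "C \<ge> 0" unfolding C_def by (rule sum_nonneg) simp
  obtain M :: nat where M: "real M > 2 * C / r" using reals_Archimedean2 by blast
  show "\<exists>no. \<forall>n\<ge>no. norm ((\<Sum>j<n. f j) / real n - l) < r"
  proof (intro exI allI impI)
    fix n assume n: "n \<ge> Suc (max N M)"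
    then have n0: "real n > 0" by simp
    have "(\<Sum>j<n. f j) / real n - l = (\<Sum>j<n. f j - l) / real n"
      using n0 by (simp add: sum_subtractf field_simps)
    also have "\<bar>\<dots>\<bar> \<le> (\<Sum>j<n. \<bar>f j - l\<bar>) / real n"
      using n0 by (simp add: divide_right_mono)
    also have "(\<Sum>j<n. \<bar>f j - l\<bar>) = C + (\<Sum>j\<in>{N..<n}. \<bar>f j - l\<bar>)"
    proof -
      have "{..<n} = {..<N} \<union> {N..<n}" using n by auto
      then show ?thesis unfolding C_def by (simp add: sum.union_disjoint ivl_disj_int)
    qed
    also have "(\<Sum>j\<in>{N..<n}. \<bar>f j - l\<bar>) \<le> (\<Sum>j\<in>{N..<n}. r/2)"
      by (intro sum_mono less_imp_le[OF N]) auto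
    also have "\<dots> \<le> real n * (r/2)" using \<open>r > 0\<close> by (simp add: mult_right_mono)
    finally have "\<bar>(\<Sum>j<n. f j) / real n - l\<bar> \<le> C / real n + r / 2"
      using n0 by (simp add: divide_right_mono field_simps)
    moreover have "C / real n < r / 2"
    proof -
      have "2 * C < real M * r" using M \<open>r > 0\<close> by (simp add: field_simps)
      also have "\<dots> \<le> real n * r" using n \<open>r > 0\<close> by (intro mult_right_mono) auto
      finally show ?thesis using n0 by (simp add: field_simps)
    qed
    ultimately show "norm ((\<Sum>j<n. f j) / real n - l) < r" unfolding real_norm_def by linarith
  qed
qed

text \<open>
  This is the source of all entropy estimates below.  Allowing \<open>q\<close> to have smaller mass than \<open>p\<close> makes it
  applicable to conditional laws that degenerate on null events.
\<close>

lemma gibbs_inequality: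
  fixes p q :: "'i \<Rightarrow> real"
  assumes "\<And>i. i \<in> I \<Longrightarrow> 0 \<le> p i" "\<And>i. i \<in> I \<Longrightarrow> 0 \<le> q i"
    and pos: "\<And>i. i \<in> I \<Longrightarrow> 0 < p i \<Longrightarrow> 0 < q i"
    and le: "sum q I \<le> sum p I"
  shows "(\<Sum>i\<in>I. p i * ln (q i)) \<le> (\<Sum>i\<in>I. p i * ln (p i))"
proof -
  have "p i * ln (q i) - p i * ln (p i) \<le> q i - p i" if i: "i \<in> I" for i
  proof (cases "p i = 0")
    case False
    with assms(1)[OF i] have p: "p i > 0" by simp
    with pos i have q: "q i > 0" by simp
    have "p i * ln (q i / p i) \<le> p i * (q i / p i - 1)"
      using p q by (intro mult_left_mono ln_le_minus_one) auto
    then show ?thesis using p q by (simp add: ln_div right_diff_distrib)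
  qed (use assms i in auto)
  then have "(\<Sum>i\<in>I. p i * ln (q i) - p i * ln (p i)) \<le> (\<Sum>i\<in>I. q i - p i)" by (rule sum_mono)
  then show ?thesis using le by (simp add: sum_subtractf)
qed

definition words :: "'b set \<Rightarrow> nat \<Rightarrow> 'b list set" where
  "words S n = {w. set w \<subseteq> S \<and> length w = n}"

lemma words_UNIV: "words UNIV n = {w. length w = n}"
  by (auto simp: words_def)

lemma finite_words: "finite S \<Longrightarrow> finite (words S n)"
  unfolding words_def by (rule finite_lists_length_eq)

lemma words_0 [simp]: "words S 0 = {[]}"
  by (auto simp: words_def)

lemma sum_words_Cons:
  assumes "finite S"
  shows "(\<Sum>w\<in>words S (Suc n). f w) = (\<Sum>w\<in>words S n. \<Sum>b\<in>S. f (b # w))"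
proof -
  have "words S (Suc n) = (\<lambda>(w, b). b # w) ` (words S n \<times> S)"
    by (force simp: words_def length_Suc_conv image_iff)
  moreover have "inj_on (\<lambda>(w, b). b # w) (words S n \<times> S)" by (auto simp: inj_on_def)
  ultimately show ?thesis
    by (simp add: sum.reindex sum.cartesian_product case_prod_unfold)
qed

lemma sum_words_snoc:
  assumes "finite S"
  shows "(\<Sum>w\<in>words S (Suc n). f w) = (\<Sum>w\<in>words S n. \<Sum>b\<in>S. f (w @ [b]))"
proof -
  have "words S (Suc n) = (\<lambda>(w, b). w @ [b]) ` (words S n \<times> S)"
  proof (intro set_eqI iffI)
    fix v assume v: "v \<in> words S (Suc n)"
    then have "v \<noteq> []" by (auto simp: words_def)
    then have "v = butlast v @ [last v]" by simp
    moreover have "butlast v \<in> words S n" "last v \<in> S"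
      using v \<open>v \<noteq> []\<close> by (auto simp: words_def dest: in_set_butlastD)
    ultimately show "v \<in> (\<lambda>(w, b). w @ [b]) ` (words S n \<times> S)" by force
  qed (auto simp: words_def)
  moreover have "inj_on (\<lambda>(w, b). w @ [b]) (words S n \<times> S)" by (auto simp: inj_on_def)
  ultimately show ?thesis
    by (simp add: sum.reindex sum.cartesian_product case_prod_unfold)
qed

definition block_entropy :: "'b set \<Rightarrow> ('b list \<Rightarrow> real) \<Rightarrow> nat \<Rightarrow> real" where
  "block_entropy S P n = - (\<Sum>w\<in>words S n. P w * ln (P w))"

definition entropy_increment :: "'b set \<Rightarrow> ('b list \<Rightarrow> real) \<Rightarrow> nat \<Rightarrow> real" where
  "entropy_increment S P n = block_entropy S P (Suc n) - block_entropy S P n"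

text \<open>
  Three kinds of families satisfy these axioms and are treated alike: the cylinder probabilities of an
  invariant measure, the law of the itinerary of a point with respect to a finite partition, and the
  cyclic block frequencies of a finite word.  The alphabet is a finite subset of a type because the cells of a
  partition are labelled by natural numbers.
\<close>

locale stationary_law =
  fixes S :: "'b set" and P :: "'b list \<Rightarrow> real"
  assumes finite_alphabet: "finite S"
    and nonneg: "\<And>w. 0 \<le> P w"
    and law_Nil: "P [] = 1"
    and snoc: "\<And>w. set w \<subseteq> S \<Longrightarrow> (\<Sum>b\<in>S. P (w @ [b])) = P w"
    and Cons: "\<And>w. set w \<subseteq> S \<Longrightarrow> (\<Sum>b\<in>S. P (b # w)) = P w"
begin

abbreviation "H \<equiv> block_entropy S P"
abbreviation "h \<equiv> entropy_increment S P"

lemma sum_butlast: "(\<Sum>v\<in>words S (Suc n). P v * F (butlast v)) = (\<Sum>w\<in>words S n. P w * F w)"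
  by (subst sum_words_snoc[OF finite_alphabet])
    (auto simp: sum_distrib_right[symmetric] snoc words_def intro!: sum.cong)

lemma sum_tl: "(\<Sum>v\<in>words S (Suc n). P v * F (tl v)) = (\<Sum>w\<in>words S n. P w * F w)"
  by (subst sum_words_Cons[OF finite_alphabet])
    (auto simp: sum_distrib_right[symmetric] Cons words_def intro!: sum.cong)

lemma sum_law: "(\<Sum>w\<in>words S n. P w) = 1"
proof (induction n)
  case (Suc n)
  then show ?case using sum_tl[of "\<lambda>_. 1" n] by simp
qed (simp add: law_Nil)

lemma le_butlast: "v \<in> words S (Suc n) \<Longrightarrow> P v \<le> P (butlast v)"
proof -
  assume v: "v \<in> words S (Suc n)"
  then have "v \<noteq> []" by (auto simp: words_def)
  then have e: "v = butlast v @ [last v]" and "last v \<in> S" and s: "set (butlast v) \<subseteq> S"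
    using v by (auto simp: words_def dest: in_set_butlastD)
  then have "P (butlast v @ [last v]) \<le> (\<Sum>b\<in>S. P (butlast v @ [b]))"
    by (intro member_le_sum nonneg finite_alphabet) auto
  then show ?thesis using snoc[OF s] e by simp
qed

lemma le_tl: "v \<in> words S (Suc n) \<Longrightarrow> P v \<le> P (tl v)"
proof -
  assume v: "v \<in> words S (Suc n)"
  then obtain a w where e: "v = a # w" "a \<in> S" "set w \<subseteq> S" by (cases v) (auto simp: words_def)
  then have "P (a # w) \<le> (\<Sum>b\<in>S. P (b # w))"
    by (intro member_le_sum nonneg finite_alphabet) auto
  then show ?thesis using Cons[of w] e by simp
qed

lemma entropy_0: "H 0 = 0"
  by (simp add: block_entropy_def law_Nil)

lemma increment_nonneg: "0 \<le> h n"
proof -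
  have "(\<Sum>v\<in>words S (Suc n). P v * ln (P v)) \<le> (\<Sum>v\<in>words S (Suc n). P v * ln (P (butlast v)))"
  proof (rule sum_mono)
    fix v assume v: "v \<in> words S (Suc n)"
    show "P v * ln (P v) \<le> P v * ln (P (butlast v))"
    proof (cases "P v = 0")
      case False
      then have "P v > 0" using nonneg[of v] by simp
      then show ?thesis using le_butlast[OF v] by (intro mult_left_mono) auto
    qed simp
  qed
  then show ?thesis
    by (simp add: entropy_increment_def block_entropy_def sum_butlast[of "\<lambda>w. ln (P w)" n])
qed

text \<open>
  Strong subadditivity of the entropy: comparison of the law of a word \<open>a w b\<close> with the one under which \<open>a\<close> and
  \<open>b\<close> are independent given \<open>w\<close>.
\<close>

lemma increment_decreasing: "h (Suc n) \<le> h n"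
proof -
  let ?W = "words S (Suc (Suc n))"
  define q where "q v = P (butlast v) * P (tl v) / P (tl (butlast v))" for v
  have len: "length v = Suc (Suc n)" if "v \<in> ?W" for v using that by (simp add: words_def)
  have pos: "P (butlast v) > 0 \<and> P (tl v) > 0 \<and> P (tl (butlast v)) > 0"
    if v: "v \<in> ?W" "P v > 0" for v
  proof -
    have b: "butlast v \<in> words S (Suc n)"
      using v by (auto simp: words_def dest: in_set_butlastD)
    show ?thesis using le_butlast[OF v(1)] le_tl[OF v(1)] le_tl[OF b] v(2) by linarith
  qed
  have "sum q ?W = (\<Sum>w\<in>words S n. \<Sum>b\<in>S. \<Sum>a\<in>S. P (a # w) * P (w @ [b]) / P w)"
    by (simp add: sum_words_Cons[OF finite_alphabet, of _ "Suc n"]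
        sum_words_snoc[OF finite_alphabet, of _ n] q_def butlast_append)
  also have "\<dots> = (\<Sum>w\<in>words S n. (\<Sum>a\<in>S. P (a # w)) * (\<Sum>b\<in>S. P (w @ [b])) / P w)"
    by (simp add: sum_distrib_right sum_distrib_left sum_divide_distrib)
  also have "\<dots> = (\<Sum>w\<in>words S n. P w)"
    by (intro sum.cong refl) (auto simp: words_def Cons snoc)
  finally have sq: "sum q ?W = 1" by (simp add: sum_law)
  have "(\<Sum>v\<in>?W. P v * ln (q v)) \<le> (\<Sum>v\<in>?W. P v * ln (P v))"
  proof (rule gibbs_inequality)
    show "0 < q v" if "v \<in> ?W" "0 < P v" for v
      using pos[OF that] by (simp add: q_def)
    show "sum q ?W \<le> sum P ?W" by (simp add: sq sum_law)
  qed (auto simp: q_def nonneg)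
  moreover have "(\<Sum>v\<in>?W. P v * ln (q v)) =
      (\<Sum>v\<in>?W. P v * ln (P (butlast v)) + P v * ln (P (tl v)) - P v * ln (P (tl (butlast v))))"
  proof (rule sum.cong[OF refl])
    fix v assume v: "v \<in> ?W"
    show "P v * ln (q v) = P v * ln (P (butlast v)) + P v * ln (P (tl v)) - P v * ln (P (tl (butlast v)))"
    proof (cases "P v = 0")
      case False
      then have "P v > 0" using nonneg[of v] by simp
      from pos[OF v this] show ?thesis
        by (simp add: q_def ln_div ln_mult algebra_simps)
    qed simp
  qed
  moreover have "\<dots> = - H (Suc n) - H (Suc n) + H n"
    by (simp add: sum.distrib sum_subtractf sum_tl[of "\<lambda>w. ln (P w)"]
        sum_butlast[of "\<lambda>w. ln (P w)"] sum_butlast[of "\<lambda>w. ln (P (tl w))"] block_entropy_def)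
  ultimately show ?thesis
    by (simp add: entropy_increment_def block_entropy_def)
qed

lemma increment_antimono: "m \<le> n \<Longrightarrow> h n \<le> h m"
  by (rule lift_Suc_antimono_le[of h]) (rule increment_decreasing)

lemma entropy_eq_sum: "H n = (\<Sum>j<n. h j)"
  by (induction n) (auto simp: entropy_0 entropy_increment_def)

lemma increment_le_mean: "real (Suc n) * h n \<le> H (Suc n)"
proof -
  have "(\<Sum>j<Suc n. h n) \<le> (\<Sum>j<Suc n. h j)" by (intro sum_mono increment_antimono) auto
  then show ?thesis by (simp add: entropy_eq_sum)
qed

text \<open>
  The entropy rate exists because it is the limit of Cesaro means of the decreasing increments; for the same reason
  it lies below each of them.
\<close>

lemma entropy_rate: "\<exists>l. (\<lambda>n. H n / real n) \<longlonglongrightarrow> l \<and> (\<forall>m. l \<le> h m)"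
proof -
  have "decseq h" by (intro decseq_SucI increment_decreasing)
  then obtain l where l: "h \<longlonglongrightarrow> l" "\<forall>i. l \<le> h i"
    using decseq_convergent[of h 0] increment_nonneg by blast
  then show ?thesis using cesaro_mean[OF l(1)] by (auto simp: entropy_eq_sum)
qed

end


section \<open>Sequences, cylinders and continuity\<close>

lemma funpow_shift: "(shift ^^ i) x = (\<lambda>j. x (j + i))"
  by (induction i) (auto simp: shift_def)

lemma length_prefix_of [simp]: "length (prefix_of x n) = n"
  by (simp add: prefix_of_def)

lemma nth_prefix_of [simp]: "i < n \<Longrightarrow> prefix_of x n ! i = x i"
  by (simp add: prefix_of_def)

lemma prefix_of_eq_iff: "prefix_of x n = prefix_of y n \<longleftrightarrow> (\<forall>i<n. x i = y i)"
  by (auto simp: list_eq_iff_nth_eq)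

lemma prefix_of_mono: "prefix_of x n = prefix_of y n \<Longrightarrow> m \<le> n \<Longrightarrow> prefix_of x m = prefix_of y m"
  by (simp add: prefix_of_eq_iff)

lemma prefix_of_0 [simp]: "prefix_of x 0 = []"
  by (simp add: prefix_of_def)

lemma prefix_of_Suc_Cons: "prefix_of x (Suc n) = x 0 # prefix_of (shift x) n"
  by (auto simp: list_eq_iff_nth_eq nth_Cons shift_def split: nat.split)

lemma in_cylinder_iff: "x \<in> cylinder a \<longleftrightarrow> prefix_of x (length a) = a"
  by (simp add: cylinder_def)

lemma in_cylinder_nth: "x \<in> cylinder a \<longleftrightarrow> (\<forall>i<length a. x i = a ! i)"
  by (auto simp: cylinder_def list_eq_iff_nth_eq)

text \<open>
  The periodic extension of a word serves throughout as the canonical point of its cylinder.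
\<close>

lemma periodic_ext_in_cylinder: "periodic_ext w \<in> cylinder w"
  by (simp add: in_cylinder_nth periodic_ext_def)

lemma case_nat_in_cylinder [simp]: "case_nat b x \<in> cylinder (a # w) \<longleftrightarrow> b = a \<and> x \<in> cylinder w"
  by (auto simp: in_cylinder_iff prefix_of_Suc_Cons shift_def)

lemma shift_case_nat [simp]: "shift (case_nat b x) = x"
  by (simp add: shift_def)

lemma case_nat_shift: "case_nat (x 0) (shift x) = x"
  by (auto simp: shift_def fun_eq_iff split: nat.split)

lemma openin_seq_topology_iff:
  "openin seq_topology U \<longleftrightarrow> (\<forall>x\<in>U. \<exists>m. cylinder (prefix_of x m) \<subseteq> U)"
proof
  assume "openin seq_topology U"
  show "\<forall>x\<in>U. \<exists>m. cylinder (prefix_of x m) \<subseteq> U"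
  proof
    fix x assume "x \<in> U"
    with \<open>openin seq_topology U\<close> obtain V where V: "finite {i. V i \<noteq> UNIV}" "x \<in> PiE UNIV V" "PiE UNIV V \<subseteq> U"
      unfolding seq_topology_def openin_product_topology_alt by fastforce
    obtain m where m: "\<And>i. V i \<noteq> UNIV \<Longrightarrow> i < m"
      using finite_nat_bounded[OF V(1)] by auto
    have "cylinder (prefix_of x m) \<subseteq> PiE UNIV V"
    proof
      fix y assume y: "y \<in> cylinder (prefix_of x m)"
      have "y i \<in> V i" for i
        using m[of i] y V(2) by (cases "V i = UNIV") (auto simp: in_cylinder_nth PiE_iff)
      then show "y \<in> PiE UNIV V" by auto
    qed
    with V(3) show "\<exists>m. cylinder (prefix_of x m) \<subseteq> U" by blast
  qed
next
  assume *: "\<forall>x\<in>U. \<exists>m. cylinder (prefix_of x m) \<subseteq> U"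
  show "openin seq_topology U"
    unfolding seq_topology_def openin_product_topology_alt
  proof
    fix x assume "x \<in> U"
    then obtain m where m: "cylinder (prefix_of x m) \<subseteq> U" using * by blast
    let ?V = "\<lambda>i. if i < m then {x i} else UNIV"
    have "{i. ?V i \<noteq> UNIV} \<subseteq> {..<m}" by auto
    then have "finite {i. ?V i \<noteq> UNIV}" by (rule finite_subset) simp
    moreover have "PiE UNIV ?V \<subseteq> U"
      using m by (force simp: in_cylinder_nth PiE_iff split: if_splits)
    ultimately show "\<exists>V. finite {i \<in> UNIV. V i \<noteq> topspace (discrete_topology UNIV)} \<and>
        (\<forall>i\<in>UNIV. openin (discrete_topology UNIV) (V i)) \<and> x \<in> PiE UNIV V \<and> PiE UNIV V \<subseteq> U"
      by (intro exI[of _ ?V]) auto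
  qed
qed

lemma openin_cylinder: "openin seq_topology (cylinder a)"
  by (auto simp: openin_seq_topology_iff in_cylinder_iff intro!: exI[of _ "length a"])

text \<open>
  Compactness of the sequence space, in the form that is used for uniform continuity and for the
  continuity at the empty set of finitely additive contents.
\<close>

lemma cylinder_cover_bounded:
  fixes R :: "(nat \<Rightarrow> 'a::finite) \<Rightarrow> nat \<Rightarrow> bool"
  assumes "\<And>x. \<exists>m. R x m"
  shows "\<exists>F. finite F \<and> (\<forall>(x, m)\<in>F. R x m) \<and> (\<forall>y. \<exists>(x, m)\<in>F. y \<in> cylinder (prefix_of x m))"
proof -
  obtain m where m: "\<And>x. R x (m x)" using assms by metis
  have "compact_space (seq_topology :: (nat \<Rightarrow> 'a) topology)"
    unfolding seq_topology_def by (simp add: compact_space_product_topology compact_space_discrete_topology)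
  moreover have "topspace (seq_topology :: (nat \<Rightarrow> 'a) topology) = UNIV"
    by (simp add: seq_topology_def)
  moreover have "x \<in> cylinder (prefix_of x (m x))" for x by (simp add: in_cylinder_iff)
  ultimately have "\<exists>F. finite F \<and> F \<subseteq> range (\<lambda>x. cylinder (prefix_of x (m x))) \<and> UNIV \<subseteq> \<Union>F"
    unfolding compact_space_def compactin_def
    by (metis (no_types, lifting) UNIV_I UN_I openin_cylinder rangeE subsetI)
  then obtain F where F: "finite F" "F \<subseteq> range (\<lambda>x. cylinder (prefix_of x (m x)))" "UNIV \<subseteq> \<Union>F"
    by blast
  then obtain G where G: "finite G" "F = (\<lambda>x. cylinder (prefix_of x (m x))) ` G"
    by (meson finite_subset_image)
  show ?thesis
    using G F(3) m by (intro exI[of _ "(\<lambda>x. (x, m x)) ` G"]) auto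
qed

lemma uniformly_continuous_prefix:
  fixes f :: "(nat \<Rightarrow> 'a::finite) \<Rightarrow> real"
  assumes "continuous_map seq_topology euclideanreal f" and "\<delta> > 0"
  shows "\<exists>m. \<forall>x y. prefix_of x m = prefix_of y m \<longrightarrow> \<bar>f x - f y\<bar> < \<delta>"
proof -
  define R where "R x m \<longleftrightarrow> (\<forall>y\<in>cylinder (prefix_of x m). \<bar>f y - f x\<bar> < \<delta> / 2)" for x m
  have "\<exists>m. R x m" for x
  proof -
    have "openin seq_topology {y. \<bar>f y - f x\<bar> < \<delta> / 2}"
    proof -
      have "{y. \<bar>f y - f x\<bar> < \<delta> / 2} = {y \<in> topspace seq_topology. f y \<in> ball (f x) (\<delta> / 2)}"
        by (auto simp: seq_topology_def dist_real_def abs_minus_commute)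
      then show ?thesis
        using openin_continuous_map_preimage[OF assms(1), of "ball (f x) (\<delta>/2)"] by simp
    qed
    moreover have "x \<in> {y. \<bar>f y - f x\<bar> < \<delta> / 2}" using \<open>\<delta> > 0\<close> by simp
    ultimately show ?thesis unfolding openin_seq_topology_iff R_def by blast
  qed
  from cylinder_cover_bounded[of R, OF this] obtain F where F: "finite F"
    "\<And>x m. (x, m) \<in> F \<Longrightarrow> R x m" "\<And>y. \<exists>(x, m)\<in>F. y \<in> cylinder (prefix_of x m)"
    by blast
  define M where "M = (\<Sum>(x, m)\<in>F. m)"
  have "\<bar>f y - f z\<bar> < \<delta>" if yz: "prefix_of y M = prefix_of z M" for y z
  proof -
    obtain x m where xm: "(x, m) \<in> F" "y \<in> cylinder (prefix_of x m)" using F(3)[of y] by blast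
    have "m \<le> M" unfolding M_def using member_le_sum[OF xm(1), of "\<lambda>(x, m). m"] F(1) by auto
    then have "z \<in> cylinder (prefix_of x m)"
      using xm(2) prefix_of_mono[OF yz] by (simp add: in_cylinder_iff)
    with F(2)[OF xm(1)] xm(2) have "\<bar>f y - f x\<bar> < \<delta>/2" "\<bar>f z - f x\<bar> < \<delta>/2" by (auto simp: R_def)
    then show ?thesis by linarith
  qed
  then show ?thesis by blast
qed

lemma space_seq_borel [simp]: "space seq_borel = UNIV"
  by (simp add: seq_borel_def)

lemma cylinder_in_sets [measurable]: "cylinder a \<in> sets seq_borel"
  by (simp add: seq_borel_def openin_cylinder)

text \<open>
  These are the clopen sets.  They form an algebra that generates the Borel sets.
\<close>

definition prefix_event :: "nat \<Rightarrow> 'a list set \<Rightarrow> (nat \<Rightarrow> 'a) set" where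
  "prefix_event m W = {x. prefix_of x m \<in> W}"

lemma take_prefix_of: "m \<le> n \<Longrightarrow> take m (prefix_of x n) = prefix_of x m"
  by (simp add: prefix_of_def take_map take_upt)

lemma periodic_ext_in_prefix_event:
  "m \<le> length w \<Longrightarrow> periodic_ext w \<in> prefix_event m W \<longleftrightarrow> take m w \<in> W"
  using periodic_ext_in_cylinder[of w] take_prefix_of[of m "length w" "periodic_ext w"]
  by (simp add: prefix_event_def in_cylinder_iff)

lemma prefix_event_extend: "m \<le> n \<Longrightarrow> prefix_event m W = prefix_event n {w. take m w \<in> W}"
  by (simp add: prefix_event_def take_prefix_of)

lemma prefix_event_in_sets:
  fixes W :: "'a::finite list set"
  shows "prefix_event m W \<in> sets seq_borel"
proof -
  have "prefix_event m W = (\<Union>a\<in>W \<inter> words UNIV m. cylinder a)"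
    by (auto simp: prefix_event_def in_cylinder_iff words_UNIV)
  then show ?thesis by (auto simp: finite_words)
qed

lemma sum_indicator_cylinder_snoc:
  fixes w :: "'a::finite list"
  shows "(\<Sum>b\<in>UNIV. indicator (cylinder (w @ [b])) y) = (indicator (cylinder w) y :: real)"
proof -
  have "(\<Sum>b\<in>UNIV. indicator (cylinder (w @ [b])) y) =
      (\<Sum>b\<in>UNIV. if b = y (length w) then indicator (cylinder w) y else (0::real))"
    by (intro sum.cong refl) (auto simp: indicator_def in_cylinder_nth nth_append less_Suc_eq)
  then show ?thesis by simp
qed

section \<open>Measures on the sequence space\<close>

lemma sets_seq_borel_cylinders:
  "sets (seq_borel :: (nat \<Rightarrow> 'a::finite) measure) = sigma_sets UNIV (insert {} (range cylinder))"
proof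
  have "U \<in> sigma_sets UNIV (insert {} (range cylinder))" if U: "openin seq_topology U"
    for U :: "(nat \<Rightarrow> 'a) set"
  proof -
    have "U = (\<Union>a\<in>{a. cylinder a \<subseteq> U}. cylinder a)"
    proof
      show "U \<subseteq> (\<Union>a\<in>{a. cylinder a \<subseteq> U}. cylinder a)"
      proof
        fix x assume "x \<in> U"
        then obtain m where "cylinder (prefix_of x m) \<subseteq> U" using U openin_seq_topology_iff by blast
        then show "x \<in> (\<Union>a\<in>{a. cylinder a \<subseteq> U}. cylinder a)"
          by (auto simp: in_cylinder_iff intro!: bexI[of _ "prefix_of x m"] exI[of _ "prefix_of x m"])
      qed
    qed auto
    also have "\<dots> \<in> sigma_sets UNIV (insert {} (range cylinder))"
      by (rule sigma_sets_UNION) (auto intro: countable_subset[OF subset_UNIV])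
    finally show ?thesis .
  qed
  then show "sets (seq_borel :: (nat \<Rightarrow> 'a) measure) \<subseteq> sigma_sets UNIV (insert {} (range cylinder))"
    unfolding seq_borel_def by (subst sets_measure_of) (auto intro!: sigma_sets_mono)
  show "sigma_sets UNIV (insert {} (range cylinder)) \<subseteq> sets (seq_borel :: (nat \<Rightarrow> 'a) measure)"
    using sets.sigma_sets_subset[of "insert {} (range cylinder)" "seq_borel :: (nat \<Rightarrow> 'a) measure"]
    by (simp add: image_subset_iff)
qed

lemma Int_stable_cylinders: "Int_stable (insert {} (range cylinder))"
proof (rule Int_stableI)
  have main: "cylinder a \<inter> cylinder b \<in> insert {} (range cylinder)" if "length a \<le> length b"
    for a b :: "'a list"
  proof (cases "cylinder a \<inter> cylinder b = {}")
    case False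
    then obtain x where x: "prefix_of x (length a) = a" "prefix_of x (length b) = b"
      by (auto simp: in_cylinder_iff)
    then have "cylinder b \<subseteq> cylinder a"
      using that by (auto simp: in_cylinder_iff dest!: prefix_of_mono[OF _ that])
        (metis prefix_of_mono that)
    then show ?thesis by (auto simp: Int_absorb1)
  qed auto
  fix A B :: "(nat \<Rightarrow> 'a) set" assume "A \<in> insert {} (range cylinder)" "B \<in> insert {} (range cylinder)"
  then consider "A = {} \<or> B = {}" | a b where "A = cylinder a" "B = cylinder b" by blast
  then show "A \<inter> B \<in> insert {} (range cylinder)"
  proof cases
    case 2
    then show ?thesis using main[of a b] main[of b a] by (metis Int_commute nat_le_linear)
  qed auto
qed

lemma measure_eqI_cylinders:
  fixes \<mu> \<nu> :: "(nat \<Rightarrow> 'a::finite) measure"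
  assumes "prob_space \<mu>" "prob_space \<nu>" "sets \<mu> = sets seq_borel" "sets \<nu> = sets seq_borel"
    and eq: "\<And>a. measure \<mu> (cylinder a) = measure \<nu> (cylinder a)"
  shows "\<mu> = \<nu>"
proof -
  interpret \<mu>: prob_space \<mu> by fact
  interpret \<nu>: prob_space \<nu> by fact
  have U: "cylinder [] = (UNIV :: (nat \<Rightarrow> 'a) set)" by (auto simp: in_cylinder_iff)
  show ?thesis
  proof (rule measure_eqI_generator_eq[OF Int_stable_cylinders, of UNIV \<mu> \<nu> "\<lambda>_. UNIV"])
    show "emeasure \<mu> X = emeasure \<nu> X" if "X \<in> insert {} (range cylinder)" for X
      using that eq by (auto simp: \<mu>.emeasure_eq_measure \<nu>.emeasure_eq_measure)
    show "range (\<lambda>_. UNIV) \<subseteq> insert {} (range (cylinder :: 'a list \<Rightarrow> _))" using U by auto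
  qed (use assms sets_seq_borel_cylinders in auto)
qed

lemma measurable_into_seq_borel:
  fixes f :: "'b \<Rightarrow> nat \<Rightarrow> 'a::finite"
  assumes "\<And>a. f -` cylinder a \<inter> space M \<in> sets M"
  shows "f \<in> measurable M seq_borel"
proof -
  have "f \<in> measurable M (sigma UNIV (insert {} (range cylinder)))"
    using assms by (intro measurable_sigma_sets[where A="insert {} (range cylinder)"]) auto
  moreover have "measurable M (sigma UNIV (insert {} (range cylinder))) =
      measurable M (seq_borel :: (nat \<Rightarrow> 'a) measure)"
    by (rule measurable_cong_sets) (auto simp: sets_seq_borel_cylinders)
  ultimately show ?thesis by simp
qed

lemma shift_vimage_cylinder: "shift -` cylinder a = (\<Union>b\<in>UNIV. cylinder (b # a))"
  by (auto simp: in_cylinder_iff prefix_of_Suc_Cons)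

lemma measurable_shift: "shift \<in> measurable seq_borel (seq_borel :: (nat \<Rightarrow> 'a::finite) measure)"
  by (rule measurable_into_seq_borel) (simp add: shift_vimage_cylinder, measurable)

lemma measurable_continuous_seq:
  assumes "continuous_map seq_topology euclideanreal f"
  shows "f \<in> borel_measurable (seq_borel :: (nat \<Rightarrow> 'a) measure)"
proof (rule borel_measurableI)
  fix U :: "real set" assume "open U"
  then have "openin seq_topology {x. f x \<in> U}"
    using openin_continuous_map_preimage[OF assms, of U] by (simp add: seq_topology_def)
  then show "f -` U \<inter> space seq_borel \<in> sets seq_borel"
    by (auto simp: seq_borel_def vimage_def)
qed

lemma finite_range_expansion:
  assumes "finite C" "X x \<in> C"
  shows "(F (X x) :: real) = (\<Sum>c\<in>C. indicator (X -` {c}) x * F c)"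
proof -
  have "(\<Sum>c\<in>C. indicator (X -` {c}) x * F c) = (\<Sum>c\<in>C. if X x = c then F c else 0)"
    by (intro sum.cong) (auto simp: indicator_def)
  then show ?thesis using assms by simp
qed

lemma integrable_finite_range:
  assumes "prob_space M" "finite C" "\<And>x. X x \<in> C" "\<And>c. X -` {c} \<in> sets M"
  shows "integrable M (\<lambda>x. F (X x) :: real)"
proof -
  interpret prob_space M by fact
  have "integrable M (\<lambda>x. \<Sum>c\<in>C. indicator (X -` {c}) x * F c)"
    using assms(4)
    by (intro Bochner_Integration.integrable_sum integrable_mult_left integrable_real_indicator)
      (auto simp: less_top[symmetric])
  then show ?thesis
    unfolding finite_range_expansion[of C X, OF assms(2,3), symmetric] .
qed

lemma integral_finite_range:
  assumes "prob_space M" "finite C" "\<And>x. X x \<in> C" "\<And>c. X -` {c} \<in> sets M"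
  shows "(\<integral>x. F (X x) \<partial>M) = (\<Sum>c\<in>C. measure M (X -` {c}) * (F c :: real))"
proof -
  interpret prob_space M by fact
  have "(\<integral>x. F (X x) \<partial>M) = (\<integral>x. (\<Sum>c\<in>C. indicator (X -` {c}) x * F c) \<partial>M)"
    unfolding finite_range_expansion[of C X, OF assms(2,3), symmetric] ..
  also have "\<dots> = (\<Sum>c\<in>C. (\<integral>x. indicator (X -` {c}) x * F c \<partial>M))"
    using assms(4)
    by (intro Bochner_Integration.integral_sum integrable_mult_left integrable_real_indicator)
      (auto simp: less_top[symmetric])
  also have "\<dots> = (\<Sum>c\<in>C. measure M (X -` {c}) * F c)"
    using assms(4) sets.sets_into_space[OF assms(4)] by (intro sum.cong) (auto simp: Int_absorb2)
  finally show ?thesis .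
qed

lemma measure_split_finite:
  assumes "prob_space M" "finite C" "\<And>x. X x \<in> C" "\<And>c. X -` {c} \<in> sets M" "B \<in> sets M"
  shows "(\<Sum>c\<in>C. measure M (B \<inter> X -` {c})) = measure M B"
proof -
  interpret prob_space M by fact
  have "measure M (\<Union>c\<in>C. B \<inter> X -` {c}) = (\<Sum>c\<in>C. measure M (B \<inter> X -` {c}))"
    using assms by (intro finite_measure_finite_Union) (auto simp: disjoint_family_on_def)
  moreover have "(\<Union>c\<in>C. B \<inter> X -` {c}) = B" using assms(3) by auto
  ultimately show ?thesis by simp
qed

text \<open>
  Labels of arbitrary type cover both itineraries with respect to a partition and, with the first
  coordinate as label, the prefixes of the sequence itself.
\<close>

definition label_word :: "((nat \<Rightarrow> 'a) \<Rightarrow> 'c) \<Rightarrow> nat \<Rightarrow> (nat \<Rightarrow> 'a) \<Rightarrow> 'c list" where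
  "label_word f n x = map (\<lambda>i. f ((shift ^^ i) x)) [0..<n]"

definition label_law :: "(nat \<Rightarrow> 'a) measure \<Rightarrow> ((nat \<Rightarrow> 'a) \<Rightarrow> 'c) \<Rightarrow> 'c list \<Rightarrow> real" where
  "label_law \<nu> f w = measure \<nu> (label_word f (length w) -` {w})"

lemma length_label_word [simp]: "length (label_word f n x) = n"
  by (simp add: label_word_def)

lemma label_word_itinerary: "itinerary p = label_word p"
  by (simp add: fun_eq_iff itinerary_def label_word_def)

lemma label_word_prefix: "label_word (\<lambda>x. x 0) n x = prefix_of x n"
  by (simp add: label_word_def prefix_of_def funpow_shift)

lemma label_law_cylinder: "label_law \<nu> (\<lambda>x. x 0) = cyl_prob \<nu>"
  by (simp add: fun_eq_iff label_law_def cyl_prob_def label_word_prefix cylinder_def vimage_def)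

lemma label_word_Suc_Cons: "label_word f (Suc n) x = f x # label_word f n (shift x)"
proof -
  have "[0..<Suc n] = 0 # map Suc [0..<n]" by (simp add: upt_conv_Cons map_Suc_upt)
  then show ?thesis by (simp add: label_word_def funpow_swap1 del: upt_Suc)
qed

lemma label_word_Suc_snoc: "label_word f (Suc n) x = label_word f n x @ [f ((shift ^^ n) x)]"
  by (simp add: label_word_def)

lemma label_word_nth: "i < n \<Longrightarrow> label_word f n x ! i = f ((shift ^^ i) x)"
  by (simp add: label_word_def)

locale shift_invariant =
  fixes \<nu> :: "(nat \<Rightarrow> 'a::finite) measure"
  assumes invariant: "\<nu> \<in> invariant_measures"
begin

sublocale prob_space \<nu>
  using invariant by (simp add: invariant_measures_def)

lemma sets_eq: "sets \<nu> = sets seq_borel"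
  using invariant by (simp add: invariant_measures_def)

lemma space_eq [simp]: "space \<nu> = UNIV"
  using sets_eq_imp_space_eq[OF sets_eq] by simp

lemma shift_measurable: "shift \<in> measurable \<nu> \<nu>"
  using measurable_shift by (simp add: measurable_cong_sets[OF sets_eq sets_eq])

lemma shift_funpow_measurable: "shift ^^ i \<in> measurable \<nu> \<nu>"
proof (induction i)
  case (Suc i)
  then have "shift \<circ> (shift ^^ i) \<in> measurable \<nu> \<nu>" by (rule measurable_comp[OF _ shift_measurable])
  then show ?case by (simp add: comp_def)
qed (simp add: id_def)

lemma distr_shift: "distr \<nu> \<nu> shift = \<nu>"
  using invariant by (simp add: invariant_measures_def)

lemma vimage_shift_sets: "B \<in> sets \<nu> \<Longrightarrow> shift -` B \<in> sets \<nu>"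
  using measurable_sets[OF shift_measurable] by simp

lemma vimage_funpow_sets: "B \<in> sets \<nu> \<Longrightarrow> (shift ^^ i) -` B \<in> sets \<nu>"
  using measurable_sets[OF shift_funpow_measurable] by simp

lemma measure_shift: "B \<in> sets \<nu> \<Longrightarrow> measure \<nu> (shift -` B) = measure \<nu> B"
  using measure_distr[OF shift_measurable, of B] by (simp add: distr_shift)

lemma integral_shift:
  assumes "f \<in> borel_measurable \<nu>"
  shows "(\<integral>x. f (shift x) \<partial>\<nu>) = (\<integral>x. f x \<partial>\<nu> :: real)"
  using integral_distr[OF shift_measurable assms] by (simp add: distr_shift)

lemma integral_funpow_shift:
  assumes "f \<in> borel_measurable \<nu>"
  shows "(\<integral>x. f ((shift ^^ i) x) \<partial>\<nu>) = (\<integral>x. f x \<partial>\<nu> :: real)"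
proof (induction i)
  case (Suc i)
  have "(\<lambda>x. f ((shift ^^ i) x)) \<in> borel_measurable \<nu>"
    using measurable_compose[OF shift_funpow_measurable assms] .
  from integral_shift[OF this] Suc show ?case by (simp add: funpow_swap1)
qed simp

lemma cylinder_sets [measurable]: "cylinder a \<in> sets \<nu>"
  by (simp add: sets_eq)

lemma label_word_sets:
  assumes "\<And>c. f -` {c} \<in> sets \<nu>"
  shows "label_word f n -` {w} \<in> sets \<nu>"
proof (induction n arbitrary: w)
  case 0
  have "label_word f 0 -` {w} = (if w = [] then UNIV else {})"
    by (auto simp: label_word_def)
  then show ?case using sets.top[of \<nu>] by simp
next
  case (Suc n)
  have "label_word f (Suc n) -` {w} =
      (if w = [] then {} else f -` {hd w} \<inter> shift -` (label_word f n -` {tl w}))"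
    by (cases w) (auto simp: label_word_Suc_Cons)
  then show ?case using assms vimage_shift_sets[OF Suc] by auto
qed

lemma prefix_of_sets: "(\<lambda>x. prefix_of x n) -` {w} \<in> sets \<nu>"
proof -
  have "(\<lambda>x. x 0) -` {c :: 'a} = cylinder [c]" for c by (auto simp: in_cylinder_nth)
  then have "(\<lambda>x. x 0) -` {c :: 'a} \<in> sets \<nu>" for c by simp
  from label_word_sets[OF this] show ?thesis by (simp add: label_word_prefix[abs_def])
qed

lemma stationary_label_law:
  assumes fin: "finite (range f)" and f: "\<And>c. f -` {c} \<in> sets \<nu>"
  shows "stationary_law (range f) (label_law \<nu> f)"
proof
  show "label_law \<nu> f [] = 1"
    using prob_space by (simp add: label_law_def label_word_def vimage_def)
  fix w assume "set w \<subseteq> range f"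
  let ?B = "label_word f (length w) -` {w}"
  have B: "?B \<in> sets \<nu>" by (rule label_word_sets[OF f])
  have "(\<lambda>x. f ((shift ^^ length w) x)) -` {c} \<in> sets \<nu>" for c
    using vimage_funpow_sets[OF f[of c], of "length w"] by (simp add: vimage_def)
  then have "(\<Sum>c\<in>range f. measure \<nu> (?B \<inter> (\<lambda>x. f ((shift ^^ length w) x)) -` {c})) = measure \<nu> ?B"
    by (intro measure_split_finite[OF prob_space_axioms fin _ _ B]) auto
  moreover have "?B \<inter> (\<lambda>x. f ((shift ^^ length w) x)) -` {c} = label_word f (length (w @ [c])) -` {w @ [c]}" for c
    by (auto simp: label_word_Suc_snoc)
  ultimately show "(\<Sum>b\<in>range f. label_law \<nu> f (w @ [b])) = label_law \<nu> f w"
    by (simp add: label_law_def)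
  have "(\<Sum>c\<in>range f. measure \<nu> (shift -` ?B \<inter> f -` {c})) = measure \<nu> (shift -` ?B)"
    by (intro measure_split_finite[OF prob_space_axioms fin _ _ vimage_shift_sets[OF B]] f) auto
  moreover have "shift -` ?B \<inter> f -` {c} = label_word f (length (c # w)) -` {c # w}" for c
    by (auto simp: label_word_Suc_Cons)
  ultimately show "(\<Sum>b\<in>range f. label_law \<nu> f (b # w)) = label_law \<nu> f w"
    by (simp add: label_law_def measure_shift[OF B])
qed (auto simp: label_law_def fin)

lemma stationary_cyl_prob: "stationary_law UNIV (cyl_prob \<nu>)"
proof -
  have *: "(\<lambda>x. x 0) -` {c :: 'a} = cylinder [c]" for c by (auto simp: in_cylinder_nth)
  have "range (\<lambda>x :: nat \<Rightarrow> 'a. x 0) = UNIV" by (auto intro!: range_eqI[of _ _ "\<lambda>_. _"])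
  with stationary_label_law[of "\<lambda>x. x 0"] * show ?thesis by (simp add: label_law_cylinder)
qed

lemma integral_prefix:
  "(\<integral>x. F (prefix_of x n) \<partial>\<nu>) = (\<Sum>w\<in>words UNIV n. cyl_prob \<nu> w * F w)"
proof -
  have "(\<integral>x. F (prefix_of x n) \<partial>\<nu>) =
      (\<Sum>w\<in>words UNIV n. measure \<nu> ((\<lambda>x. prefix_of x n) -` {w}) * F w)"
    by (rule integral_finite_range[OF prob_space_axioms finite_words _ prefix_of_sets])
      (simp_all add: words_UNIV)
  also have "\<dots> = (\<Sum>w\<in>words UNIV n. cyl_prob \<nu> w * F w)"
    by (intro sum.cong) (auto simp: words_UNIV cyl_prob_def cylinder_def vimage_def)
  finally show ?thesis .
qed

lemma integrable_prefix: "integrable \<nu> (\<lambda>x. F (prefix_of x n) :: real)"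
  by (rule integrable_finite_range[OF prob_space_axioms finite_words[of UNIV n] _ prefix_of_sets])
    (simp_all add: words_UNIV)

text \<open>
  Words that are no itinerary have probability \<open>0\<close>, so the entropy of the join may be computed over all words
  in the labels.
\<close>

lemma join_entropy_eq:
  assumes fin: "finite (range p)"
  shows "join_entropy \<nu> p n = block_entropy (range p) (label_law \<nu> p) n"
proof -
  have "(\<Sum>w\<in>words (range p) n. label_law \<nu> p w * ln (label_law \<nu> p w)) =
     (\<Sum>w\<in>range (itinerary p n). label_law \<nu> p w * ln (label_law \<nu> p w))"
  proof (rule sum.mono_neutral_right)
    show "range (itinerary p n) \<subseteq> words (range p) n"
      by (auto simp: words_def label_word_itinerary label_word_def)
    show "\<forall>w\<in>words (range p) n - range (itinerary p n). label_law \<nu> p w * ln (label_law \<nu> p w) = 0"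
    proof
      fix w assume w: "w \<in> words (range p) n - range (itinerary p n)"
      then have "length w = n" "w \<notin> range (label_word p n)"
        by (auto simp: words_def label_word_itinerary)
      then have "label_word p (length w) x \<noteq> w" for x by (metis rangeI)
      then have "label_word p (length w) -` {w} = {}" by (simp add: vimage_def)
      then show "label_law \<nu> p w * ln (label_law \<nu> p w) = 0" by (simp add: label_law_def)
    qed
  qed (simp add: finite_words fin)
  also have "\<dots> = (\<Sum>w\<in>range (itinerary p n).
          measure \<nu> (itinerary p n -` {w}) * ln (measure \<nu> (itinerary p n -` {w})))"
    by (intro sum.cong refl) (auto simp: label_law_def label_word_itinerary)
  finally show ?thesis by (simp add: join_entropy_def block_entropy_def)
qed

end


section \<open>Kolmogorov-Sinai entropy and block entropies\<close>

text \<open>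
  One summand of an entropy is controlled by the variance of an event of probability \<open>t\<close>.  The proof uses \<open>- ln r \<le> 1 / r - 1\<close> at
  \<open>r = sqrt t\<close> and the inequality between arithmetic and geometric mean with weight \<open>\<eta>\<close>.
\<close>

lemma entropy_summand_bound:
  fixes t \<eta> :: real
  assumes "0 \<le> t" "t \<le> 1" "\<eta> > 0"
  shows "- (t * ln t) \<le> t * (1 - t) / \<eta> + \<eta>"
proof (cases "t = 0")
  case False
  define r where "r = sqrt t"
  have r: "0 < r" "r \<le> 1" "t = r\<^sup>2" using assms False by (auto simp: r_def)
  have "ln (1 / r) \<le> 1 / r - 1" using r by (intro ln_le_minus_one) auto
  then have "2 * r\<^sup>2 * ln (1 / r) \<le> 2 * r\<^sup>2 * (1 / r - 1)" using r by (intro mult_left_mono) auto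
  also have "\<dots> = 2 * (r * (1 - r))"
  proof -
    have "r * (1 / r) = 1" using r by simp
    then show ?thesis by algebra
  qed
  finally have "2 * r\<^sup>2 * ln (1 / r) \<le> 2 * (r * (1 - r))" .
  moreover have "ln t = 2 * ln r" "ln (1 / r) = - ln r"
    using r by (simp_all add: ln_realpow ln_div)
  ultimately have "- (t * ln t) \<le> 2 * (r * (1 - r))"
    using r(3) by (simp only:)
  also have "2 * (r * (1 - r)) \<le> (r * (1 - r))\<^sup>2 / \<eta> + \<eta>"
  proof -
    have square: "(a - \<eta>)\<^sup>2 / \<eta> = a\<^sup>2 / \<eta> + \<eta> - 2 * a" for a
      using assms by (simp add: field_simps power2_eq_square)
    have "0 \<le> (r * (1 - r) - \<eta>)\<^sup>2 / \<eta>" using assms by simp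
    also note square
    finally show ?thesis by simp
  qed
  also have "(r * (1 - r))\<^sup>2 \<le> t * (1 - t)"
  proof -
    have "(1 - r) * (1 - r) \<le> (1 - r) * (1 + r)" using r by (intro mult_left_mono) auto
    then have "r\<^sup>2 * (1 - r)\<^sup>2 \<le> r\<^sup>2 * (1 - r\<^sup>2)"
      by (intro mult_left_mono) (auto simp: power2_eq_square algebra_simps)
    then show ?thesis by (simp add: r(3) power_mult_distrib)
  qed
  finally show ?thesis using assms by (simp add: divide_right_mono)
qed (use assms in auto)

lemma sum_words_prod_le_1:
  assumes "finite S" "\<And>i l. 0 \<le> F i l" "\<And>i. (\<Sum>l\<in>S. F i l) \<le> (1 :: real)"
  shows "(\<Sum>u\<in>words S n. \<Prod>i<n. F i (u ! i)) \<le> 1"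
proof (induction n)
  case (Suc n)
  have "(\<Sum>u\<in>words S (Suc n). \<Prod>i<Suc n. F i (u ! i)) =
      (\<Sum>u\<in>words S n. (\<Prod>i<n. F i (u ! i)) * (\<Sum>l\<in>S. F n l))"
    unfolding sum_words_snoc[OF assms(1)] sum_distrib_left
    by (intro sum.cong refl) (auto simp: words_def nth_append)
  also have "\<dots> \<le> (\<Sum>u\<in>words S n. (\<Prod>i<n. F i (u ! i)) * 1)"
    by (intro sum_mono mult_left_mono assms prod_nonneg)
  finally show ?case using Suc by simp
qed simp

context shift_invariant
begin

lemma prefix_event_sets: "prefix_event m W \<in> sets \<nu>"
  by (simp add: sets_eq prefix_event_in_sets)

text \<open>
  The sets with this property contain the cylinders and are closed under complements and countable
  unions.
\<close>

lemma approximation_by_prefix_events: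
  assumes "B \<in> sets \<nu>" "\<delta> > 0"
  shows "\<exists>m W. measure \<nu> ((B - prefix_event m W) \<union> (prefix_event m W - B)) < \<delta>"
proof -
  have "B \<in> sigma_sets UNIV (insert {} (range cylinder))"
    using assms(1) by (simp add: sets_eq sets_seq_borel_cylinders)
  then show ?thesis using assms(2)
  proof (induction arbitrary: \<delta>)
    case (Basic B)
    then consider "B = {}" | a where "B = cylinder a" by blast
    then show ?case
    proof cases
      case 1
      then show ?thesis using Basic by (intro exI[of _ 0] exI[of _ "{}"]) (simp add: prefix_event_def)
    next
      case 2
      then have "B = prefix_event (length a) {a}" by (auto simp: prefix_event_def in_cylinder_iff)
      then show ?thesis using Basic by (intro exI[of _ "length a"] exI[of _ "{a}"]) simp
    qed
  next
    case Empty
    then show ?case by (intro exI[of _ 0] exI[of _ "{}"]) (simp add: prefix_event_def)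
  next
    case (Compl B)
    then obtain m W where *: "measure \<nu> ((B - prefix_event m W) \<union> (prefix_event m W - B)) < \<delta>" by blast
    have "(UNIV - B - prefix_event m (- W)) \<union> (prefix_event m (- W) - (UNIV - B)) =
        (B - prefix_event m W) \<union> (prefix_event m W - B)"
      by (auto simp: prefix_event_def)
    then show ?case using * by (intro exI[of _ m] exI[of _ "- W"]) simp
  next
    case (Union B)
    have B: "B i \<in> sets \<nu>" for i
      using Union by (simp add: sets_eq sets_seq_borel_cylinders)
    have "(\<lambda>n. measure \<nu> (\<Union>i<n. B i)) \<longlonglongrightarrow> measure \<nu> (\<Union>n. \<Union>i<n. B i)"
      by (rule finite_Lim_measure_incseq) (auto simp: incseq_def B intro: less_le_trans)
    moreover have "(\<Union>n. \<Union>i<n. B i) = (\<Union>i. B i)" by blast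
    ultimately have "(\<lambda>n. measure \<nu> (\<Union>i<n. B i)) \<longlonglongrightarrow> measure \<nu> (\<Union>i. B i)" by simp
    from LIMSEQ_D[OF this, of "\<delta>/2"] \<open>0 < \<delta>\<close> obtain N where
      N: "\<bar>measure \<nu> (\<Union>i<N. B i) - measure \<nu> (\<Union>i. B i)\<bar> < \<delta> / 2" by auto
    have "measure \<nu> ((\<Union>i. B i) - (\<Union>i<N. B i)) = measure \<nu> (\<Union>i. B i) - measure \<nu> (\<Union>i<N. B i)"
      by (rule finite_measure_Diff) (auto simp: B)
    with N have N': "measure \<nu> ((\<Union>i. B i) - (\<Union>i<N. B i)) < \<delta> / 2" by linarith
    define d where "d = \<delta> / (2 * (real N + 1))"
    have "d > 0" using \<open>0 < \<delta>\<close> by (simp add: d_def)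
    have "\<forall>i. \<exists>m W. measure \<nu> ((B i - prefix_event m W) \<union> (prefix_event m W - B i)) < d"
      using Union.IH \<open>d > 0\<close> by blast
    then obtain m W where mW:
      "\<And>i. measure \<nu> ((B i - prefix_event (m i) (W i)) \<union> (prefix_event (m i) (W i) - B i)) < d" by metis
    define M where "M = (\<Sum>i<N. m i)"
    define V where "V = (\<Union>i<N. {w. take (m i) w \<in> W i})"
    have mM: "m i \<le> M" if "i < N" for i
      unfolding M_def using that by (intro member_le_sum) auto
    have V: "prefix_event M V = (\<Union>i<N. prefix_event (m i) (W i))"
      using mM by (auto simp: prefix_event_def V_def prefix_of_def take_map take_upt)
    let ?D = "\<lambda>i. (B i - prefix_event (m i) (W i)) \<union> (prefix_event (m i) (W i) - B i)"
    have D: "?D i \<in> sets \<nu>" for i using B prefix_event_sets by blast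
    have "(\<Union>i<N. ?D i) \<in> sets \<nu>" using D by blast
    have "measure \<nu> (((\<Union>i. B i) - prefix_event M V) \<union> (prefix_event M V - (\<Union>i. B i))) \<le>
        measure \<nu> (((\<Union>i. B i) - (\<Union>i<N. B i)) \<union> (\<Union>i<N. ?D i))"
      unfolding V by (rule finite_measure_mono) (use B D in auto)
    also have "\<dots> \<le> measure \<nu> ((\<Union>i. B i) - (\<Union>i<N. B i)) + measure \<nu> (\<Union>i<N. ?D i)"
      by (rule measure_Un_le) (use B D in auto)
    also have "measure \<nu> (\<Union>i<N. ?D i) \<le> (\<Sum>i<N. measure \<nu> (?D i))"
      by (rule finite_measure_subadditive_finite) (use D in auto)
    also have "\<dots> \<le> (\<Sum>i<N. d)" by (intro sum_mono less_imp_le[OF mW])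
    also have "\<dots> \<le> \<delta> / 2"
      using \<open>0 < \<delta>\<close> by (simp add: d_def divide_simps)
    finally show ?case using N' by (intro exI[of _ M] exI[of _ V]) simp
  qed
qed

definition label_cond_prob :: "((nat \<Rightarrow> 'a) \<Rightarrow> 'c) \<Rightarrow> 'c \<Rightarrow> 'a list \<Rightarrow> real" where
  "label_cond_prob p l w = measure \<nu> (p -` {l} \<inter> cylinder w) / measure \<nu> (cylinder w)"

text \<open>
  This is the conditional entropy of the label of a point given its first \<open>m\<close> letters.
\<close>

definition label_cond_entropy :: "((nat \<Rightarrow> 'a) \<Rightarrow> 'c) \<Rightarrow> nat \<Rightarrow> real" where
  "label_cond_entropy p m = - (\<integral>x. ln (label_cond_prob p (p x) (prefix_of x m)) \<partial>\<nu>)"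

lemma label_prefix_vimage:
  "w \<in> words UNIV m \<Longrightarrow> (\<lambda>x. (p x, prefix_of x m)) -` {(l, w)} = p -` {l} \<inter> cylinder w"
  by (auto simp: words_UNIV in_cylinder_iff)

lemma label_prefix_sets:
  assumes "\<And>c. p -` {c} \<in> sets \<nu>"
  shows "(\<lambda>x. (p x, prefix_of x m)) -` {c} \<in> sets \<nu>"
proof -
  have "(\<lambda>x. (p x, prefix_of x m)) -` {c} = p -` {fst c} \<inter> (\<lambda>x. prefix_of x m) -` {snd c}"
    by (cases c) auto
  then show ?thesis using assms prefix_of_sets by auto
qed

lemma label_cond_entropy_sum:
  assumes fin: "finite (range p)" and p: "\<And>c. p -` {c} \<in> sets \<nu>"
  shows "label_cond_entropy p m = (\<Sum>l\<in>range p. \<Sum>w\<in>words UNIV m.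
      - (measure \<nu> (p -` {l} \<inter> cylinder w) * ln (label_cond_prob p l w)))"
proof -
  have "(\<integral>x. (\<lambda>(l, w). ln (label_cond_prob p l w)) (p x, prefix_of x m) \<partial>\<nu>) =
      (\<Sum>c\<in>range p \<times> words UNIV m. measure \<nu> ((\<lambda>x. (p x, prefix_of x m)) -` {c}) *
        (case c of (l, w) \<Rightarrow> ln (label_cond_prob p l w)))"
    by (rule integral_finite_range[OF prob_space_axioms _ _ label_prefix_sets[OF p]])
      (simp_all add: fin finite_words, simp add: words_UNIV)
  also have "\<dots> = (\<Sum>(l, w)\<in>range p \<times> words UNIV m.
      measure \<nu> (p -` {l} \<inter> cylinder w) * ln (label_cond_prob p l w))"
    by (intro sum.cong refl) (auto simp: label_prefix_vimage)
  finally show ?thesis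
    by (simp add: label_cond_entropy_def sum.cartesian_product sum_negf)
qed

lemma label_cond_prob_nonneg: "0 \<le> label_cond_prob p l w"
  by (simp add: label_cond_prob_def)

lemma sum_label_cond_prob:
  assumes fin: "finite (range p)" and p: "\<And>c. p -` {c} \<in> sets \<nu>"
  shows "(\<Sum>l\<in>range p. label_cond_prob p l w) \<le> 1"
proof -
  have "(\<Sum>l\<in>range p. measure \<nu> (cylinder w \<inter> p -` {l})) = measure \<nu> (cylinder w)"
    by (rule measure_split_finite[OF prob_space_axioms fin _ p]) auto
  then show ?thesis
    by (simp add: label_cond_prob_def sum_divide_distrib[symmetric] Int_commute)
qed

text \<open>
  If the cell \<open>B\<close> were a union of cylinders of length \<open>m\<close>, then its conditional probabilities would be \<open>0\<close> or \<open>1\<close> and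
  the left side would vanish.  In general, on the cylinder of \<open>w\<close> the product of conditional probability and
  complementary probability is at most the conditional probability of the symmetric difference.
\<close>

lemma label_cond_entropy_bound:
  assumes B: "B \<in> sets \<nu>" and "\<eta> > 0"
  shows "(\<Sum>w\<in>words UNIV m. - (measure \<nu> (B \<inter> cylinder w) *
        ln (measure \<nu> (B \<inter> cylinder w) / measure \<nu> (cylinder w)))) \<le>
      measure \<nu> ((B - prefix_event m W) \<union> (prefix_event m W - B)) / \<eta> + \<eta>"
proof -
  let ?D = "(B - prefix_event m W) \<union> (prefix_event m W - B)"
  have D: "?D \<in> sets \<nu>" using B prefix_event_sets by blast
  have "- (measure \<nu> (B \<inter> cylinder w) * ln (measure \<nu> (B \<inter> cylinder w) / measure \<nu> (cylinder w)))
      \<le> measure \<nu> (?D \<inter> (\<lambda>x. prefix_of x m) -` {w}) / \<eta> + \<eta> * measure \<nu> (cylinder w)"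
    if w: "w \<in> words UNIV m" for w
  proof (cases "measure \<nu> (cylinder w) = 0")
    case True
    then show ?thesis using \<open>\<eta> > 0\<close> by simp
  next
    case False
    define c s where "c = measure \<nu> (cylinder w)" and "s = measure \<nu> (B \<inter> cylinder w)"
    have c: "c > 0" using False by (simp add: c_def zero_less_measure_iff)
    have s: "0 \<le> s" "s \<le> c" unfolding s_def c_def by (auto intro!: finite_measure_mono)
    have cyl: "(\<lambda>x. prefix_of x m) -` {w} = cylinder w"
      using w by (auto simp: words_UNIV in_cylinder_iff)
    have "s * (1 - s / c) \<le> measure \<nu> (?D \<inter> cylinder w)"
    proof (cases "w \<in> W")
      case True
      then have "cylinder w - B \<inter> cylinder w \<subseteq> ?D \<inter> cylinder w"
        using w by (auto simp: words_UNIV in_cylinder_iff prefix_event_def)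
      then have "measure \<nu> (cylinder w - B \<inter> cylinder w) \<le> measure \<nu> (?D \<inter> cylinder w)"
        using B D by (intro finite_measure_mono) auto
      moreover have "measure \<nu> (cylinder w - B \<inter> cylinder w) = c - s"
        unfolding c_def s_def using B by (intro finite_measure_Diff) auto
      moreover have "s * (1 - s / c) \<le> c * (1 - s / c)" using s c by (intro mult_right_mono) auto
      moreover have "c * (1 - s / c) = c - s" using c by (simp add: field_simps)
      ultimately show ?thesis by linarith
    next
      case False
      then have "B \<inter> cylinder w \<subseteq> ?D \<inter> cylinder w"
        using w by (auto simp: words_UNIV in_cylinder_iff prefix_event_def)
      then have "s \<le> measure \<nu> (?D \<inter> cylinder w)"
        unfolding s_def using B D by (intro finite_measure_mono) auto
      moreover have "s * (1 - s / c) \<le> s * 1" using s c by (intro mult_left_mono) auto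
      ultimately show ?thesis by simp
    qed
    have "- (s * ln (s / c)) = c * - (s / c * ln (s / c))" using c by simp
    also have "\<dots> \<le> c * (s / c * (1 - s / c) / \<eta> + \<eta>)"
      using s c \<open>\<eta> > 0\<close> by (intro mult_left_mono entropy_summand_bound) auto
    also have "\<dots> = s * (1 - s / c) / \<eta> + \<eta> * c" using c by (simp add: distrib_left)
    also have "\<dots> \<le> measure \<nu> (?D \<inter> cylinder w) / \<eta> + \<eta> * c"
      using \<open>s * (1 - s / c) \<le> _\<close> \<open>\<eta> > 0\<close> by (simp add: divide_right_mono)
    finally show ?thesis by (simp add: c_def s_def cyl)
  qed
  then have "(\<Sum>w\<in>words UNIV m. - (measure \<nu> (B \<inter> cylinder w) *
        ln (measure \<nu> (B \<inter> cylinder w) / measure \<nu> (cylinder w)))) \<le>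
      (\<Sum>w\<in>words UNIV m. measure \<nu> (?D \<inter> (\<lambda>x. prefix_of x m) -` {w}) / \<eta> + \<eta> * measure \<nu> (cylinder w))"
    by (rule sum_mono)
  also have "\<dots> = measure \<nu> ?D / \<eta> + \<eta>"
  proof -
    have "(\<Sum>w\<in>words UNIV m. measure \<nu> (?D \<inter> (\<lambda>x. prefix_of x m) -` {w})) = measure \<nu> ?D"
      by (rule measure_split_finite[OF prob_space_axioms finite_words _ prefix_of_sets D])
        (auto simp: words_UNIV)
    moreover have "(\<Sum>w\<in>words UNIV m. measure \<nu> (cylinder w)) = 1"
      using stationary_law.sum_law[OF stationary_cyl_prob] by (simp add: cyl_prob_def)
    ultimately show ?thesis
      by (simp add: sum.distrib sum_divide_distrib[symmetric] sum_distrib_left[symmetric])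
  qed
  finally show ?thesis .
qed

lemma label_cond_entropy_small:
  assumes fin: "finite (range p)" and p: "\<And>c. p -` {c} \<in> sets \<nu>" and "\<delta> > 0"
  shows "\<exists>m. label_cond_entropy p m \<le> \<delta>"
proof -
  \<comment> \<open>Each of the cells contributes at most \<open>\<eta>\<^sup>2 / \<eta> + \<eta>\<close>.\<close>
  define \<eta> where "\<eta> = \<delta> / (2 * card (range p))"
  have c0: "card (range p) > 0" using fin by (simp add: card_gt_0_iff)
  have "\<eta> > 0" using \<open>\<delta> > 0\<close> c0 by (simp add: \<eta>_def)
  have "\<forall>l. \<exists>m W. measure \<nu> ((p -` {l} - prefix_event m W) \<union> (prefix_event m W - p -` {l})) < \<eta> * \<eta>"
    using approximation_by_prefix_events[OF p] \<open>\<eta> > 0\<close> by simp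
  then obtain m W where mW: "\<And>l. measure \<nu> ((p -` {l} - prefix_event (m l) (W l)) \<union>
      (prefix_event (m l) (W l) - p -` {l})) < \<eta> * \<eta>" by metis
  define M where "M = (\<Sum>l\<in>range p. m l)"
  have "label_cond_entropy p M = (\<Sum>l\<in>range p. \<Sum>w\<in>words UNIV M.
      - (measure \<nu> (p -` {l} \<inter> cylinder w) *
        ln (measure \<nu> (p -` {l} \<inter> cylinder w) / measure \<nu> (cylinder w))))"
    by (simp add: label_cond_entropy_sum[OF fin p] label_cond_prob_def)
  also have "\<dots> \<le> (\<Sum>l\<in>range p. 2 * \<eta>)"
  proof (rule sum_mono)
    fix l assume l: "l \<in> range p"
    have "m l \<le> M" unfolding M_def using fin l by (intro member_le_sum) auto
    from label_cond_entropy_bound[OF p \<open>\<eta> > 0\<close>, of l M "{w. take (m l) w \<in> W l}"]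
    have "(\<Sum>w\<in>words UNIV M. - (measure \<nu> (p -` {l} \<inter> cylinder w) *
        ln (measure \<nu> (p -` {l} \<inter> cylinder w) / measure \<nu> (cylinder w)))) \<le>
        measure \<nu> ((p -` {l} - prefix_event (m l) (W l)) \<union> (prefix_event (m l) (W l) - p -` {l})) / \<eta> + \<eta>"
      by (simp only: prefix_event_extend[OF \<open>m l \<le> M\<close>])
    also have "\<dots> \<le> \<eta> * \<eta> / \<eta> + \<eta>"
      using mW[of l] \<open>\<eta> > 0\<close> by (intro add_right_mono divide_right_mono) auto
    finally show "(\<Sum>w\<in>words UNIV M. - (measure \<nu> (p -` {l} \<inter> cylinder w) *
        ln (measure \<nu> (p -` {l} \<inter> cylinder w) / measure \<nu> (cylinder w)))) \<le> 2 * \<eta>"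
      using \<open>\<eta> > 0\<close> by simp
  qed
  also have "\<dots> = \<delta>" using c0 by (simp add: \<eta>_def)
  finally show ?thesis by blast
qed

lemma measure_funpow_shift: "B \<in> sets \<nu> \<Longrightarrow> measure \<nu> ((shift ^^ i) -` B) = measure \<nu> B"
proof (induction i arbitrary: B)
  case (Suc i)
  have "(shift ^^ Suc i) -` B = shift -` ((shift ^^ i) -` B)"
    by (simp only: funpow_Suc_right vimage_comp)
  then show ?case
    using Suc.IH[OF Suc.prems] measure_shift[OF vimage_funpow_sets[OF Suc.prems]] by metis
qed simp

lemma distr_funpow_shift: "distr \<nu> \<nu> (shift ^^ i) = \<nu>"
proof (rule measure_eqI)
  fix B assume "B \<in> sets (distr \<nu> \<nu> (shift ^^ i))"
  then show "emeasure (distr \<nu> \<nu> (shift ^^ i)) B = emeasure \<nu> B"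
    by (simp add: emeasure_distr[OF shift_funpow_measurable] emeasure_eq_measure measure_funpow_shift)
qed simp

lemma prefix_of_funpow_shift: "i + m \<le> n \<Longrightarrow> prefix_of ((shift ^^ i) x) m = take m (drop i (prefix_of x n))"
  by (auto simp: list_eq_iff_nth_eq funpow_shift add.commute)

text \<open>
  Given the first \<open>n + m\<close> letters, the entropy of each label is at most its entropy given only the \<open>m\<close> letters
  from its position on, which is \<open>label_cond_entropy p m\<close>.  Formally, the joint law of labels and letters is compared by the Gibbs inequality
  with the law \<open>Q\<close> under which the labels are conditionally independent with these conditional laws.
\<close>

lemma join_entropy_le:
  fixes p :: "(nat \<Rightarrow> 'a) \<Rightarrow> nat"
  assumes fin: "finite (range p)" and p: "\<And>c. p -` {c} \<in> sets \<nu>"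
  shows "join_entropy \<nu> p n \<le> block_entropy UNIV (cyl_prob \<nu>) (n + m) + real n * label_cond_entropy p m"
proof -
  define X where "X x = (label_word p n x, prefix_of x (n + m))" for x
  define C where "C = words (range p) n \<times> (words UNIV (n + m) :: 'a list set)"
  define PX where "PX c = measure \<nu> (X -` {c})" for c
  let ?L = "label_law \<nu> p"
  let ?R = "\<lambda>u v i. label_cond_prob p (u ! i) (take m (drop i v))"
  define Q where "Q = (\<lambda>(u, v). cyl_prob \<nu> v * (\<Prod>i<n. ?R u v i))"
  have finC: "finite C" by (simp add: C_def finite_words fin)
  have XC: "X x \<in> C" for x
    by (auto simp: X_def C_def words_def label_word_def)
  have X: "X -` {c} \<in> sets \<nu>" for c
  proof -
    have "X -` {c} = label_word p n -` {fst c} \<inter> (\<lambda>x. prefix_of x (n + m)) -` {snd c}"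
      by (cases c) (auto simp: X_def)
    then show ?thesis using label_word_sets[OF p] prefix_of_sets by auto
  qed
  have int: "(\<integral>x. F (X x) \<partial>\<nu>) = (\<Sum>c\<in>C. PX c * F c)" for F :: "_ \<Rightarrow> real"
    unfolding PX_def by (rule integral_finite_range[OF prob_space_axioms finC XC X])
  have PX0: "PX c \<ge> 0" for c by (simp add: PX_def)
  have Q0: "Q c \<ge> 0" for c
    by (cases c) (auto simp: Q_def cyl_prob_def intro!: mult_nonneg_nonneg prod_nonneg label_cond_prob_nonneg)
  have pos: "cyl_prob \<nu> v > 0 \<and> (\<forall>i<n. ?R u v i > 0)" if c: "(u, v) \<in> C" "PX (u, v) > 0" for u v
  proof
    have "X -` {(u, v)} \<subseteq> cylinder v" using c by (auto simp: X_def C_def words_UNIV in_cylinder_iff)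
    then have "PX (u, v) \<le> cyl_prob \<nu> v"
      unfolding PX_def cyl_prob_def by (rule finite_measure_mono) simp
    then show "cyl_prob \<nu> v > 0" using c by linarith
    show "\<forall>i<n. ?R u v i > 0"
    proof (intro allI impI)
      fix i assume i: "i < n"
      let ?E = "p -` {u ! i} \<inter> cylinder (take m (drop i v))"
      have E: "?E \<in> sets \<nu>" using p by auto
      have "X -` {(u, v)} \<subseteq> (shift ^^ i) -` ?E"
      proof
        fix x assume "x \<in> X -` {(u, v)}"
        then have "label_word p n x = u" "prefix_of x (n + m) = v" by (auto simp: X_def)
        then have "p ((shift ^^ i) x) = u ! i" "prefix_of ((shift ^^ i) x) m = take m (drop i v)"
          using i label_word_nth[of i n p x] prefix_of_funpow_shift[of i m "n + m" x] by auto
        moreover have "length (take m (drop i v)) = m"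
          using c i by (simp add: C_def words_def)
        ultimately show "x \<in> (shift ^^ i) -` ?E" by (simp add: in_cylinder_iff)
      qed
      then have "PX (u, v) \<le> measure \<nu> ((shift ^^ i) -` ?E)"
        unfolding PX_def using vimage_funpow_sets[OF E] by (rule finite_measure_mono)
      then have "measure \<nu> ?E > 0" using c measure_funpow_shift[OF E, of i] by linarith
      moreover have "measure \<nu> ?E \<le> measure \<nu> (cylinder (take m (drop i v)))"
        by (rule finite_measure_mono) auto
      ultimately show "?R u v i > 0" by (simp add: label_cond_prob_def)
    qed
  qed
  have "sum Q C = (\<Sum>v\<in>words UNIV (n + m). cyl_prob \<nu> v * (\<Sum>u\<in>words (range p) n. \<Prod>i<n. ?R u v i))"
    unfolding C_def Q_def sum.cartesian_product[symmetric] sum_distrib_left by (rule sum.swap)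
  also have "\<dots> \<le> (\<Sum>v\<in>words UNIV (n + m). cyl_prob \<nu> v * 1)"
    by (intro sum_mono mult_left_mono sum_words_prod_le_1[of "range p"
          "\<lambda>i l. label_cond_prob p l (take m (drop i _))"] fin label_cond_prob_nonneg
          sum_label_cond_prob[OF fin p]) (auto simp: cyl_prob_def)
  also have "\<dots> = 1" using stationary_law.sum_law[OF stationary_cyl_prob] by simp
  also have "1 = sum PX C" using int[of "\<lambda>_. 1"] prob_space by simp
  finally have QP: "sum Q C \<le> sum PX C" .
  have "(\<Sum>c\<in>C. PX c * ln (Q c)) \<le> (\<Sum>c\<in>C. PX c * ln (PX c))"
  proof (rule gibbs_inequality[OF PX0 Q0 _ QP])
    fix c assume "c \<in> C" "0 < PX c"
    then show "0 < Q c" using pos[of "fst c" "snd c"]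
      by (auto simp: Q_def case_prod_unfold intro!: mult_pos_pos prod_pos)
  qed
  also have "\<dots> \<le> (\<Sum>c\<in>C. PX c * ln (?L (fst c)))"
  proof (rule sum_mono)
    fix c assume c: "c \<in> C"
    show "PX c * ln (PX c) \<le> PX c * ln (?L (fst c))"
    proof (cases "PX c = 0")
      case False
      then have "PX c > 0" using PX0[of c] by simp
      moreover have "PX c \<le> ?L (fst c)"
        unfolding PX_def label_law_def using c
        by (intro finite_measure_mono label_word_sets p) (auto simp: X_def C_def words_def)
      ultimately show ?thesis by (intro mult_left_mono) auto
    qed simp
  qed
  also have "\<dots> = (\<integral>x. ln (?L (label_word p n x)) \<partial>\<nu>)" by (simp add: int[symmetric] X_def)
  also have "\<dots> = (\<Sum>u\<in>words (range p) n. measure \<nu> (label_word p n -` {u}) * ln (?L u))"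
    by (rule integral_finite_range[OF prob_space_axioms finite_words[OF fin] _ label_word_sets[OF p]])
      (auto simp: words_def label_word_def)
  also have "\<dots> = - join_entropy \<nu> p n"
    unfolding join_entropy_eq[OF fin] block_entropy_def
    by (simp, intro sum.cong) (auto simp: words_def label_law_def)
  finally have main: "(\<Sum>c\<in>C. PX c * ln (Q c)) \<le> - join_entropy \<nu> p n" .
  let ?G = "\<lambda>x. ln (label_cond_prob p (p x) (prefix_of x m))"
  have Gint: "integrable \<nu> ?G"
  proof -
    have "finite (range p \<times> (words UNIV m :: 'a list set))" by (simp add: fin finite_words)
    from integrable_finite_range[OF prob_space_axioms this _ label_prefix_sets[OF p],
        of m "\<lambda>(l, w). ln (label_cond_prob p l w)"]
    show ?thesis by (simp add: words_UNIV)
  qed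
  have "(\<Sum>c\<in>C. PX c * ln (Q c)) =
      (\<Sum>c\<in>C. PX c * (\<lambda>(u, v). ln (cyl_prob \<nu> v) + (\<Sum>i<n. ln (?R u v i))) c)"
  proof (rule sum.cong[OF refl])
    fix c assume c: "c \<in> C"
    obtain u v where uv: "c = (u, v)" by (cases c)
    show "PX c * ln (Q c) = PX c * (\<lambda>(u, v). ln (cyl_prob \<nu> v) + (\<Sum>i<n. ln (?R u v i))) c"
    proof (cases "PX c = 0")
      case False
      then have "PX (u, v) > 0" using PX0[of c] uv by simp
      from pos[OF _ this] c uv have v: "cyl_prob \<nu> v > 0" and R: "\<And>i. i < n \<Longrightarrow> ?R u v i > 0"
        by auto
      have "ln (Q c) = ln (cyl_prob \<nu> v) + (\<Sum>i<n. ln (?R u v i))"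
      proof -
        have "ln (\<Prod>i<n. ?R u v i) = (\<Sum>i<n. ln (?R u v i))" by (rule ln_prod) (auto dest: R)
        moreover have "(\<Prod>i<n. ?R u v i) > 0" using R by (auto intro: prod_pos)
        ultimately show ?thesis using v unfolding uv Q_def by (simp add: ln_mult_pos)
      qed
      then show ?thesis by (simp add: uv)
    qed simp
  qed
  also have "\<dots> = (\<integral>x. ln (cyl_prob \<nu> (prefix_of x (n + m))) +
      (\<Sum>i<n. ?G ((shift ^^ i) x)) \<partial>\<nu>)"
    unfolding int[symmetric]
    by (intro Bochner_Integration.integral_cong refl)
      (auto simp: X_def label_word_nth prefix_of_funpow_shift[of _ m "n + m"] intro!: sum.cong)
  also have "\<dots> = (\<integral>x. ln (cyl_prob \<nu> (prefix_of x (n + m))) \<partial>\<nu>) +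
      (\<Sum>i<n. \<integral>x. ?G ((shift ^^ i) x) \<partial>\<nu>)"
  proof -
    have 1: "integrable \<nu> (\<lambda>x. ?G ((shift ^^ i) x))" for i
      using integrable_distr[OF shift_funpow_measurable[of i], of "?G"] Gint
      by (simp add: distr_funpow_shift)
    have 2: "integrable \<nu> (\<lambda>x. ln (cyl_prob \<nu> (prefix_of x (n + m))))"
      by (rule integrable_prefix[of "\<lambda>w. ln (cyl_prob \<nu> w)"])
    show ?thesis using 1 2 by (simp add: Bochner_Integration.integral_sum)
  qed
  also have "\<dots> = - block_entropy UNIV (cyl_prob \<nu>) (n + m) - real n * label_cond_entropy p m"
    using integral_funpow_shift[of ?G] Gint
    by (simp add: integral_prefix[of "\<lambda>w. ln (cyl_prob \<nu> w)"] block_entropy_def label_cond_entropy_def)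
  finally show ?thesis using main by simp
qed

text \<open>
  The inequality of the Kolmogorov-Sinai generator theorem: every finite partition is approximated by partitions
  into cylinders, whose entropy rate is at most each increment of the block entropies.
\<close>

theorem KS_entropy_le_increment:
  "KS_entropy \<nu> \<le> ereal (entropy_increment UNIV (cyl_prob \<nu>) k)"
  unfolding KS_entropy_def
proof (rule SUP_least)
  interpret stationary_law UNIV "cyl_prob \<nu>" by (rule stationary_cyl_prob)
  fix p :: "(nat \<Rightarrow> 'a) \<Rightarrow> nat" assume "p \<in> {p. simple_function \<nu> p}"
  then have fin: "finite (range p)" and p: "p -` {c} \<in> sets \<nu>" for c
    using simple_functionD[of \<nu> p] by (auto dest: simple_functionD)
  from stationary_law.entropy_rate[OF stationary_label_law[OF fin p]]
  obtain l where l: "(\<lambda>n. join_entropy \<nu> p n / real n) \<longlonglongrightarrow> l"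
    by (auto simp: join_entropy_eq[OF fin])
  obtain r where r: "(\<lambda>n. H n / real n) \<longlonglongrightarrow> r" "r \<le> h k" using entropy_rate by blast
  have "l \<le> h k + \<delta>" if "\<delta> > 0" for \<delta>
  proof -
    obtain m where m: "label_cond_entropy p m \<le> \<delta>" using label_cond_entropy_small[OF fin p \<open>\<delta> > 0\<close>] by blast
    have *: "(\<lambda>n. H (n + m) / real (n + m) * (1 + real m / real n) + \<delta>) \<longlonglongrightarrow> r * (1 + 0) + \<delta>"
      by (intro tendsto_intros LIMSEQ_ignore_initial_segment[OF r(1)] lim_const_over_n)
    have "l \<le> r * (1 + 0) + \<delta>"
    proof (rule LIMSEQ_le[OF l *], intro exI[of _ 1] allI impI)
      fix n :: nat assume n: "1 \<le> n"
      have "join_entropy \<nu> p n \<le> H (n + m) + real n * \<delta>"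
        using join_entropy_le[OF fin p, of n m] mult_left_mono[OF m, of "real n"] by simp
      then have "join_entropy \<nu> p n / real n \<le> (H (n + m) + real n * \<delta>) / real n"
        by (rule divide_right_mono) simp
      also have "\<dots> = H (n + m) / real n + \<delta>" using n by (simp add: add_divide_distrib)
      also have "H (n + m) / real n = H (n + m) / real (n + m) * (1 + real m / real n)"
      proof -
        have "1 + real m / real n = real (n + m) / real n" using n by (simp add: add_divide_distrib)
        then show ?thesis using n by simp
      qed
      finally show "join_entropy \<nu> p n / real n \<le> H (n + m) / real (n + m) * (1 + real m / real n) + \<delta>" .
    qed
    then show ?thesis using r(2) by simp
  qed
  then have "l \<le> h k" by (rule field_le_epsilon)
  then show "ereal (partition_entropy \<nu> p) \<le> ereal (h k)"
    using limI[OF l] by (simp add: partition_entropy_def)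
qed

end


section \<open>Measures of nonnegative pressure are Gibbs laws\<close>

text \<open>
  A substitute for Pinsker's inequality that can be summed term by term: the summand of the relative
  entropy dominates that of the squared Hellinger distance, and the factor \<open>\<eta>\<close> replaces the Cauchy-Schwarz
  inequality.
\<close>

lemma abs_diff_le_relative_entropy:
  fixes p q \<eta> :: real
  assumes "0 \<le> p" "0 \<le> q" "0 < p \<Longrightarrow> 0 < q" "\<eta> > 0"
  shows "\<bar>p - q\<bar> \<le> (p * ln p - p * ln q - p + q) / (2 * \<eta>) + \<eta> * (p + q)"
proof -
  define r s where "r = sqrt p" and "s = sqrt q"
  have rs: "0 \<le> r" "0 \<le> s" "p = r\<^sup>2" "q = s\<^sup>2" using assms by (auto simp: r_def s_def)
  have hellinger: "(r - s)\<^sup>2 \<le> p * ln p - p * ln q - p + q"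
  proof (cases "p = 0")
    case True
    then show ?thesis using rs by simp
  next
    case False
    then have pos: "r > 0" "s > 0" using assms by (auto simp: r_def s_def)
    have "2 * r\<^sup>2 * ln (s / r) \<le> 2 * r\<^sup>2 * (s / r - 1)"
      using pos by (intro mult_left_mono ln_le_minus_one) auto
    also have "2 * r\<^sup>2 * (s / r - 1) = 2 * r * s - 2 * r\<^sup>2"
      using pos by (simp add: right_diff_distrib power2_eq_square)
    finally have "2 * r\<^sup>2 * (ln s - ln r) \<le> 2 * r * s - 2 * r\<^sup>2" using pos by (simp add: ln_div)
    moreover have "ln p = 2 * ln r" "ln q = 2 * ln s" using pos rs by (auto simp: ln_realpow)
    ultimately show ?thesis
      unfolding \<open>ln p = _\<close> \<open>ln q = _\<close> by (simp add: rs(3,4) power2_diff algebra_simps)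
  qed
  have am_gm: "2 * (x * y) \<le> x\<^sup>2 / \<eta> + \<eta> * y\<^sup>2" for x y
  proof -
    have "0 \<le> (x - \<eta> * y)\<^sup>2 / \<eta>" using assms by simp
    also have "\<dots> = x\<^sup>2 / \<eta> + \<eta> * y\<^sup>2 - 2 * (x * y)"
      using assms by (simp add: field_simps power2_eq_square)
    finally show ?thesis by simp
  qed
  have "p - q = (r - s) * (r + s)" by (simp add: rs(3,4) power2_eq_square algebra_simps)
  then have "2 * \<bar>p - q\<bar> = 2 * (\<bar>r - s\<bar> * (r + s))" using rs by (simp add: abs_mult)
  also have "\<dots> \<le> (r - s)\<^sup>2 / \<eta> + \<eta> * (r + s)\<^sup>2" using am_gm[of "\<bar>r - s\<bar>" "r + s"] by simp
  also have "\<dots> \<le> (p * ln p - p * ln q - p + q) / \<eta> + \<eta> * (2 * (p + q))"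
  proof -
    have "0 \<le> (r - s)\<^sup>2" by simp
    then have "(r + s)\<^sup>2 \<le> 2 * (p + q)" by (simp add: rs(3,4) power2_eq_square algebra_simps)
    then show ?thesis
      using hellinger assms by (intro add_mono divide_right_mono mult_left_mono) auto
  qed
  also have "\<dots> = 2 * ((p * ln p - p * ln q - p + q) / (2 * \<eta>) + \<eta> * (p + q))"
    using assms by (simp add: field_simps)
  finally show ?thesis by (simp only: mult_le_cancel_left_pos zero_less_numeral)
qed

locale normalized_potential =
  fixes g :: "(nat \<Rightarrow> 'a::finite) \<Rightarrow> real"
  assumes g_function: "g_function g"
begin

definition \<phi> :: "(nat \<Rightarrow> 'a) \<Rightarrow> real" where "\<phi> x = ln (g x)"

lemma g_pos: "0 < g x" and g_less_1: "g x < 1"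
  using g_function by (auto simp: g_function_def)

lemma exp_phi: "exp (\<phi> x) = g x"
  using g_pos by (simp add: \<phi>_def)

lemma phi_neg: "\<phi> x < 0"
  using g_pos g_less_1 by (simp add: \<phi>_def ln_less_zero)

lemma sum_g: "(\<Sum>a\<in>UNIV. g (case_nat a x)) = 1"
proof -
  have "{b. shift b = x} = range (\<lambda>a. case_nat a x)"
  proof
    show "{b. shift b = x} \<subseteq> range (\<lambda>a. case_nat a x)"
    proof
      fix b assume "b \<in> {b. shift b = x}"
      then have "b = case_nat (b 0) x" using case_nat_shift[of b] by simp
      then show "b \<in> range (\<lambda>a. case_nat a x)" by blast
    qed
  qed auto
  moreover have "inj (\<lambda>a. case_nat a x)"
    by (auto simp: inj_on_def fun_eq_iff split: nat.splits)
  ultimately have "(\<Sum>b | shift b = x. g b) = (\<Sum>a\<in>UNIV. g (case_nat a x))"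
    by (simp add: sum.reindex)
  then show ?thesis using g_function by (simp add: g_function_def)
qed

lemma continuous_g: "continuous_map seq_topology euclideanreal g"
  using g_function by (simp add: g_function_def)

lemma continuous_phi: "continuous_map seq_topology euclideanreal \<phi>"
proof -
  have "continuous_map seq_topology (top_of_set {0<..}) g"
    using continuous_g g_pos by (simp add: continuous_map_in_subtopology image_subset_iff)
  moreover have "continuous_map (top_of_set {0<..}) euclideanreal (ln :: real \<Rightarrow> real)"
    by (auto intro!: continuous_intros)
  ultimately have "continuous_map seq_topology euclideanreal (ln \<circ> g)"
    by (rule continuous_map_compose)
  then show ?thesis by (simp add: comp_def \<phi>_def[abs_def])
qed

lemma bounded_phi: "\<exists>M>0. \<forall>x. \<bar>\<phi> x\<bar> \<le> M"
proof -
  obtain m where m: "\<And>x y. prefix_of x m = prefix_of y m \<Longrightarrow> \<bar>\<phi> x - \<phi> y\<bar> < 1"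
    using uniformly_continuous_prefix[OF continuous_phi, of 1] by auto
  define M where "M = 1 + (\<Sum>w\<in>words UNIV m. \<bar>\<phi> (periodic_ext w)\<bar>)"
  have "\<bar>\<phi> x\<bar> \<le> M" for x
  proof -
    let ?w = "prefix_of x m"
    have "prefix_of (periodic_ext ?w) m = prefix_of x m"
      using periodic_ext_in_cylinder[of ?w] by (simp add: in_cylinder_iff)
    from m[OF this] have "\<bar>\<phi> x\<bar> < 1 + \<bar>\<phi> (periodic_ext ?w)\<bar>" by linarith
    moreover have "\<bar>\<phi> (periodic_ext ?w)\<bar> \<le> (\<Sum>w\<in>words UNIV m. \<bar>\<phi> (periodic_ext w)\<bar>)"
      by (rule member_le_sum) (auto simp: finite_words, simp add: words_UNIV)
    ultimately show ?thesis by (simp add: M_def)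
  qed
  moreover have "M > 0" unfolding M_def by (intro add_pos_nonneg sum_nonneg) auto
  ultimately show ?thesis by blast
qed

text \<open>
  The modulus of continuity of \<open>\<phi>\<close> with respect to the length of common prefixes.
\<close>

definition osc :: "nat \<Rightarrow> real" where
  "osc m = (SUP (x, y)\<in>{(x, y). prefix_of x m = prefix_of y m}. \<bar>\<phi> x - \<phi> y\<bar>)"

lemma osc_bound:
  assumes "prefix_of x m = prefix_of y m"
  shows "\<bar>\<phi> x - \<phi> y\<bar> \<le> osc m"
proof -
  obtain M where M: "\<And>x. \<bar>\<phi> x\<bar> \<le> M" using bounded_phi by blast
  have bdd: "bdd_above ((\<lambda>(x, y). \<bar>\<phi> x - \<phi> y\<bar>) ` {(x, y). prefix_of x m = prefix_of y m})"
  proof (rule bdd_aboveI2)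
    fix xy :: "(nat \<Rightarrow> 'a) \<times> (nat \<Rightarrow> 'a)"
    obtain x y where "xy = (x, y)" by (cases xy)
    then show "(\<lambda>(x, y). \<bar>\<phi> x - \<phi> y\<bar>) xy \<le> 2 * M" using M[of x] M[of y] by simp
  qed
  show ?thesis
    unfolding osc_def using cSUP_upper[OF _ bdd, of "(x, y)"] assms by simp
qed

lemma osc_cylinder: "x \<in> cylinder w \<Longrightarrow> y \<in> cylinder w \<Longrightarrow> \<bar>\<phi> x - \<phi> y\<bar> \<le> osc (length w)"
  by (rule osc_bound) (simp add: in_cylinder_iff)

lemma g_case_nat_bounds:
  assumes "x \<in> cylinder (a # w)" "y \<in> cylinder w"
  shows "exp (\<phi> x - osc (Suc (length w))) \<le> g (case_nat a y)"
    and "g (case_nat a y) \<le> exp (\<phi> x + osc (Suc (length w)))"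
  using osc_cylinder[OF assms(1), of "case_nat a y"] assms(2)
  by (simp_all add: exp_phi[symmetric] abs_le_iff)

lemma osc_nonneg: "0 \<le> osc m"
  using osc_bound[of undefined m undefined] by simp

lemma osc_tendsto_0: "osc \<longlonglongrightarrow> 0"
proof (rule LIMSEQ_I)
  fix r :: real assume "r > 0"
  then obtain m where m: "\<And>x y. prefix_of x m = prefix_of y m \<Longrightarrow> \<bar>\<phi> x - \<phi> y\<bar> < r / 2"
    using uniformly_continuous_prefix[OF continuous_phi, of "r/2"] by auto
  have "osc n \<le> r / 2" if "n \<ge> m" for n
    unfolding osc_def
  proof (rule cSUP_least)
    fix xy :: "(nat \<Rightarrow> 'a) \<times> (nat \<Rightarrow> 'a)" assume "xy \<in> {(x, y). prefix_of x n = prefix_of y n}"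
    then show "(\<lambda>(x, y). \<bar>\<phi> x - \<phi> y\<bar>) xy \<le> r / 2"
      using m prefix_of_mono[OF _ that] by (force intro: less_imp_le)
  qed auto
  then show "\<exists>no. \<forall>n\<ge>no. norm (osc n - 0) < r"
    using \<open>r > 0\<close> osc_nonneg by (intro exI[of _ m]) (force simp: abs_of_nonneg)
qed

definition birkhoff_sum :: "nat \<Rightarrow> (nat \<Rightarrow> 'a) \<Rightarrow> real" where
  "birkhoff_sum n x = (\<Sum>i<n. \<phi> ((shift ^^ i) x))"

text \<open>
  The error of a Birkhoff sum of length \<open>n\<close> when only the first \<open>n\<close> letters are known.
\<close>

definition distortion :: "nat \<Rightarrow> real" where
  "distortion n = (\<Sum>j<n. osc (Suc j))"

lemma distortion_nonneg: "0 \<le> distortion n"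
  by (simp add: distortion_def sum_nonneg osc_nonneg)

lemma distortion_sublinear: "(\<lambda>n. distortion n / real n) \<longlonglongrightarrow> 0"
  unfolding distortion_def by (rule cesaro_mean[OF LIMSEQ_Suc[OF osc_tendsto_0]])

lemma birkhoff_sum_Suc: "birkhoff_sum (Suc n) x = \<phi> x + birkhoff_sum n (shift x)"
  unfolding birkhoff_sum_def sum.lessThan_Suc_shift by (simp add: funpow_swap1)

text \<open>
  An approximate form of the identity that the conditional probability of the first letter given the
  others equals \<open>g\<close>.  It is stated for words because in this form it passes to pointwise limits of laws.
\<close>

definition gibbs_law :: "('a list \<Rightarrow> real) \<Rightarrow> bool" where
  "gibbs_law P \<longleftrightarrow> P [] = 1 \<and> (\<forall>a w. \<forall>x\<in>cylinder (a # w).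
     P w * exp (\<phi> x - osc (Suc (length w))) \<le> P (a # w) \<and>
     P (a # w) \<le> P w * exp (\<phi> x + osc (Suc (length w))))"

lemma gibbs_law_pos: "gibbs_law P \<Longrightarrow> 0 < P w"
proof (induction w)
  case (Cons a w)
  then have "P w * exp (\<phi> (periodic_ext (a # w)) - osc (Suc (length w))) \<le> P (a # w)"
    unfolding gibbs_law_def using periodic_ext_in_cylinder by blast
  moreover have "0 < P w * exp (\<phi> (periodic_ext (a # w)) - osc (Suc (length w)))"
    using Cons by (intro mult_pos_pos) auto
  ultimately show ?case by linarith
qed (simp add: gibbs_law_def)

lemma gibbs_law_step:
  assumes "gibbs_law P" "x \<in> cylinder (a # w)"
  shows "\<bar>ln (P (a # w)) - ln (P w) - \<phi> x\<bar> \<le> osc (Suc (length w))"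
proof -
  let ?o = "osc (Suc (length w))"
  have pos: "P (a # w) > 0" "P w > 0" using gibbs_law_pos[OF assms(1)] by auto
  have *: "P w * exp (\<phi> x - ?o) \<le> P (a # w)" "P (a # w) \<le> P w * exp (\<phi> x + ?o)"
    using assms unfolding gibbs_law_def by blast+
  have "ln (P w * exp (\<phi> x - ?o)) \<le> ln (P (a # w))" "ln (P (a # w)) \<le> ln (P w * exp (\<phi> x + ?o))"
    using * pos by simp_all
  then show ?thesis using pos by (simp add: ln_mult abs_le_iff)
qed

lemma gibbs_law_log:
  assumes "gibbs_law P" "x \<in> cylinder w"
  shows "\<bar>ln (P w) - birkhoff_sum (length w) x\<bar> \<le> distortion (length w)"
  using assms(2)
proof (induction w arbitrary: x)
  case Nil
  then show ?case using assms(1) by (simp add: gibbs_law_def birkhoff_sum_def distortion_def)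
next
  case (Cons a w)
  have "shift x \<in> cylinder w" using Cons.prems by (simp add: in_cylinder_iff prefix_of_Suc_Cons)
  from Cons.IH[OF this] gibbs_law_step[OF assms(1) Cons.prems]
  show ?case by (simp add: birkhoff_sum_Suc distortion_def)
qed

lemma measurable_phi: "\<phi> \<in> borel_measurable seq_borel"
  by (rule measurable_continuous_seq[OF continuous_phi])

lemma measurable_case_nat_seq: "case_nat a \<in> measurable seq_borel (seq_borel :: (nat \<Rightarrow> 'a) measure)"
proof (rule measurable_into_seq_borel)
  fix w :: "'a list"
  have "case_nat a -` cylinder w = (if w = [] then UNIV else if a = hd w then cylinder (tl w) else {})"
    by (cases w) (auto simp: in_cylinder_iff[of _ "[]"])
  then show "case_nat a -` cylinder w \<inter> space seq_borel \<in> sets (seq_borel :: (nat \<Rightarrow> 'a) measure)"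
    using sets.top[of seq_borel] by auto
qed

end

locale potential_measure = normalized_potential g + shift_invariant \<nu>
  for g :: "(nat \<Rightarrow> 'a::finite) \<Rightarrow> real" and \<nu> :: "(nat \<Rightarrow> 'a) measure"
begin

sublocale law: stationary_law UNIV "cyl_prob \<nu>"
  by (rule stationary_cyl_prob)

lemma measurable_phi': "\<phi> \<in> borel_measurable \<nu>"
  using measurable_phi by (simp add: measurable_cong_sets[OF sets_eq refl])

lemma integrable_phi: "integrable \<nu> \<phi>"
proof -
  obtain M where "\<And>x. \<bar>\<phi> x\<bar> \<le> M" using bounded_phi by blast
  then show ?thesis by (intro integrable_const_bound[of _ M] measurable_phi') auto
qed

lemma integral_birkhoff_sum: "integrable \<nu> (birkhoff_sum n)" "(\<integral>x. birkhoff_sum n x \<partial>\<nu>) = real n * (\<integral>x. \<phi> x \<partial>\<nu>)"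
proof -
  have i: "integrable \<nu> (\<lambda>x. \<phi> ((shift ^^ i) x))" for i
    using integrable_distr[OF shift_funpow_measurable[of i], of \<phi>] integrable_phi
    by (simp add: distr_funpow_shift)
  show "integrable \<nu> (birkhoff_sum n)"
    unfolding birkhoff_sum_def[abs_def] using i by (intro Bochner_Integration.integrable_sum)
  show "(\<integral>x. birkhoff_sum n x \<partial>\<nu>) = real n * (\<integral>x. \<phi> x \<partial>\<nu>)"
    unfolding birkhoff_sum_def using i integral_funpow_shift[OF measurable_phi']
    by (subst Bochner_Integration.integral_sum) auto
qed

text \<open>
  The probability of \<open>v\<close> when its first letter is drawn with probability \<open>g\<close>, given that the rest
  has law \<open>\<nu>\<close>.  A \<open>\<nu>\<close> that is fixed by the dual transfer operator is characterized by \<open>g_mass = cyl_prob \<nu>\<close>.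
\<close>

definition g_mass :: "'a list \<Rightarrow> real" where
  "g_mass v = (\<integral>y. indicator (cylinder (tl v)) y * g (case_nat (hd v) y) \<partial>\<nu>)"

lemma measurable_g_case_nat: "(\<lambda>y. g (case_nat a y)) \<in> borel_measurable \<nu>"
proof -
  have "(\<lambda>y. g (case_nat a y)) \<in> borel_measurable seq_borel"
    by (rule measurable_compose[OF measurable_case_nat_seq measurable_continuous_seq[OF continuous_g]])
  then show ?thesis by (simp add: measurable_cong_sets[OF sets_eq refl])
qed

lemma integrable_g_mass: "integrable \<nu> (\<lambda>y. indicator (cylinder w) y * g (case_nat a y))"
proof (rule integrable_const_bound[of _ 1])
  show "AE x in \<nu>. norm (indicator (cylinder w) x * g (case_nat a x)) \<le> 1"
    using g_pos g_less_1 by (auto simp: indicator_def abs_of_pos intro!: AE_I2 less_imp_le)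
qed (intro borel_measurable_times measurable_g_case_nat borel_measurable_indicator cylinder_sets)

lemma g_mass_nonneg: "0 \<le> g_mass v"
  unfolding g_mass_def using g_pos by (intro Bochner_Integration.integral_nonneg) (auto simp: indicator_def less_imp_le)

lemma sum_g_mass_Cons: "(\<Sum>a\<in>UNIV. g_mass (a # w)) = cyl_prob \<nu> w"
proof -
  have "(\<Sum>a\<in>UNIV. g_mass (a # w)) = (\<integral>y. (\<Sum>a\<in>UNIV. indicator (cylinder w) y * g (case_nat a y)) \<partial>\<nu>)"
    unfolding g_mass_def list.sel by (rule Bochner_Integration.integral_sum[symmetric, OF integrable_g_mass])
  also have "\<dots> = (\<integral>y. indicator (cylinder w) y \<partial>\<nu>)"
    unfolding sum_distrib_left[symmetric] sum_g by simp
  finally show ?thesis by (simp add: cyl_prob_def)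
qed

lemma sum_g_mass_snoc:
  assumes "v \<noteq> []"
  shows "(\<Sum>b\<in>UNIV. g_mass (v @ [b])) = g_mass v"
proof -
  have "(\<Sum>b\<in>UNIV. g_mass (v @ [b])) =
      (\<integral>y. (\<Sum>b\<in>UNIV. indicator (cylinder (tl v @ [b])) y * g (case_nat (hd v) y)) \<partial>\<nu>)"
    using assms
    by (simp only: g_mass_def hd_append2 tl_append2 simp_thms Bochner_Integration.integral_sum[OF integrable_g_mass])
  also have "\<dots> = g_mass v"
    unfolding sum_distrib_right[symmetric] sum_indicator_cylinder_snoc g_mass_def by simp
  finally show ?thesis .
qed

lemma g_mass_bounds:
  assumes x: "x \<in> cylinder (a # w)"
  shows "cyl_prob \<nu> w * exp (\<phi> x - osc (Suc (length w))) \<le> g_mass (a # w)"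
    and "g_mass (a # w) \<le> cyl_prob \<nu> w * exp (\<phi> x + osc (Suc (length w)))"
proof -
  let ?o = "osc (Suc (length w))"
  have int: "(\<integral>y. indicator (cylinder w) y * c \<partial>\<nu>) = cyl_prob \<nu> w * c" for c :: real
    by (simp add: cyl_prob_def)
  have intg: "integrable \<nu> (\<lambda>y. indicator (cylinder w) y * c)" for c :: real
    by (intro integrable_mult_left integrable_real_indicator) (auto simp: less_top[symmetric])
  show "cyl_prob \<nu> w * exp (\<phi> x - ?o) \<le> g_mass (a # w)"
    unfolding g_mass_def int[symmetric]
    by (intro integral_mono intg integrable_g_mass)
      (simp add: indicator_def g_case_nat_bounds[OF x])
  show "g_mass (a # w) \<le> cyl_prob \<nu> w * exp (\<phi> x + ?o)"
    unfolding g_mass_def int[symmetric]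
    by (intro integral_mono intg integrable_g_mass)
      (simp add: indicator_def g_case_nat_bounds[OF x])
qed

definition discrepancy :: "nat \<Rightarrow> real" where
  "discrepancy n = (\<Sum>v\<in>words UNIV (Suc n). \<bar>cyl_prob \<nu> v - g_mass v\<bar>)"

text \<open>
  Total variation distance increases when the partition into cylinders is refined.
\<close>

lemma discrepancy_mono: "m \<le> n \<Longrightarrow> discrepancy m \<le> discrepancy n"
proof (rule lift_Suc_mono_le[of discrepancy])
  fix n
  have "discrepancy n \<le> (\<Sum>v\<in>words UNIV (Suc n). \<Sum>b\<in>UNIV. \<bar>cyl_prob \<nu> (v @ [b]) - g_mass (v @ [b])\<bar>)"
    unfolding discrepancy_def
  proof (rule sum_mono)
    fix v :: "'a list" assume "v \<in> words UNIV (Suc n)"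
    then have "v \<noteq> []" by (auto simp: words_def)
    then have "cyl_prob \<nu> v - g_mass v = (\<Sum>b\<in>UNIV. cyl_prob \<nu> (v @ [b]) - g_mass (v @ [b]))"
      by (simp add: sum_subtractf law.snoc sum_g_mass_snoc)
    then show "\<bar>cyl_prob \<nu> v - g_mass v\<bar> \<le> (\<Sum>b\<in>UNIV. \<bar>cyl_prob \<nu> (v @ [b]) - g_mass (v @ [b])\<bar>)"
      by (simp add: sum_abs)
  qed
  also have "\<dots> = discrepancy (Suc n)"
    unfolding discrepancy_def by (subst (2) sum_words_snoc) auto
  finally show "discrepancy n \<le> discrepancy (Suc n)" .
qed

text \<open>
  The relative entropy of \<open>cyl_prob \<nu>\<close> with respect to \<open>g_mass\<close> on words of length \<open>n + 1\<close> is
  \<open>- H (n + 1) + H n - (\<integral>x. \<phi> x \<partial>\<nu>)\<close> up to twice the oscillation, and nonnegative pressure says that the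
  main term is at most \<open>0\<close>.
\<close>

lemma discrepancy_bound:
  assumes KS: "0 \<le> ereal (\<integral>x. \<phi> x \<partial>\<nu>) + KS_entropy \<nu>" and "\<eta> > 0"
  shows "discrepancy n \<le> osc (Suc n) / \<eta> + 2 * \<eta>"
proof -
  let ?P = "cyl_prob \<nu>" and ?W = "words UNIV (Suc n) :: 'a list set" and ?o = "osc (Suc n)"
  have "0 \<le> ereal (\<integral>x. \<phi> x \<partial>\<nu>) + ereal (law.h n)"
    using KS KS_entropy_le_increment[of n] by (meson add_left_mono order_trans)
  then have hn: "0 \<le> (\<integral>x. \<phi> x \<partial>\<nu>) + law.h n" by simp
  have pos: "?P (tl v) > 0 \<and> g_mass v > 0 \<and>
      ln (?P (tl v)) + \<phi> (periodic_ext v) - ?o \<le> ln (g_mass v)" if v: "v \<in> ?W" "?P v > 0" for v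
  proof -
    have tl: "?P (tl v) > 0" using law.le_tl[OF v(1)] v(2) by linarith
    obtain a w where aw: "v = a # w" "length w = n" using v(1) by (cases v) (auto simp: words_def)
    have *: "?P (tl v) * exp (\<phi> (periodic_ext v) - ?o) \<le> g_mass v"
      using g_mass_bounds(1)[OF periodic_ext_in_cylinder[of "a # w"]] aw by simp
    moreover have p: "0 < ?P (tl v) * exp (\<phi> (periodic_ext v) - ?o)" using tl by simp
    ultimately have "g_mass v > 0" by linarith
    moreover have "ln (?P (tl v) * exp (\<phi> (periodic_ext v) - ?o)) \<le> ln (g_mass v)"
      using * p \<open>g_mass v > 0\<close> by (subst ln_le_cancel_iff) auto
    ultimately show ?thesis using tl by (simp add: ln_mult)
  qed
  have "(\<integral>x. \<phi> x \<partial>\<nu>) \<le> (\<integral>x. \<phi> (periodic_ext (prefix_of x (Suc n))) + ?o \<partial>\<nu>)"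
  proof (rule integral_mono[OF integrable_phi])
    show "integrable \<nu> (\<lambda>x. \<phi> (periodic_ext (prefix_of x (Suc n))) + ?o)"
      by (rule integrable_prefix[of "\<lambda>w. \<phi> (periodic_ext w) + ?o"])
    fix x :: "nat \<Rightarrow> 'a"
    have "prefix_of x (Suc n) = prefix_of (periodic_ext (prefix_of x (Suc n))) (Suc n)"
      using periodic_ext_in_cylinder[of "prefix_of x (Suc n)"] by (simp add: in_cylinder_iff)
    from osc_bound[OF this] show "\<phi> x \<le> \<phi> (periodic_ext (prefix_of x (Suc n))) + ?o" by linarith
  qed
  also have "\<dots> = (\<Sum>v\<in>?W. ?P v * \<phi> (periodic_ext v)) + ?o"
    unfolding integral_prefix[of "\<lambda>w. \<phi> (periodic_ext w) + ?o"]
    by (simp add: distrib_left sum.distrib sum_distrib_right[symmetric] law.sum_law)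
  finally have phi: "(\<integral>x. \<phi> x \<partial>\<nu>) - ?o \<le> (\<Sum>v\<in>?W. ?P v * \<phi> (periodic_ext v))" by simp
  have "(\<Sum>v\<in>?W. ?P v * (ln (?P (tl v)) + \<phi> (periodic_ext v) - ?o)) \<le> (\<Sum>v\<in>?W. ?P v * ln (g_mass v))"
  proof (rule sum_mono)
    fix v assume v: "v \<in> ?W"
    show "?P v * (ln (?P (tl v)) + \<phi> (periodic_ext v) - ?o) \<le> ?P v * ln (g_mass v)"
    proof (cases "?P v = 0")
      case False
      then have "?P v > 0" using law.nonneg[of v] by simp
      with pos[OF v] show ?thesis by (intro mult_left_mono) auto
    qed simp
  qed
  moreover have "(\<Sum>v\<in>?W. ?P v * (ln (?P (tl v)) + \<phi> (periodic_ext v) - ?o)) =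
      - law.H n + (\<Sum>v\<in>?W. ?P v * \<phi> (periodic_ext v)) - ?o"
    using law.sum_tl[of "\<lambda>w. ln (?P w)" n]
    by (simp add: right_diff_distrib distrib_left sum.distrib sum_subtractf block_entropy_def
        sum_distrib_right[symmetric] law.sum_law)
  moreover have "(\<Sum>v\<in>?W. ?P v * ln (?P v)) = - law.H (Suc n)" by (simp add: block_entropy_def)
  ultimately have rel: "(\<Sum>v\<in>?W. ?P v * ln (?P v)) - (\<Sum>v\<in>?W. ?P v * ln (g_mass v)) \<le> 2 * ?o"
    using phi hn by (simp add: entropy_increment_def)
  have sq: "(\<Sum>v\<in>?W. g_mass v) = 1"
    by (simp add: sum_words_Cons sum_g_mass_Cons law.sum_law)
  have "discrepancy n \<le> (\<Sum>v\<in>?W. (?P v * ln (?P v) - ?P v * ln (g_mass v) - ?P v + g_mass v) / (2 * \<eta>) + \<eta> * (?P v + g_mass v))"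
    unfolding discrepancy_def
    using pos by (intro sum_mono abs_diff_le_relative_entropy law.nonneg g_mass_nonneg \<open>\<eta> > 0\<close>) auto
  also have "\<dots> = ((\<Sum>v\<in>?W. ?P v * ln (?P v)) - (\<Sum>v\<in>?W. ?P v * ln (g_mass v))) / (2 * \<eta>) + 2 * \<eta>"
    by (simp add: sum.distrib sum_subtractf sum_divide_distrib[symmetric] sum_distrib_left[symmetric]
        law.sum_law sq)
  also have "\<dots> \<le> (2 * ?o) / (2 * \<eta>) + 2 * \<eta>"
    using rel \<open>\<eta> > 0\<close> by (intro add_right_mono divide_right_mono) auto
  finally show ?thesis by simp
qed

text \<open>
  At large \<open>n\<close> the discrepancy is arbitrarily small, and by monotonicity it bounds the discrepancy at every
  fixed length.
\<close>

theorem gibbs_law_of_nonneg_pressure: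
  assumes KS: "0 \<le> ereal (\<integral>x. \<phi> x \<partial>\<nu>) + KS_entropy \<nu>"
  shows "gibbs_law (cyl_prob \<nu>)"
proof -
  have "discrepancy m \<le> 0" for m
  proof (rule field_le_epsilon)
    fix e :: real assume "e > 0"
    define \<eta> where "\<eta> = e / 3"
    have "\<eta> > 0" using \<open>e > 0\<close> by (simp add: \<eta>_def)
    then have "\<forall>\<^sub>F n in sequentially. osc (Suc n) < \<eta> * \<eta>"
      using order_tendstoD(2)[OF LIMSEQ_Suc[OF osc_tendsto_0], of "\<eta> * \<eta>"] by simp
    then obtain n where n: "n \<ge> m" "osc (Suc n) < \<eta> * \<eta>"
      using eventually_happens[OF eventually_conj[OF _ eventually_ge_at_top[of m]]] by fastforce
    have "discrepancy m \<le> osc (Suc n) / \<eta> + 2 * \<eta>"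
      using discrepancy_mono[OF n(1)] discrepancy_bound[OF KS \<open>\<eta> > 0\<close>, of n] by linarith
    also have "\<dots> \<le> \<eta> * \<eta> / \<eta> + 2 * \<eta>"
      using n(2) \<open>\<eta> > 0\<close> by (intro add_right_mono divide_right_mono) auto
    finally show "discrepancy m \<le> 0 + e" using \<open>\<eta> > 0\<close> by (simp add: \<eta>_def)
  qed
  moreover have "\<bar>cyl_prob \<nu> (a # w) - g_mass (a # w)\<bar> \<le> discrepancy (length w)" for a w
    unfolding discrepancy_def
    by (rule member_le_sum) (auto simp: finite_words, simp add: words_UNIV)
  ultimately have "cyl_prob \<nu> (a # w) = g_mass (a # w)" for a w
    by (meson abs_le_zero_iff eq_iff_diff_eq_0 order_trans)
  then show ?thesis
    unfolding gibbs_law_def using g_mass_bounds law.law_Nil by auto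
qed

end


section \<open>Existence of an invariant Gibbs law\<close>

lemma pointwise_convergent_subsequence:
  fixes u :: "nat \<Rightarrow> 'i::countable \<Rightarrow> real"
  assumes bound: "\<And>n i. \<bar>u n i\<bar> \<le> M"
  shows "\<exists>r. strict_mono (r :: nat \<Rightarrow> nat) \<and> (\<forall>i. convergent (\<lambda>n. u (r n) i))"
proof -
  let ?P = "\<lambda>n s. convergent (\<lambda>j. u (s j) (from_nat n))"
  interpret subseqs ?P
  proof
    fix n and s :: "nat \<Rightarrow> nat" assume "strict_mono s"
    have "u (s j) (from_nat n) \<in> {-M..M}" for j
      using bound[of "s j" "from_nat n"] by (simp add: abs_le_iff minus_le_iff)
    then obtain l r where "strict_mono r" "((\<lambda>j. u (s j) (from_nat n)) \<circ> r) \<longlonglongrightarrow> l"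
      using compact_imp_seq_compact[OF compact_Icc] by (metis seq_compactE)
    then show "\<exists>r. strict_mono r \<and> convergent (\<lambda>j. u ((s \<circ> r) j) (from_nat n))"
      by (auto simp: convergent_def comp_def)
  qed
  have "convergent (\<lambda>n. u (diagseq n) i)" for i
  proof -
    have "?P (to_nat i) (diagseq \<circ> (+) (Suc (to_nat i)))"
    proof (rule diagseq_holds)
      fix r s :: "nat \<Rightarrow> nat" and n
      assume "strict_mono r" "convergent (\<lambda>j. u (s j) (from_nat n))"
      from convergent_subseq_convergent[OF this(2,1)]
      show "convergent (\<lambda>j. u ((s \<circ> r) j) (from_nat n))" by (simp add: comp_def)
    qed
    then have "convergent (\<lambda>j. u (diagseq (j + Suc (to_nat i))) i)" by (simp add: add.commute)
    then show ?thesis by (rule convergent_ignore_initial_segment[THEN iffD1])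
  qed
  then show ?thesis using subseq_diagseq by blast
qed

text \<open>
  On clopen sets the content is additive, and it is continuous at the empty set because, by compactness, a
  decreasing sequence of clopen sets with empty intersection is eventually empty.
\<close>

lemma kolmogorov_extension_words:
  fixes P :: "'a::finite list \<Rightarrow> real"
  assumes nonneg: "\<And>w. 0 \<le> P w" and Nil: "P [] = 1"
    and snoc: "\<And>w. (\<Sum>b\<in>UNIV. P (w @ [b])) = P w"
  shows "\<exists>\<nu>. prob_space \<nu> \<and> sets \<nu> = sets seq_borel \<and> (\<forall>w. measure \<nu> (cylinder w) = P w)"
proof -
  define G where "G = {A :: (nat \<Rightarrow> 'a) set. \<exists>m W. A = prefix_event m W}"
  \<comment> \<open>For a clopen \<open>A\<close> the value \<open>F n A\<close> is constant once \<open>n\<close> reaches the length on which \<open>A\<close> depends.  Taking the limit makes the content independent of the representation of \<open>A\<close>.\<close>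
  define F where "F n A = (\<Sum>w\<in>words UNIV n. if periodic_ext w \<in> A then P w else 0)"
    for n and A :: "(nat \<Rightarrow> 'a) set"
  define f where "f A = lim (\<lambda>n. F n A)" for A
  have F_stable: "F n (prefix_event m W) = F m (prefix_event m W)" if "m \<le> n" for n m W
    using that
  proof (induction rule: dec_induct)
    case (step n)
    have "F (Suc n) (prefix_event m W) =
        (\<Sum>w\<in>words UNIV n. \<Sum>b\<in>UNIV. if take m w \<in> W then P (w @ [b]) else 0)"
      unfolding F_def sum_words_snoc[OF finite]
      using step by (intro sum.cong refl) (auto simp: words_UNIV periodic_ext_in_prefix_event)
    also have "\<dots> = (\<Sum>w\<in>words UNIV n. if take m w \<in> W then P w else 0)"
      by (intro sum.cong refl) (simp add: snoc)
    also have "\<dots> = F n (prefix_event m W)"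
      unfolding F_def using step by (intro sum.cong refl) (auto simp: words_UNIV periodic_ext_in_prefix_event)
    finally show ?case using step by simp
  qed simp
  have f_eq: "f (prefix_event m W) = F n (prefix_event m W)" if "m \<le> n" for n m W
  proof -
    have "\<forall>\<^sub>F n in sequentially. F n (prefix_event m W) = F m (prefix_event m W)"
      by (rule eventually_mono[OF eventually_ge_at_top[of m] F_stable])
    then have "(\<lambda>n. F n (prefix_event m W)) \<longlonglongrightarrow> F m (prefix_event m W)"
      by (rule tendsto_eventually)
    then show ?thesis using F_stable[OF that] by (simp add: f_def limI)
  qed
  have F_nonneg: "0 \<le> F n A" for n A by (simp add: F_def sum_nonneg nonneg)
  have f_nonneg: "0 \<le> f A" if A: "A \<in> G" for A
  proof -
    obtain m W where "A = prefix_event m W" using A unfolding G_def by blast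
    then show ?thesis using f_eq[of m m W] F_nonneg[of m A] by simp
  qed
  have G_Un: "A \<union> B \<in> G" and G_Diff: "A - B \<in> G" and
    f_Un: "A \<inter> B = {} \<Longrightarrow> f (A \<union> B) = f A + f B" if AB: "A \<in> G" "B \<in> G" for A B
  proof -
    obtain m W m' W' where A: "A = prefix_event m W" and B: "B = prefix_event m' W'"
      using AB unfolding G_def by blast
    define n where "n = max m m'"
    obtain V V' where A': "A = prefix_event n V" and B': "B = prefix_event n V'"
      using prefix_event_extend[of m n W] prefix_event_extend[of m' n W'] A B n_def by auto
    have un: "A \<union> B = prefix_event n (V \<union> V')" and "A - B = prefix_event n (V - V')"
      unfolding A' B' prefix_event_def by auto
    then show "A \<union> B \<in> G" "A - B \<in> G" unfolding G_def by blast+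
    assume disj: "A \<inter> B = {}"
    have "f A = F n A" "f B = F n B" "f (A \<union> B) = F n (A \<union> B)"
      unfolding un unfolding A' B' by (rule f_eq[OF order_refl])+
    moreover have "F n (A \<union> B) = F n A + F n B"
      unfolding F_def sum.distrib[symmetric] using disj by (intro sum.cong) auto
    ultimately show "f (A \<union> B) = f A + f B" by simp
  qed
  have empty_eq: "{} = prefix_event 0 ({} :: 'a list set)" by (simp add: prefix_event_def)
  have cyl_eq: "cylinder w = prefix_event (length w) {w}" for w :: "'a list"
    by (auto simp: prefix_event_def in_cylinder_iff)
  have empty_G: "{} \<in> G" unfolding G_def using empty_eq by blast
  have cyl_G: "cylinder w \<in> G" for w unfolding G_def using cyl_eq by blast
  have f_empty: "f {} = 0"
    using f_eq[of 0 0 "{}"] by (simp add: F_def empty_eq[symmetric])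
  have f_cyl: "f (cylinder w) = P w" for w
  proof -
    have "f (cylinder w) = F (length w) (cylinder w)" unfolding cyl_eq by (rule f_eq) simp
    also have "\<dots> = (\<Sum>v\<in>words UNIV (length w). if v = w then P v else 0)"
      unfolding F_def cyl_eq
      by (intro sum.cong refl) (auto simp: words_UNIV periodic_ext_in_prefix_event)
    also have "\<dots> = P w" by (simp add: finite_words words_UNIV finite_words[of UNIV, unfolded words_UNIV])
    finally show ?thesis .
  qed
  interpret ring_of_sets UNIV G
    by (rule ring_of_setsI) (auto simp: empty_G G_Un G_Diff)
  have "\<exists>\<mu> :: (nat \<Rightarrow> 'a) set \<Rightarrow> ennreal. (\<forall>A\<in>G. \<mu> A = ennreal (f A)) \<and>
      measure_space UNIV (sigma_sets UNIV G) \<mu>"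
  proof (rule caratheodory_empty_continuous)
    show "positive G (\<lambda>A. ennreal (f A))" by (simp add: positive_def f_empty)
    show "additive G (\<lambda>A. ennreal (f A))"
      unfolding additive_def by (auto simp: f_Un f_nonneg ennreal_plus)
    fix A :: "nat \<Rightarrow> (nat \<Rightarrow> 'a) set"
    assume A: "range A \<subseteq> G" "decseq A" "(\<Inter>i. A i) = {}"
    have "\<exists>m. \<exists>i. cylinder (prefix_of x m) \<inter> A i = {}" for x
    proof -
      obtain i where i: "x \<notin> A i" using A(3) by blast
      have "A i \<in> G" using A(1) by blast
      then obtain m W where Ai: "A i = prefix_event m W" unfolding G_def by blast
      have "y \<notin> A i" if "y \<in> cylinder (prefix_of x m)" for y
      proof -
        have "prefix_of y m = prefix_of x m" using that by (simp add: in_cylinder_iff)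
        then show ?thesis using i unfolding Ai prefix_event_def by simp
      qed
      then have "cylinder (prefix_of x m) \<inter> A i = {}" by blast
      then show ?thesis by blast
    qed
    from cylinder_cover_bounded[of "\<lambda>x m. \<exists>i. cylinder (prefix_of x m) \<inter> A i = {}", OF this]
    obtain K where K: "finite K" "\<forall>c\<in>K. \<exists>i. cylinder (prefix_of (fst c) (snd c)) \<inter> A i = {}"
      "\<forall>y. \<exists>c\<in>K. y \<in> cylinder (prefix_of (fst c) (snd c))"
      unfolding case_prod_beta by blast
    from bchoice[OF K(2)] obtain i
      where i: "\<forall>c\<in>K. cylinder (prefix_of (fst c) (snd c)) \<inter> A (i c) = {}" by blast
    define N where "N = (\<Sum>c\<in>K. i c)"
    have "A n = {}" if "n \<ge> N" for n
    proof -
      have "A n \<subseteq> A (i c)" if "c \<in> K" for c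
      proof -
        have "i c \<le> N" unfolding N_def using K(1) that by (intro member_le_sum) auto
        then show ?thesis using A(2) \<open>n \<ge> N\<close> by (auto simp: decseq_def)
      qed
      then show ?thesis using K(3) i by blast
    qed
    then have "\<forall>\<^sub>F n in sequentially. ennreal (f (A n)) = 0"
      by (auto simp: eventually_sequentially f_empty intro!: exI[of _ N])
    then show "(\<lambda>i. ennreal (f (A i))) \<longlonglongrightarrow> 0" by (rule tendsto_eventually)
  qed simp
  then obtain \<mu> where \<mu>: "\<And>A. A \<in> G \<Longrightarrow> \<mu> A = ennreal (f A)"
    "measure_space UNIV (sigma_sets UNIV G) \<mu>" by blast
  define \<nu> where "\<nu> = measure_of UNIV G \<mu>"
  have GU: "G \<subseteq> Pow UNIV" by simp
  have em: "emeasure \<nu> A = ennreal (f A)" if "A \<in> G" for A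
  proof -
    have "emeasure \<nu> A = \<mu> A"
      unfolding \<nu>_def using \<mu>(2) that
      by (intro emeasure_measure_of[OF refl GU]) (auto simp: measure_space_def sets_measure_of)
    then show ?thesis using \<mu>(1)[OF that] by simp
  qed
  have "sets \<nu> = sigma_sets UNIV G" by (simp add: \<nu>_def)
  also have "\<dots> = sets seq_borel"
  proof
    have "G \<subseteq> sets seq_borel" unfolding G_def using prefix_event_in_sets by blast
    then show "sigma_sets UNIV G \<subseteq> sets seq_borel"
      using sets.sigma_sets_subset[of G "seq_borel :: (nat \<Rightarrow> 'a) measure"] by simp
    show "sets (seq_borel :: (nat \<Rightarrow> 'a) measure) \<subseteq> sigma_sets UNIV G"
      unfolding sets_seq_borel_cylinders using empty_G cyl_G
      by (intro sigma_sets_mono) (auto intro: sigma_sets.Basic)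
  qed
  finally have sets: "sets \<nu> = sets seq_borel" .
  have cyl: "emeasure \<nu> (cylinder w) = ennreal (P w)" for w using em[OF cyl_G] f_cyl by simp
  have "cylinder [] = (UNIV :: (nat \<Rightarrow> 'a) set)" by (auto simp: in_cylinder_iff)
  moreover have "space \<nu> = UNIV" using sets_eq_imp_space_eq[OF sets] by simp
  ultimately have "prob_space \<nu>" using cyl[of "[]"] Nil by (intro prob_spaceI) simp
  then show ?thesis using sets cyl nonneg by (auto simp: measure_def)
qed

lemma invariant_extension:
  fixes P :: "'a::finite list \<Rightarrow> real"
  assumes "stationary_law UNIV P"
  shows "\<exists>\<nu>\<in>invariant_measures. cyl_prob \<nu> = P"
proof -
  interpret stationary_law UNIV P by fact
  obtain \<nu> where \<nu>: "prob_space \<nu>" "sets \<nu> = sets seq_borel" "\<And>w. measure \<nu> (cylinder w) = P w"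
    using kolmogorov_extension_words[of P] nonneg law_Nil snoc by auto
  interpret prob_space \<nu> by fact
  have sp: "space \<nu> = UNIV" using sets_eq_imp_space_eq[OF \<nu>(2)] by simp
  have sh: "shift \<in> measurable \<nu> \<nu>"
    using measurable_shift by (simp add: measurable_cong_sets[OF \<nu>(2) \<nu>(2)])
  have "distr \<nu> \<nu> shift = \<nu>"
  proof (rule measure_eqI_cylinders)
    fix w :: "'a list"
    have "measure \<nu> (\<Union>b\<in>UNIV. cylinder (b # w)) = (\<Sum>b\<in>UNIV. measure \<nu> (cylinder (b # w)))"
      by (rule finite_measure_finite_Union)
        (auto simp: \<nu>(2) disjoint_family_on_def in_cylinder_iff)
    then show "measure (distr \<nu> \<nu> shift) (cylinder w) = measure \<nu> (cylinder w)"
      by (simp add: measure_distr[OF sh] sp \<nu>(2) shift_vimage_cylinder \<nu>(3) Cons)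
  qed (use \<nu> sh in \<open>auto intro: prob_space_distr\<close>)
  then show ?thesis
    using \<nu> by (intro bexI[of _ \<nu>]) (auto simp: invariant_measures_def cyl_prob_def fun_eq_iff)
qed

context normalized_potential
begin

text \<open>
  The transfer operator of \<open>g\<close>.  The normalization of \<open>g\<close> says that it fixes the constant function \<open>1\<close>.
\<close>

definition transfer :: "((nat \<Rightarrow> 'a) \<Rightarrow> real) \<Rightarrow> (nat \<Rightarrow> 'a) \<Rightarrow> real" where
  "transfer f x = (\<Sum>a\<in>UNIV. g (case_nat a x) * f (case_nat a x))"

lemma transfer_iterate_Suc:
  "(transfer ^^ Suc i) f x = (\<Sum>a\<in>UNIV. g (case_nat a x) * (transfer ^^ i) f (case_nat a x))"
  by (simp add: transfer_def)

lemma transfer_iterate_mono: "(\<And>x. f x \<le> f' x) \<Longrightarrow> (transfer ^^ i) f x \<le> (transfer ^^ i) f' x"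
proof (induction i arbitrary: x)
  case (Suc i)
  show ?case unfolding transfer_iterate_Suc
    by (intro sum_mono mult_left_mono Suc less_imp_le[OF g_pos])
qed simp

lemma transfer_iterate_scale: "(transfer ^^ i) (\<lambda>x. c * f x) x = c * (transfer ^^ i) f x"
  by (induction i arbitrary: x) (simp_all add: transfer_def sum_distrib_left mult.left_commute)

lemma transfer_iterate_sum:
  "(transfer ^^ i) (\<lambda>x. \<Sum>b\<in>B. f b x) x = (\<Sum>b\<in>B. (transfer ^^ i) (f b) x)"
proof (induction i arbitrary: x)
  case (Suc i)
  show ?case
    unfolding transfer_iterate_Suc Suc sum_distrib_left by (rule sum.swap)
qed simp

lemma transfer_iterate_1: "(transfer ^^ i) (\<lambda>x. 1) x = 1"
  by (induction i arbitrary: x) (simp_all add: transfer_def sum_g)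

lemma transfer_indicator_Cons:
  "transfer (indicator (cylinder (a # w))) x = g (case_nat a x) * indicator (cylinder w) x"
proof -
  have "transfer (indicator (cylinder (a # w))) x =
      (\<Sum>b\<in>UNIV. if b = a then g (case_nat a x) * indicator (cylinder w) x else 0)"
    unfolding transfer_def by (intro sum.cong refl) (auto simp: indicator_def)
  then show ?thesis by simp
qed

text \<open>
  The cylinder probabilities of the image of a point mass under the \<open>i\<close>-th power of the dual transfer operator.
\<close>

definition pullback :: "nat \<Rightarrow> 'a list \<Rightarrow> real" where
  "pullback i w = (transfer ^^ i) (indicator (cylinder w)) undefined"

lemma pullback_range: "0 \<le> pullback i w" "pullback i w \<le> 1"
proof -
  have "(transfer ^^ i) (\<lambda>x. 0 * 1) undefined \<le> pullback i w"
    unfolding pullback_def by (rule transfer_iterate_mono) (simp add: indicator_def)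
  then show "0 \<le> pullback i w" using transfer_iterate_scale[of i 0 "\<lambda>_. 1" undefined] by simp
  have "pullback i w \<le> (transfer ^^ i) (\<lambda>x. 1) undefined"
    unfolding pullback_def by (rule transfer_iterate_mono) (simp add: indicator_def)
  then show "pullback i w \<le> 1" by (simp add: transfer_iterate_1)
qed

lemma pullback_Nil: "pullback i [] = 1"
proof -
  have "indicator (cylinder []) = (\<lambda>x :: nat \<Rightarrow> 'a. 1 :: real)"
    by (auto simp: fun_eq_iff in_cylinder_iff)
  then show ?thesis by (simp add: pullback_def transfer_iterate_1)
qed

lemma sum_pullback_snoc: "(\<Sum>b\<in>UNIV. pullback i (w @ [b])) = pullback i w"
  by (simp add: pullback_def transfer_iterate_sum[symmetric] sum_indicator_cylinder_snoc)

lemma pullback_Suc_Cons: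
  "pullback (Suc i) (a # w) = (transfer ^^ i) (\<lambda>x. g (case_nat a x) * indicator (cylinder w) x) undefined"
  unfolding pullback_def funpow_Suc_right comp_def
  by (simp add: transfer_indicator_Cons[abs_def, of a w])

lemma sum_pullback_Cons: "(\<Sum>a\<in>UNIV. pullback (Suc i) (a # w)) = pullback i w"
  unfolding pullback_Suc_Cons transfer_iterate_sum[symmetric] sum_distrib_right[symmetric] sum_g
  by (simp add: pullback_def)

lemma pullback_Cons_bounds:
  assumes x: "x \<in> cylinder (a # w)"
  shows "pullback i w * exp (\<phi> x - osc (Suc (length w))) \<le> pullback (Suc i) (a # w)"
    and "pullback (Suc i) (a # w) \<le> pullback i w * exp (\<phi> x + osc (Suc (length w)))"
proof -
  let ?o = "osc (Suc (length w))"
  have scale: "pullback i w * c = (transfer ^^ i) (\<lambda>y. c * indicator (cylinder w) y) undefined" for c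
    by (simp add: transfer_iterate_scale pullback_def mult.commute)
  show "pullback i w * exp (\<phi> x - ?o) \<le> pullback (Suc i) (a # w)"
    unfolding scale pullback_Suc_Cons
    by (rule transfer_iterate_mono) (simp add: indicator_def g_case_nat_bounds[OF x])
  show "pullback (Suc i) (a # w) \<le> pullback i w * exp (\<phi> x + ?o)"
    unfolding scale pullback_Suc_Cons
    by (rule transfer_iterate_mono) (simp add: indicator_def g_case_nat_bounds[OF x])
qed

text \<open>
  The Krylov-Bogolyubov argument at the level of words.  Prepending a letter relates \<open>pullback (Suc i)\<close> to
  \<open>pullback i\<close>, so the averages \<open>A\<close> and the shifted averages \<open>A'\<close>, which have the same limit, satisfy stationarity
  and the Gibbs inequalities exactly.
\<close>

lemma stationary_gibbs_law_exists: "\<exists>P. stationary_law UNIV P \<and> gibbs_law P"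
proof -
  define A where "A N w = (\<Sum>i<N. pullback i w) / real N" for N w
  define A' where "A' N w = (\<Sum>i<N. pullback (Suc i) w) / real N" for N w
  have Aabs: "\<bar>A N w\<bar> \<le> 1" for N w
  proof (cases "N = 0")
    case False
    have "0 \<le> (\<Sum>i<N. pullback i w)" by (simp add: sum_nonneg pullback_range)
    moreover have "(\<Sum>i<N. pullback i w) \<le> (\<Sum>i<N. 1)" by (intro sum_mono pullback_range)
    ultimately show ?thesis using False by (simp add: A_def)
  qed (simp add: A_def)
  obtain r where r: "strict_mono (r :: nat \<Rightarrow> nat)" "\<And>w. convergent (\<lambda>n. A (r n) w)"
    using pointwise_convergent_subsequence[of A 1] Aabs by blast
  then obtain P where P: "\<And>w. (\<lambda>n. A (r n) w) \<longlonglongrightarrow> P w" unfolding convergent_def by metis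
  have rinf: "filterlim r at_top sequentially" using r(1) by (rule filterlim_subseq)
  have P': "(\<lambda>n. A' (r n) w) \<longlonglongrightarrow> P w" for w
  proof -
    have "(\<lambda>N. 2 / real N) \<longlonglongrightarrow> 0" by (rule lim_const_over_n)
    then have lim: "(\<lambda>n. 2 / real (r n)) \<longlonglongrightarrow> 0" using rinf by (rule filterlim_compose)
    have close: "\<bar>A' N w - A N w\<bar> \<le> 2 / real N" for N
    proof -
      have "(\<Sum>i<N. pullback (Suc i) w) - (\<Sum>i<N. pullback i w) = pullback N w - pullback 0 w"
        using sum_lessThan_telescope[of "\<lambda>i. pullback i w" N] by (simp add: sum_subtractf)
      moreover have "\<bar>pullback N w - pullback 0 w\<bar> \<le> 2"
        using pullback_range[of N w] pullback_range[of 0 w] by linarith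
      ultimately show ?thesis
        by (simp add: A_def A'_def diff_divide_distrib[symmetric] divide_right_mono)
    qed
    have "(\<lambda>n. A' (r n) w - A (r n) w) \<longlonglongrightarrow> 0"
      by (rule Lim_null_comparison[OF _ lim]) (simp add: close)
    from tendsto_add[OF this P[of w]] show ?thesis by simp
  qed
  have r_pos: "\<forall>\<^sub>F n in sequentially. r n > 0"
    by (rule eventually_mono[OF eventually_gt_at_top[of 0]]) (use seq_suble[OF r(1)] less_le_trans in blast)
  have "stationary_law UNIV P"
  proof
    fix w
    show "0 \<le> P w"
      by (rule tendsto_lowerbound[OF P]) (auto simp: A_def sum_nonneg pullback_range)
    have "\<forall>\<^sub>F n in sequentially. A (r n) [] = 1"
      using r_pos by eventually_elim (simp add: A_def pullback_Nil)
    then show "P [] = 1" using LIMSEQ_unique[OF P tendsto_eventually] by blast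
    have "(\<Sum>b\<in>UNIV. A N (w @ [b])) = A N w" for N
      unfolding A_def sum_divide_distrib[symmetric] by (subst sum.swap) (simp add: sum_pullback_snoc)
    then show "(\<Sum>b\<in>UNIV. P (w @ [b])) = P w"
      using LIMSEQ_unique[OF tendsto_sum[where f = "\<lambda>b n. A (r n) (w @ [b])", OF P] , of UNIV "P w"] P[of w]
      by simp
    have "(\<Sum>b\<in>UNIV. A' N (b # w)) = A N w" for N
      unfolding A_def A'_def sum_divide_distrib[symmetric] by (subst sum.swap) (simp add: sum_pullback_Cons)
    then show "(\<Sum>b\<in>UNIV. P (b # w)) = P w"
      using LIMSEQ_unique[OF tendsto_sum[where f = "\<lambda>b n. A' (r n) (b # w)", OF P'] , of UNIV "P w"] P[of w]
      by simp
  qed simp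
  moreover have "gibbs_law P"
    unfolding gibbs_law_def
  proof (intro conjI allI ballI)
    show "P [] = 1" using \<open>stationary_law UNIV P\<close> by (rule stationary_law.law_Nil)
    fix a :: 'a and w x assume x: "x \<in> cylinder (a # w)"
    let ?o = "osc (Suc (length w))"
    have "A N w * exp (\<phi> x - ?o) \<le> A' N (a # w)" for N
      unfolding A_def A'_def times_divide_eq_left sum_distrib_right
      by (intro divide_right_mono sum_mono pullback_Cons_bounds x) auto
    then show "P w * exp (\<phi> x - ?o) \<le> P (a # w)"
      by (intro LIMSEQ_le[OF tendsto_mult_right[OF P] P']) auto
    have "A' N (a # w) \<le> A N w * exp (\<phi> x + ?o)" for N
      unfolding A_def A'_def times_divide_eq_left sum_distrib_right
      by (intro divide_right_mono sum_mono pullback_Cons_bounds x) auto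
    then show "P (a # w) \<le> P w * exp (\<phi> x + ?o)"
      by (intro LIMSEQ_le[OF P' tendsto_mult_right[OF P]]) auto
  qed
  ultimately show ?thesis by blast
qed

end

context potential_measure
begin

text \<open>
  Here \<open>P\<close> need not be the law of \<open>\<nu>\<close>: the estimate is applied with \<open>\<nu>\<close> the Gibbs measure itself, and with \<open>\<nu>\<close> the
  empirical measure of a word.
\<close>

lemma mean_log_gibbs_law:
  assumes "gibbs_law P"
  shows "\<bar>(\<Sum>a\<in>words UNIV k. cyl_prob \<nu> a * ln (P a)) - real k * (\<integral>x. \<phi> x \<partial>\<nu>)\<bar> \<le> distortion k"
proof -
  have int: "integrable \<nu> (\<lambda>x. ln (P (prefix_of x k)))"
    by (rule integrable_prefix[of "\<lambda>w. ln (P w)"])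
  have b: "\<bar>ln (P (prefix_of x k)) - birkhoff_sum k x\<bar> \<le> distortion k" for x
    using gibbs_law_log[OF assms, of x "prefix_of x k"] by (simp add: in_cylinder_iff)
  have "\<bar>\<integral>x. ln (P (prefix_of x k)) - birkhoff_sum k x \<partial>\<nu>\<bar> \<le> (\<integral>x. distortion k \<partial>\<nu>)"
    using b int integral_birkhoff_sum(1)
    by (intro order_trans[OF integral_abs_bound] integral_mono) auto
  then show ?thesis
    using int integral_birkhoff_sum[of k] prob_space
    by (simp add: integral_prefix[of "\<lambda>w. ln (P w)"])
qed

lemma gibbs_entropy_rate:
  assumes "gibbs_law (cyl_prob \<nu>)"
  shows "(\<lambda>n. law.H n / real n) \<longlonglongrightarrow> - (\<integral>x. \<phi> x \<partial>\<nu>)"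
proof -
  have "\<bar>law.H n / real n - - (\<integral>x. \<phi> x \<partial>\<nu>)\<bar> \<le> distortion n / real n" if n: "n > 0" for n
  proof -
    have "\<bar>law.H n + real n * (\<integral>x. \<phi> x \<partial>\<nu>)\<bar> \<le> distortion n"
      using mean_log_gibbs_law[OF assms, of n] unfolding block_entropy_def by linarith
    moreover have "law.H n / real n - - (\<integral>x. \<phi> x \<partial>\<nu>) = (law.H n + real n * (\<integral>x. \<phi> x \<partial>\<nu>)) / real n"
      using n by (simp add: add_divide_distrib)
    ultimately show ?thesis by (simp add: divide_right_mono)
  qed
  then have "\<forall>\<^sub>F n in sequentially. norm (law.H n / real n - - (\<integral>x. \<phi> x \<partial>\<nu>)) \<le> distortion n / real n"
    by (auto simp: eventually_sequentially intro!: exI[of _ 1])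
  from Lim_null_comparison[OF this distortion_sublinear]
  show ?thesis by (rule LIM_zero_cancel)
qed

text \<open>
  The partition according to the first letter has the block entropies as entropies of its joins.
\<close>

lemma KS_entropy_ge_rate:
  assumes "(\<lambda>n. law.H n / real n) \<longlonglongrightarrow> l"
  shows "ereal l \<le> KS_entropy \<nu>"
proof -
  define p where "p = (\<lambda>x :: nat \<Rightarrow> 'a. to_nat (x 0))"
  have range_p: "finite (range p)"
  proof -
    have "range p \<subseteq> range (to_nat :: 'a \<Rightarrow> nat)" by (auto simp: p_def)
    then show ?thesis by (rule finite_subset) simp
  qed
  have p_sets: "p -` {c} \<in> sets \<nu>" for c
  proof -
    have "p -` {c} = (\<Union>a\<in>{a. to_nat a = c}. cylinder [a])"
      by (auto simp: p_def in_cylinder_nth)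
    then show ?thesis by auto
  qed
  then have "simple_function \<nu> p" unfolding simple_function_def using range_p by auto
  moreover have "join_entropy \<nu> p n = law.H n" for n
  proof -
    have it: "itinerary p n x = map to_nat (prefix_of x n)" for x
      by (simp add: itinerary_def p_def prefix_of_def funpow_shift)
    have "range (\<lambda>x :: nat \<Rightarrow> 'a. prefix_of x n) = words UNIV n"
    proof
      show "words UNIV n \<subseteq> range (\<lambda>x :: nat \<Rightarrow> 'a. prefix_of x n)"
      proof
        fix w :: "'a list" assume "w \<in> words UNIV n"
        then have "w = prefix_of (periodic_ext w) n"
          using periodic_ext_in_cylinder[of w] by (simp add: words_UNIV in_cylinder_iff)
        then show "w \<in> range (\<lambda>x :: nat \<Rightarrow> 'a. prefix_of x n)" by blast
      qed
    qed (auto simp: words_UNIV)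
    moreover have "range (itinerary p n) = map to_nat ` range (\<lambda>x :: nat \<Rightarrow> 'a. prefix_of x n)"
      by (simp add: image_image it)
    ultimately have rng: "range (itinerary p n) = map to_nat ` (words UNIV n :: 'a list set)" by simp
    have inj: "inj (map (to_nat :: 'a \<Rightarrow> nat))" by (simp add: inj_mapI)
    have vim: "itinerary p n -` {map to_nat w} = cylinder w" if "w \<in> words UNIV n" for w
    proof (rule set_eqI)
      fix x
      have "length w = n" using that by (simp add: words_UNIV)
      then show "x \<in> itinerary p n -` {map to_nat w} \<longleftrightarrow> x \<in> cylinder w"
        by (simp add: it inj_eq[OF inj] in_cylinder_iff)
    qed
    show ?thesis
      unfolding join_entropy_def rng block_entropy_def
      by (subst sum.reindex[OF inj_on_subset[OF inj]]) (auto simp: vim cyl_prob_def intro!: sum.cong)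
  qed
  then have "partition_entropy \<nu> p = l" using limI[OF assms] by (simp add: partition_entropy_def)
  ultimately show ?thesis unfolding KS_entropy_def by (intro SUP_upper2[of p]) auto
qed

end

text \<open>
  The invariant Gibbs measure shows that the supremum in the definition of an equilibrium state is at
  least \<open>0\<close>.
\<close>

theorem (in normalized_potential) equilibrium_state_gibbs_law:
  assumes "equilibrium_state \<phi> \<rho>"
  shows "gibbs_law (cyl_prob \<rho>)"
proof -
  obtain P where P: "stationary_law UNIV P" "gibbs_law P" using stationary_gibbs_law_exists by blast
  obtain \<eta> where \<eta>: "\<eta> \<in> invariant_measures" "cyl_prob \<eta> = P" using invariant_extension[OF P(1)] by blast
  interpret \<eta>: potential_measure g \<eta>
    using \<eta>(1) by unfold_locales
  have "ereal (- (\<integral>x. \<phi> x \<partial>\<eta>)) \<le> KS_entropy \<eta>"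
    using \<eta>.KS_entropy_ge_rate[OF \<eta>.gibbs_entropy_rate] P(2) \<eta>(2) by simp
  then have "ereal (\<integral>x. \<phi> x \<partial>\<eta>) + ereal (- (\<integral>x. \<phi> x \<partial>\<eta>)) \<le> ereal (\<integral>x. \<phi> x \<partial>\<eta>) + KS_entropy \<eta>"
    by (rule add_left_mono)
  then have "0 \<le> ereal (\<integral>x. \<phi> x \<partial>\<eta>) + KS_entropy \<eta>"
    by (simp add: zero_ereal_def)
  also have "\<dots> \<le> (SUP \<eta>\<in>invariant_measures. ereal (\<integral>x. \<phi> x \<partial>\<eta>) + KS_entropy \<eta>)"
    using \<eta>(1) by (rule SUP_upper)
  also have "\<dots> = ereal (\<integral>x. \<phi> x \<partial>\<rho>) + KS_entropy \<rho>"
    using assms by (simp add: equilibrium_state_def)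
  finally have *: "0 \<le> ereal (\<integral>x. \<phi> x \<partial>\<rho>) + KS_entropy \<rho>" .
  interpret \<rho>: potential_measure g \<rho>
    using assms by unfold_locales (simp add: equilibrium_state_def)
  show ?thesis using \<rho>.gibbs_law_of_nonneg_pressure[OF *] .
qed


section \<open>Empirical measures of finite words\<close>

lemma (in stationary_law) entropy_le_ln_card:
  assumes B: "finite B" "\<And>w. w \<in> words S n \<Longrightarrow> P w > 0 \<Longrightarrow> w \<in> B"
  shows "H n \<le> ln (card B)"
proof -
  let ?C = "{w \<in> words S n. P w > 0}"
  have C: "finite ?C" "?C \<subseteq> B" using B by (auto simp: finite_words finite_alphabet)
  have restrict: "(\<Sum>w\<in>words S n. P w * F w) = (\<Sum>w\<in>?C. P w * F w)" for F
  proof (rule sum.mono_neutral_right)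
    show "\<forall>w\<in>words S n - ?C. P w * F w = 0" using nonneg by (force simp: order.order_iff_strict)
  qed (auto simp: finite_words finite_alphabet)
  have sum1: "sum P ?C = 1" using restrict[of "\<lambda>_. 1"] sum_law by simp
  then have "?C \<noteq> {}" by force
  then have c: "card ?C > 0" using C by (simp add: card_gt_0_iff)
  have "(\<Sum>w\<in>?C. P w * ln (1 / card ?C)) \<le> (\<Sum>w\<in>?C. P w * ln (P w))"
    by (rule gibbs_inequality) (use c sum1 in auto)
  moreover have "(\<Sum>w\<in>?C. P w * ln (1 / card ?C)) = - ln (card ?C)"
    unfolding sum_distrib_right[symmetric] sum1 using c by (simp add: ln_div)
  ultimately have "H n \<le> ln (card ?C)"
    by (simp add: block_entropy_def restrict)
  also have "\<dots> \<le> ln (card B)" using c card_mono[OF B(1) C(2)] by simp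
  finally show ?thesis .
qed

text \<open>
  The uniform measure on the orbit of the periodic extension.  Working with a measure rather than with
  counts lets the results on invariant measures apply to empirical frequencies.
\<close>

definition orbit_measure :: "'a::finite list \<Rightarrow> (nat \<Rightarrow> 'a) measure" where
  "orbit_measure x = distr (uniform_count_measure {..<length x}) seq_borel
     (\<lambda>i. (shift ^^ i) (periodic_ext x))"

lemma sets_orbit_measure [simp]: "sets (orbit_measure x) = sets seq_borel"
  by (simp add: orbit_measure_def)

lemma shift_period: "(shift ^^ (i + length x)) (periodic_ext x) = (shift ^^ i) (periodic_ext x)"
  by (auto simp: funpow_shift periodic_ext_def fun_eq_iff) (metis ab_semigroup_add_class.add_ac(1) mod_add_self2)

lemma orbit_measurable:
  "(\<lambda>i. (shift ^^ i) (periodic_ext x)) \<in> measurable (uniform_count_measure {..<n}) seq_borel"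
  by (auto simp: measurable_def sets_uniform_count_measure space_uniform_count_measure)

lemma measure_orbit_measure:
  assumes "B \<in> sets seq_borel" "x \<noteq> []"
  shows "measure (orbit_measure x) B =
    (\<Sum>i<length x. indicator B ((shift ^^ i) (periodic_ext x))) / length x"
proof -
  have "measure (orbit_measure x) B =
      measure (uniform_count_measure {..<length x}) {i. i < length x \<and> (shift ^^ i) (periodic_ext x) \<in> B}"
    unfolding orbit_measure_def using assms(1)
    by (subst measure_distr[OF orbit_measurable])
      (auto simp: space_uniform_count_measure intro!: arg_cong[where f="measure _"])
  also have "\<dots> = card {i. i < length x \<and> (shift ^^ i) (periodic_ext x) \<in> B} / length x"
    using assms by (subst measure_uniform_count_measure) auto
  also have "{i. i < length x \<and> (shift ^^ i) (periodic_ext x) \<in> B} =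
      {..<length x} \<inter> {i. (shift ^^ i) (periodic_ext x) \<in> B}" by auto
  also have "real (card \<dots>) = (\<Sum>i<length x. indicator B ((shift ^^ i) (periodic_ext x)))"
    by (simp add: indicator_def sum.If_cases)
  finally show ?thesis .
qed

lemma prob_space_orbit_measure: "x \<noteq> [] \<Longrightarrow> prob_space (orbit_measure x)"
  unfolding orbit_measure_def
  by (intro prob_space.prob_space_distr prob_space_uniform_count_measure orbit_measurable) auto

lemma integral_orbit_measure:
  fixes f :: "(nat \<Rightarrow> 'a::finite) \<Rightarrow> real"
  assumes "f \<in> borel_measurable seq_borel" "x \<noteq> []"
  shows "(\<integral>y. f y \<partial>orbit_measure x) = (\<Sum>i<length x. f ((shift ^^ i) (periodic_ext x))) / length x"
  unfolding orbit_measure_def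
  by (subst integral_distr[OF orbit_measurable assms(1)]) (simp add: integral_uniform_count_measure)

lemma orbit_measure_invariant:
  assumes "x \<noteq> []"
  shows "orbit_measure x \<in> invariant_measures"
proof -
  interpret prob_space "orbit_measure x" by (rule prob_space_orbit_measure[OF assms])
  have sp: "space (orbit_measure x) = UNIV" by (simp add: orbit_measure_def)
  have sh: "shift \<in> measurable (orbit_measure x) (orbit_measure x)"
    using measurable_shift by (simp add: measurable_cong_sets[OF sets_orbit_measure sets_orbit_measure])
  have "distr (orbit_measure x) (orbit_measure x) shift = orbit_measure x"
  proof (rule measure_eqI_cylinders)
    fix w :: "'a list"
    let ?F = "\<lambda>i. indicator (cylinder w) ((shift ^^ i) (periodic_ext x)) :: real"
    have "shift -` cylinder w \<in> sets seq_borel"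
      using measurable_sets[OF measurable_shift cylinder_in_sets] by simp
    then have "measure (distr (orbit_measure x) (orbit_measure x) shift) (cylinder w) =
        (\<Sum>i<length x. indicator (shift -` cylinder w) ((shift ^^ i) (periodic_ext x))) / length x"
      using assms by (simp add: measure_distr[OF sh] sp measure_orbit_measure)
    also have "\<dots> = (\<Sum>i<length x. ?F (Suc i)) / length x"
      by (simp add: indicator_def)
    also have "(\<Sum>i<length x. ?F (Suc i)) = (\<Sum>i<length x. ?F i)"
    proof -
      have "(\<Sum>i<length x. ?F (Suc i) - ?F i) = ?F (0 + length x) - ?F 0"
        using sum_lessThan_telescope[of ?F "length x"] by simp
      then show ?thesis unfolding shift_period by (simp add: sum_subtractf)
    qed
    also have "\<dots> / length x = measure (orbit_measure x) (cylinder w)"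
      using assms by (simp add: measure_orbit_measure)
    finally show "measure (distr (orbit_measure x) (orbit_measure x) shift) (cylinder w) =
        measure (orbit_measure x) (cylinder w)" .
  qed (auto simp: prob_space_axioms prob_space_distr sh)
  then show ?thesis by (simp add: invariant_measures_def prob_space_axioms)
qed

text \<open>
  A shift-invariant set contains either all points of the orbit or none.
\<close>

lemma orbit_measure_ergodic:
  assumes "x \<noteq> []"
  shows "orbit_measure x \<in> ergodic_measures"
proof -
  have "measure (orbit_measure x) B = 0 \<or> measure (orbit_measure x) B = 1"
    if B: "B \<in> sets (orbit_measure x)" "shift -` B = B" for B
  proof -
    have "(shift ^^ i) y \<in> B \<longleftrightarrow> y \<in> B" for i y
    proof (induction i)
      case (Suc i)
      have "(shift ^^ Suc i) y \<in> B \<longleftrightarrow> (shift ^^ i) y \<in> shift -` B" by simp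
      then show ?case using Suc B(2) by simp
    qed simp
    then have "measure (orbit_measure x) B =
        (\<Sum>i<length x. indicator B (periodic_ext x)) / length x"
      using B assms by (simp add: measure_orbit_measure indicator_def)
    then show ?thesis using assms by (cases "periodic_ext x \<in> B") auto
  qed
  then show ?thesis using orbit_measure_invariant[OF assms] by (auto simp: ergodic_measures_def)
qed

lemma empirical_eq_cyl_prob:
  assumes "x \<noteq> []" "length a = k"
  shows "empirical x k a = cyl_prob (orbit_measure x) a"
proof -
  have m: "map (periodic_ext x) [i..<i + k] = prefix_of ((shift ^^ i) (periodic_ext x)) k" for i
    by (auto simp: list_eq_iff_nth_eq funpow_shift add.commute)
  have "{i. i < length x \<and> map (periodic_ext x) [i..<i + k] = a} =
      {..<length x} \<inter> {i. (shift ^^ i) (periodic_ext x) \<in> cylinder a}"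
    unfolding m using assms by (auto simp: in_cylinder_iff)
  then have "real (card {i. i < length x \<and> map (periodic_ext x) [i..<i + k] = a}) =
      (\<Sum>i<length x. indicator (cylinder a) ((shift ^^ i) (periodic_ext x)))"
    by (simp add: indicator_def sum.If_cases)
  then show ?thesis
    using assms by (simp add: empirical_def cyl_prob_def measure_orbit_measure)
qed

lemma stationary_empirical:
  assumes "x \<noteq> []"
  shows "stationary_law UNIV (cyl_prob (orbit_measure x))"
  using orbit_measure_invariant[OF assms]
  by (intro shift_invariant.stationary_cyl_prob) (simp add: shift_invariant_def)

definition empirical_entropy :: "'a::finite list \<Rightarrow> nat \<Rightarrow> real" where
  "empirical_entropy x = block_entropy UNIV (cyl_prob (orbit_measure x))"

definition empirical_increment :: "'a::finite list \<Rightarrow> nat \<Rightarrow> real" where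
  "empirical_increment x = entropy_increment UNIV (cyl_prob (orbit_measure x))"

text \<open>
  Hypotheses on \<open>\<nu>\<close> concern words of length \<open>k\<close> only, since empirical frequencies at block length \<open>k\<close> agree with
  cylinder probabilities on these words only.
\<close>

lemma rel_entropy_eq:
  assumes "k > 0" "\<And>a. length a = k \<Longrightarrow> 0 \<le> Q a" "\<And>a. 0 < r a"
    and "\<And>a. length a = k \<Longrightarrow> \<nu> a = Q a"
  shows "rel_entropy k \<nu> r = - block_entropy UNIV Q k - (\<Sum>a\<in>words UNIV k. Q a * ln (r a))"
proof -
  have "\<nu> a * ln (\<nu> a / r a) = Q a * ln (Q a) - Q a * ln (r a)" if "length a = k" for a
    using assms(2)[OF that] assms(3)[of a] assms(4)[OF that]
    by (cases "Q a = 0") (auto simp: ln_div right_diff_distrib)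
  then show ?thesis
    using assms(1) by (simp add: rel_entropy_def block_entropy_def words_UNIV sum_subtractf)
qed

lemma D_hat_eq:
  assumes "x \<noteq> []" "k > 0" "\<And>a. 0 < cyl_prob \<rho> a"
  shows "D_hat k x \<rho> = - empirical_entropy x k -
    (\<Sum>a\<in>words UNIV k. cyl_prob (orbit_measure x) a * ln (cyl_prob \<rho> a))"
  unfolding D_hat_def empirical_entropy_def using assms
  by (intro rel_entropy_eq) (auto simp: empirical_eq_cyl_prob cyl_prob_def)

lemma Delta_hat_eq:
  assumes x: "x \<noteq> []" and k: "k > 0" and pos: "\<And>a. 0 < cyl_prob \<rho> a"
  shows "Delta_hat (Suc k) x \<rho> = - empirical_increment x k -
    (\<Sum>v\<in>words UNIV (Suc k). cyl_prob (orbit_measure x) v * (ln (cyl_prob \<rho> v) - ln (cyl_prob \<rho> (tl v))))"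
proof -
  interpret Q: stationary_law UNIV "cyl_prob (orbit_measure x)" by (rule stationary_empirical[OF x])
  have "marginal (empirical x (Suc k)) a = cyl_prob (orbit_measure x) a" if "length a = k" for a
    using that x by (simp add: marginal_def empirical_eq_cyl_prob Q.snoc)
  then have "rel_entropy k (marginal (empirical x (Suc k))) (cyl_prob \<rho>) =
      - Q.H k - (\<Sum>a\<in>words UNIV k. cyl_prob (orbit_measure x) a * ln (cyl_prob \<rho> a))"
    using k pos by (intro rel_entropy_eq) (auto simp: Q.nonneg)
  moreover have "rel_entropy (Suc k) (empirical x (Suc k)) (cyl_prob \<rho>) =
      - Q.H (Suc k) - (\<Sum>a\<in>words UNIV (Suc k). cyl_prob (orbit_measure x) a * ln (cyl_prob \<rho> a))"
    using x pos by (intro rel_entropy_eq) (auto simp: Q.nonneg empirical_eq_cyl_prob)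
  ultimately show ?thesis
    using Q.sum_tl[of "\<lambda>a. ln (cyl_prob \<rho> a)" k]
    by (simp add: Delta_hat_def cond_rel_entropy_def empirical_increment_def entropy_increment_def
        right_diff_distrib sum_subtractf)
qed

lemma empirical_increment_bounds:
  assumes "x \<noteq> []"
  shows "0 \<le> empirical_increment x k"
    and "real (Suc k) * empirical_increment x k \<le> empirical_entropy x (Suc k)"
proof -
  interpret Q: stationary_law UNIV "cyl_prob (orbit_measure x)" by (rule stationary_empirical[OF assms])
  show "0 \<le> empirical_increment x k"
    "real (Suc k) * empirical_increment x k \<le> empirical_entropy x (Suc k)"
    unfolding empirical_increment_def empirical_entropy_def
    by (rule Q.increment_nonneg Q.increment_le_mean)+
qed

lemma D_hat_nonneg:
  assumes "x \<noteq> []" "k > 0" "\<And>a. 0 < cyl_prob \<rho> a" "stationary_law UNIV (cyl_prob \<rho>)"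
  shows "0 \<le> D_hat k x \<rho>"
proof -
  interpret Q: stationary_law UNIV "cyl_prob (orbit_measure x)" by (rule stationary_empirical[OF assms(1)])
  have "(\<Sum>a\<in>words UNIV k. cyl_prob (orbit_measure x) a * ln (cyl_prob \<rho> a)) \<le>
      (\<Sum>a\<in>words UNIV k. cyl_prob (orbit_measure x) a * ln (cyl_prob (orbit_measure x) a))"
    using assms(3) by (intro gibbs_inequality Q.nonneg)
      (auto simp: less_imp_le Q.sum_law stationary_law.sum_law[OF assms(4)])
  then show ?thesis
    using assms by (simp add: D_hat_eq empirical_entropy_def block_entropy_def)
qed

section \<open>Counting words of a given type\<close>

lemma card_words: "finite S \<Longrightarrow> card (words S n) = card S ^ n"
  unfolding words_def by (rule card_lists_length_eq)

text \<open>
  The product is the probability of \<open>x\<close> under the Markov chain of memory \<open>k\<close> with transition probabilities \<open>R\<close>, given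
  its first \<open>k\<close> letters.  These are summed over without weight, which gives the factor \<open>CARD('a) ^ k\<close>.
\<close>

lemma sum_words_sliding_window:
  fixes R :: "'a::finite list \<Rightarrow> real"
  assumes "\<And>v. 0 \<le> R v" "\<And>c. (\<Sum>b\<in>UNIV. R (c @ [b])) \<le> 1"
  shows "(\<Sum>x\<in>words UNIV (m + k). \<Prod>i<m. R (take (Suc k) (drop i x))) \<le> real CARD('a) ^ k"
proof (induction m)
  case 0
  then show ?case by (simp add: card_words)
next
  case (Suc m)
  have "(\<Sum>x\<in>words UNIV (Suc m + k). \<Prod>i<Suc m. R (take (Suc k) (drop i x))) =
      (\<Sum>x\<in>words UNIV (m + k). \<Sum>b\<in>UNIV. (\<Prod>i<m. R (take (Suc k) (drop i x))) * R (drop m x @ [b]))"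
    unfolding add_Suc sum_words_snoc[OF finite]
    by (intro sum.cong refl) (auto simp: words_UNIV intro!: prod.cong)
  also have "\<dots> = (\<Sum>x\<in>words UNIV (m + k). (\<Prod>i<m. R (take (Suc k) (drop i x))) * (\<Sum>b\<in>UNIV. R (drop m x @ [b])))"
    by (simp add: sum_distrib_left)
  also have "\<dots> \<le> (\<Sum>x\<in>words UNIV (m + k). (\<Prod>i<m. R (take (Suc k) (drop i x))) * 1)"
    by (intro sum_mono mult_left_mono assms prod_nonneg)
  finally show ?case using Suc by simp
qed

text \<open>
  The empirical transition probability of memory \<open>length v - 1\<close>, expressed by the block counts \<open>\<tau>\<close> alone.
\<close>

definition count_ratio :: "('a::finite list \<Rightarrow> nat) \<Rightarrow> 'a list \<Rightarrow> real" where
  "count_ratio \<tau> v = real (\<tau> v) / (\<Sum>b\<in>UNIV. real (\<tau> (butlast v @ [b])))"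

text \<open>
  The left side is the probability of the cyclic word \<open>x\<close> under its own empirical Markov chain.  The \<open>k\<close> factors
  whose windows wrap around the end of \<open>x\<close> are at most \<open>1\<close> and are dropped, so that the remaining windows
  lie inside \<open>x\<close>.
\<close>

lemma exp_empirical_increment_le:
  assumes n: "length x = m + k" and x: "x \<noteq> []"
  defines "\<tau> \<equiv> \<lambda>v. card {i. i < length x \<and> (shift ^^ i) (periodic_ext x) \<in> cylinder v}"
  shows "exp (- (real (length x) * empirical_increment x k)) \<le>
    (\<Prod>i<m. count_ratio \<tau> (take (Suc k) (drop i x)))"
proof -
  let ?Q = "cyl_prob (orbit_measure x)"
  interpret Q: stationary_law UNIV ?Q by (rule stationary_empirical[OF x])
  interpret shift_invariant "orbit_measure x"
    using orbit_measure_invariant[OF x] by (simp add: shift_invariant_def)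
  have \<tau>Q: "real (\<tau> v) = length x * ?Q v" for v
  proof -
    have "{i. i < length x \<and> (shift ^^ i) (periodic_ext x) \<in> cylinder v} =
        {..<length x} \<inter> {i. (shift ^^ i) (periodic_ext x) \<in> cylinder v}" by auto
    then show ?thesis
      using x by (simp add: \<tau>_def cyl_prob_def measure_orbit_measure indicator_def sum.If_cases)
  qed
  have ratio: "count_ratio \<tau> v = ?Q v / ?Q (butlast v)" for v
    using x by (simp add: count_ratio_def \<tau>Q sum_distrib_left[symmetric] Q.snoc)
  let ?V = "\<lambda>i. prefix_of ((shift ^^ i) (periodic_ext x)) (Suc k)"
  have Vw: "?V i \<in> words UNIV (Suc k)" for i by (simp add: words_UNIV)
  have Vpos: "?Q (?V i) > 0" if "i < length x" for i
  proof -
    have "(shift ^^ i) (periodic_ext x) \<in> cylinder (?V i)" by (simp add: in_cylinder_iff)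
    then have "{i} \<subseteq> {j. j < length x \<and> (shift ^^ j) (periodic_ext x) \<in> cylinder (?V i)}"
      using that by simp
    then have "card {i} \<le> \<tau> (?V i)" unfolding \<tau>_def by (intro card_mono) auto
    then have "real (\<tau> (?V i)) > 0" by simp
    then show ?thesis unfolding \<tau>Q using Q.nonneg[of "?V i"] by (simp add: zero_less_mult_iff)
  qed
  have Rpos: "count_ratio \<tau> (?V i) > 0" and Rle: "count_ratio \<tau> (?V i) \<le> 1" if "i < length x" for i
    using Vpos[OF that] Q.le_butlast[OF Vw, of i] unfolding ratio by auto
  have "- (real (length x) * empirical_increment x k) =
      length x * (\<Sum>v\<in>words UNIV (Suc k). ?Q v * (ln (?Q v) - ln (?Q (butlast v))))"
    using Q.sum_butlast[of "\<lambda>v. ln (?Q v)" k]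
    by (simp add: empirical_increment_def entropy_increment_def block_entropy_def
        right_diff_distrib sum_subtractf)
  also have "\<dots> = length x * (\<integral>y. (\<lambda>v. ln (?Q v) - ln (?Q (butlast v))) (prefix_of y (Suc k)) \<partial>orbit_measure x)"
    by (simp only: integral_prefix[of "\<lambda>v. ln (?Q v) - ln (?Q (butlast v))" "Suc k"])
  also have "\<dots> = (\<Sum>i<length x. ln (?Q (?V i)) - ln (?Q (butlast (?V i))))"
  proof -
    have "integrable (orbit_measure x) (\<lambda>y. (\<lambda>v. ln (?Q v) - ln (?Q (butlast v))) (prefix_of y (Suc k)))"
      by (rule integrable_prefix[of "\<lambda>v. ln (?Q v) - ln (?Q (butlast v))"])
    from borel_measurable_integrable[OF this]
    have "(\<lambda>y. (\<lambda>v. ln (?Q v) - ln (?Q (butlast v))) (prefix_of y (Suc k))) \<in> borel_measurable seq_borel"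
      by (simp only: measurable_cong_sets[OF sets_orbit_measure refl])
    from integral_orbit_measure[OF this x] show ?thesis using x by simp
  qed
  also have "\<dots> = (\<Sum>i<length x. ln (count_ratio \<tau> (?V i)))"
  proof (rule sum.cong[OF refl])
    fix i assume "i \<in> {..<length x}"
    then have "?Q (?V i) > 0" using Vpos by simp
    moreover from this have "?Q (butlast (?V i)) > 0" using Q.le_butlast[OF Vw, of i] by linarith
    ultimately show "ln (?Q (?V i)) - ln (?Q (butlast (?V i))) = ln (count_ratio \<tau> (?V i))"
      by (simp add: ratio ln_div)
  qed
  also have "\<dots> \<le> (\<Sum>i<m. ln (count_ratio \<tau> (?V i)))"
  proof -
    have "{..<length x} = {..<m} \<union> {m..<length x}" using n by auto
    moreover have "(\<Sum>i\<in>{m..<length x}. ln (count_ratio \<tau> (?V i))) \<le> 0"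
      using Rpos Rle by (intro sum_nonpos) auto
    ultimately show ?thesis by (simp add: sum.union_disjoint ivl_disj_int)
  qed
  finally have "exp (- (real (length x) * empirical_increment x k)) \<le>
      exp (\<Sum>i<m. ln (count_ratio \<tau> (?V i)))" by simp
  also have "\<dots> = (\<Prod>i<m. count_ratio \<tau> (?V i))"
    using Rpos n by (simp add: exp_sum)
  also have "\<dots> = (\<Prod>i<m. count_ratio \<tau> (take (Suc k) (drop i x)))"
  proof (intro prod.cong refl arg_cong[where f="count_ratio \<tau>"])
    fix i assume i: "i \<in> {..<m}"
    show "?V i = take (Suc k) (drop i x)"
      using i n by (auto simp: list_eq_iff_nth_eq funpow_shift periodic_ext_def add.commute)
  qed
  finally show ?thesis .
qed

text \<open>
  The weight of \<open>x\<close> depends on \<open>x\<close> and on its type, the table of its block counts.  For a fixed type the weights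
  have sum at most \<open>CARD('a) ^ k\<close> over all words, and a type is a function from the blocks of length
  \<open>k + 1\<close> to \<open>{..n}\<close>.
\<close>

theorem sum_exp_empirical_increment_le:
  assumes n: "n = m + k" "n > 0"
  shows "(\<Sum>x\<in>words (UNIV :: 'a::finite set) n. exp (- (real n * empirical_increment x k))) \<le>
    real (Suc n) ^ (CARD('a) ^ Suc k) * real CARD('a) ^ k"
proof -
  define count :: "'a list \<Rightarrow> 'a list \<Rightarrow> nat" where
    "count x v = card {i. i < length x \<and> (shift ^^ i) (periodic_ext x) \<in> cylinder v}" for x v
  define type_of where "type_of x = restrict (count x) (words UNIV (Suc k))" for x
  define weight where "weight \<tau> x = (\<Prod>i<m. count_ratio \<tau> (take (Suc k) (drop i x)))"
    for \<tau> and x :: "'a list"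
  let ?W = "words (UNIV :: 'a set) n" and ?types = "PiE (words UNIV (Suc k)) (\<lambda>_ :: 'a list. {..n})"
  have types: "type_of x \<in> ?types" if "x \<in> ?W" for x
  proof -
    have "count x v \<le> card {..<length x}" for v
      unfolding count_def by (intro card_mono) auto
    then show ?thesis using that by (auto simp: type_of_def words_UNIV)
  qed
  have weight_nonneg: "0 \<le> weight \<tau> x" for \<tau> x
    unfolding weight_def count_ratio_def by (intro prod_nonneg) (auto intro!: divide_nonneg_nonneg sum_nonneg)
  have "(\<Sum>x\<in>?W. exp (- (real n * empirical_increment x k))) \<le> (\<Sum>x\<in>?W. weight (type_of x) x)"
  proof (rule sum_mono)
    fix x assume x: "x \<in> ?W"
    then have len: "length x = m + k" and ne: "x \<noteq> []" using n by (auto simp: words_UNIV)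
    have "count_ratio (type_of x) v = count_ratio (count x) v" if "length v = Suc k" for v
      using that by (simp add: count_ratio_def type_of_def words_UNIV)
    then have "weight (type_of x) x = weight (count x) x"
      unfolding weight_def using len by (intro prod.cong refl) auto
    then show "exp (- (real n * empirical_increment x k)) \<le> weight (type_of x) x"
      using exp_empirical_increment_le[OF len ne] len n unfolding weight_def count_def by simp
  qed
  also have "\<dots> \<le> (\<Sum>x\<in>?W. \<Sum>\<tau>\<in>?types. weight \<tau> x)"
    using types weight_nonneg
    by (intro sum_mono member_le_sum[where f="\<lambda>\<tau>. weight \<tau> _"]) (auto simp: finite_words finite_PiE)
  also have "\<dots> = (\<Sum>\<tau>\<in>?types. \<Sum>x\<in>?W. weight \<tau> x)" by (rule sum.swap)
  also have "\<dots> \<le> (\<Sum>\<tau>\<in>?types. real CARD('a) ^ k)"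
  proof (rule sum_mono)
    fix \<tau>
    show "(\<Sum>x\<in>?W. weight \<tau> x) \<le> real CARD('a) ^ k"
      unfolding weight_def n(1)
    proof (rule sum_words_sliding_window)
      show "0 \<le> count_ratio \<tau> v" for v by (simp add: count_ratio_def sum_nonneg)
      show "(\<Sum>b\<in>UNIV. count_ratio \<tau> (c @ [b])) \<le> 1" for c
        unfolding count_ratio_def butlast_snoc sum_divide_distrib[symmetric] by (simp add: divide_self_if)
    qed
  qed
  also have "\<dots> = real (Suc n) ^ (CARD('a) ^ Suc k) * real CARD('a) ^ k"
    by (simp add: card_PiE finite_words card_words)
  finally show ?thesis .
qed

section \<open>Empirical divergences under a Gibbs law\<close>

context potential_measure
begin

lemma mean_log_gibbs_law_step:
  assumes "gibbs_law P"
  shows "\<bar>(\<Sum>v\<in>words UNIV (Suc k). cyl_prob \<nu> v * (ln (P v) - ln (P (tl v)))) - (\<integral>x. \<phi> x \<partial>\<nu>)\<bar> \<le> osc (Suc k)"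
proof -
  let ?F = "\<lambda>v. ln (P v) - ln (P (tl v))"
  have int: "integrable \<nu> (\<lambda>x. ?F (prefix_of x (Suc k)))"
    by (rule integrable_prefix[of ?F])
  have b: "\<bar>?F (prefix_of x (Suc k)) - \<phi> x\<bar> \<le> osc (Suc k)" for x
    using gibbs_law_step[OF assms, of x "x 0" "prefix_of (shift x) k"]
    by (simp add: in_cylinder_iff prefix_of_Suc_Cons)
  have "\<bar>\<integral>x. ?F (prefix_of x (Suc k)) - \<phi> x \<partial>\<nu>\<bar> \<le> (\<integral>x. osc (Suc k) \<partial>\<nu>)"
    using b int integrable_phi
    by (intro order_trans[OF integral_abs_bound] integral_mono) auto
  then have "\<bar>(\<integral>x. ?F (prefix_of x (Suc k)) \<partial>\<nu>) - (\<integral>x. \<phi> x \<partial>\<nu>)\<bar> \<le> osc (Suc k)"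
    using prob_space unfolding Bochner_Integration.integral_diff[OF int integrable_phi] by simp
  then show ?thesis unfolding integral_prefix[of ?F] .
qed

end

context normalized_potential
begin

lemma orbit_potential_measure: "x \<noteq> [] \<Longrightarrow> potential_measure g (orbit_measure x)"
  using orbit_measure_invariant[of x] by unfold_locales

lemma integral_phi_orbit_measure:
  "x \<noteq> [] \<Longrightarrow> real (length x) * (\<integral>y. \<phi> y \<partial>orbit_measure x) = birkhoff_sum (length x) (periodic_ext x)"
  by (simp add: integral_orbit_measure[OF measurable_phi] birkhoff_sum_def)

lemma log_prob_orbit_measure:
  assumes "gibbs_law P" "x \<noteq> []"
  shows "\<bar>ln (P x) - real (length x) * (\<integral>y. \<phi> y \<partial>orbit_measure x)\<bar> \<le> distortion (length x)"
  using gibbs_law_log[OF assms(1) periodic_ext_in_cylinder[of x]] assms(2)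
  by (simp add: integral_phi_orbit_measure)

text \<open>
  One bound for both statistics: the first term comes from \<open>Delta_hat\<close>, the second from \<open>D_hat\<close>, and the third
  from replacing the Birkhoff sum along the periodic orbit by the logarithm of a probability.
\<close>

definition error_bound :: "nat \<Rightarrow> nat \<Rightarrow> real" where
  "error_bound k n = real n * osc k + real n * (distortion k / real k) + distortion n"

lemma Delta_hat_approx:
  assumes "gibbs_law (cyl_prob \<rho>)" "x \<noteq> []" "k > 0" "length x = n"
  shows "\<bar>real n * Delta_hat (Suc k) x \<rho> + real n * empirical_increment x k + ln (cyl_prob \<rho> x)\<bar>
    \<le> error_bound (Suc k) n"
proof -
  interpret \<nu>: potential_measure g "orbit_measure x" by (rule orbit_potential_measure[OF assms(2)])
  let ?I = "\<integral>y. \<phi> y \<partial>orbit_measure x"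
  have "\<bar>Delta_hat (Suc k) x \<rho> + empirical_increment x k + ?I\<bar> \<le> osc (Suc k)"
    using \<nu>.mean_log_gibbs_law_step[OF assms(1), of k] Delta_hat_eq[OF assms(2,3) gibbs_law_pos[OF assms(1)]]
    by linarith
  then have "real n * \<bar>Delta_hat (Suc k) x \<rho> + empirical_increment x k + ?I\<bar> \<le> real n * osc (Suc k)"
    by (rule mult_left_mono) simp
  then have "\<bar>real n * Delta_hat (Suc k) x \<rho> + real n * empirical_increment x k + real n * ?I\<bar> \<le> real n * osc (Suc k)"
    by (simp only: abs_mult_pos' distrib_left[symmetric] of_nat_0_le_iff)
  moreover have "\<bar>ln (cyl_prob \<rho> x) - real n * ?I\<bar> \<le> distortion n"
    using log_prob_orbit_measure[OF assms(1,2)] assms(4) by simp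
  moreover have "0 \<le> real n * (distortion (Suc k) / real (Suc k))" using distortion_nonneg by simp
  ultimately show ?thesis unfolding error_bound_def by linarith
qed

lemma D_hat_approx:
  assumes "gibbs_law (cyl_prob \<rho>)" "x \<noteq> []" "k > 0" "length x = n"
  shows "\<bar>real n * (D_hat k x \<rho> / real k) + real n * (empirical_entropy x k / real k) + ln (cyl_prob \<rho> x)\<bar>
    \<le> error_bound k n"
proof -
  interpret \<nu>: potential_measure g "orbit_measure x" by (rule orbit_potential_measure[OF assms(2)])
  let ?I = "\<integral>y. \<phi> y \<partial>orbit_measure x"
  have "\<bar>D_hat k x \<rho> + empirical_entropy x k + real k * ?I\<bar> \<le> distortion k"
    using \<nu>.mean_log_gibbs_law[OF assms(1), of k] D_hat_eq[OF assms(2,3) gibbs_law_pos[OF assms(1)]]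
    by linarith
  then have "\<bar>D_hat k x \<rho> + empirical_entropy x k + real k * ?I\<bar> / real k \<le> distortion k / real k"
    by (rule divide_right_mono) simp
  moreover have "D_hat k x \<rho> / real k + empirical_entropy x k / real k + ?I =
      (D_hat k x \<rho> + empirical_entropy x k + real k * ?I) / real k"
    using assms(3) by (simp add: add_divide_distrib)
  ultimately have "\<bar>D_hat k x \<rho> / real k + empirical_entropy x k / real k + ?I\<bar> \<le> distortion k / real k" by simp
  then have "real n * \<bar>D_hat k x \<rho> / real k + empirical_entropy x k / real k + ?I\<bar> \<le> real n * (distortion k / real k)"
    by (rule mult_left_mono) simp
  then have "\<bar>real n * (D_hat k x \<rho> / real k) + real n * (empirical_entropy x k / real k) + real n * ?I\<bar>
      \<le> real n * (distortion k / real k)"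
    by (simp only: abs_mult_pos' distrib_left[symmetric] of_nat_0_le_iff)
  moreover have "\<bar>ln (cyl_prob \<rho> x) - real n * ?I\<bar> \<le> distortion n"
    using log_prob_orbit_measure[OF assms(1,2)] assms(4) by simp
  moreover have "0 \<le> real n * osc k" using osc_nonneg by simp
  ultimately show ?thesis unfolding error_bound_def by linarith
qed

end


section \<open>Asymptotics of tilted sums\<close>

lemma ln_le_iff_le_exp: "0 < x \<Longrightarrow> ln x \<le> y \<longleftrightarrow> x \<le> exp (y :: real)"
  by (metis exp_le_cancel_iff exp_ln)

text \<open>
  Here \<open>V\<close> is the statistic, \<open>c\<close> its empirical entropy term, \<open>e\<close> a lower bound of \<open>c\<close> that satisfies a Kraft
  inequality, and \<open>I\<close> the smallest possible rate of \<open>ln p\<close>.  With \<open>L = ln (p x)\<close> the summand is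
  \<open>exp ((1 - t) L - t n c)\<close> up to \<open>exp (O(E n))\<close>.
\<close>

lemma tilted_sum_limit:
  fixes W :: "nat \<Rightarrow> 'x set" and p :: "'x \<Rightarrow> real" and V c e :: "nat \<Rightarrow> 'x \<Rightarrow> real"
    and E K :: "nat \<Rightarrow> real" and I t :: real
  assumes fin: "\<And>n. finite (W n)" and pos: "\<And>n x. x \<in> W n \<Longrightarrow> 0 < p x"
    and sum1: "\<And>n. sum p (W n) = 1"
    and E0: "\<And>n. 0 \<le> E n" and K0: "\<And>n. 0 \<le> K n"
    and E_lim: "(\<lambda>n. E n / real n) \<longlonglongrightarrow> 0" and K_lim: "(\<lambda>n. K n / real n) \<longlonglongrightarrow> 0"
    and approx: "\<forall>\<^sub>F n in sequentially. \<forall>x\<in>W n. \<bar>real n * V n x + real n * c n x + ln (p x)\<bar> \<le> E n"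
    and e_le: "\<forall>\<^sub>F n in sequentially. \<forall>x\<in>W n. 0 \<le> e n x \<and> e n x \<le> c n x"
    and V_ge: "\<forall>\<^sub>F n in sequentially. \<forall>x\<in>W n. - 2 * E n \<le> real n * V n x"
    and p_ge: "\<forall>\<^sub>F n in sequentially. \<forall>x\<in>W n. real n * I - E n \<le> ln (p x)"
    and kraft: "\<forall>\<^sub>F n in sequentially. (\<Sum>x\<in>W n. exp (- (real n * e n x))) \<le> exp (K n)"
    and low: "\<And>\<delta>. \<delta> > 0 \<Longrightarrow> \<forall>\<^sub>F n in sequentially. \<exists>x\<in>W n.
      ln (p x) \<le> real n * (I + \<delta>) \<and> real n * c n x \<le> real n * \<delta>"
  shows "(\<lambda>n. 1 / real n * ln (\<Sum>x\<in>W n. p x * exp (real n * t * V n x)))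
    \<longlonglongrightarrow> (if t > 1 then (1 - t) * I else 0)"
proof -
  define Z where "Z t n = (\<Sum>x\<in>W n. p x * exp (real n * t * V n x))" for t n
  define R where "R n = E n + K n + ln 2" for n
  have R: "E n \<le> R n" "0 \<le> R n" "K n \<le> R n" for n using E0[of n] K0[of n] by (auto simp: R_def)
  have "(\<lambda>n. E n / real n + K n / real n + ln 2 / real n) \<longlonglongrightarrow> 0 + 0 + 0"
    by (intro tendsto_add E_lim K_lim lim_const_over_n)
  then have R_lim: "(\<lambda>n. R n / real n) \<longlonglongrightarrow> 0" by (simp add: R_def add_divide_distrib)
  have ne: "W n \<noteq> {}" for n using sum1[of n] by auto
  have Z_pos: "0 < Z t n" for t n
    unfolding Z_def using pos ne fin by (intro sum_pos) auto
  have p_exp: "p x = exp (ln (p x))" if "x \<in> W n" for x n using pos[OF that] by simp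
  have summand: "p x * exp (real n * t * V n x) = exp (ln (p x) + t * (real n * V n x))" if "x \<in> W n" for t n x
    using pos[OF that] by (simp add: exp_add mult.left_commute mult.assoc)
  \<comment> \<open>For \<open>0 \<le> s \<le> 1\<close> the exponent is, up to \<open>E n\<close>, at most a convex combination of \<open>ln (p x)\<close> and \<open>- n e\<close>, hence at most their maximum.\<close>
  have upper_small: "ln (Z s n) \<le> R n" if s: "0 \<le> s" "s \<le> 1"
    and n: "\<forall>x\<in>W n. \<bar>real n * V n x + real n * c n x + ln (p x)\<bar> \<le> E n"
      "\<forall>x\<in>W n. 0 \<le> e n x \<and> e n x \<le> c n x"
      "(\<Sum>x\<in>W n. exp (- (real n * e n x))) \<le> exp (K n)" for s n
  proof -
    have "Z s n \<le> (\<Sum>x\<in>W n. exp (E n) * (p x + exp (- (real n * e n x))))"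
      unfolding Z_def
    proof (rule sum_mono)
      fix x assume x: "x \<in> W n"
      let ?a = "ln (p x)" and ?b = "- (real n * e n x)"
      have "real n * e n x \<le> real n * c n x" using n(2) x by (intro mult_left_mono) auto
      then have "real n * V n x \<le> ?b - ?a + E n" using n(1) x by (auto simp: abs_le_iff)
      then have "s * (real n * V n x) \<le> s * (?b - ?a + E n)" using s by (intro mult_left_mono)
      also have "\<dots> \<le> s * (?b - ?a) + E n"
        using s E0[of n] mult_right_mono[of s 1 "E n"] by (simp add: distrib_left)
      finally have "?a + s * (real n * V n x) \<le> E n + max ?a ?b"
        using s convex_bound_le[of ?a "max ?a ?b" ?b "1 - s" s] by (simp add: algebra_simps)
      then have "p x * exp (real n * s * V n x) \<le> exp (E n) * exp (max ?a ?b)"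
        unfolding summand[OF x] exp_add[symmetric] by simp
      also have "exp (max ?a ?b) \<le> p x + exp ?b"
        using p_exp[OF x] pos[OF x] by (simp add: max_def)
      finally show "p x * exp (real n * s * V n x) \<le> exp (E n) * (p x + exp ?b)" by simp
    qed
    also have "\<dots> \<le> exp (E n) * (1 + exp (K n))"
      unfolding sum_distrib_left[symmetric] sum.distrib sum1 using n(3) by simp
    also have "\<dots> \<le> exp (E n) * (2 * exp (K n))" using K0[of n] by simp
    also have "\<dots> = exp (R n)" by (simp add: R_def exp_add)
    finally show ?thesis using Z_pos[of s n] by (simp add: ln_le_iff_le_exp)
  qed
  show ?thesis
  proof (cases "t > 1")
    case False
    have "\<forall>\<^sub>F n in sequentially. norm (1 / real n * ln (Z t n)) \<le> (2 * \<bar>t\<bar> + 1) * (R n / real n)"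
      using approx e_le V_ge kraft
    proof eventually_elim
      case (elim n)
      have "\<bar>ln (Z t n)\<bar> \<le> (2 * \<bar>t\<bar> + 1) * R n"
      proof (cases "0 \<le> t")
        case True
        have "(\<Sum>x\<in>W n. p x * exp (- 2 * t * E n)) \<le> Z t n"
          unfolding Z_def
        proof (intro sum_mono mult_left_mono)
          fix x assume x: "x \<in> W n"
          have "t * (- 2 * E n) \<le> t * (real n * V n x)" using elim(3) x True by (intro mult_left_mono) auto
          then show "exp (- 2 * t * E n) \<le> exp (real n * t * V n x)" by (simp add: mult.left_commute mult.assoc)
          show "0 \<le> p x" using pos[OF x] by simp
        qed
        then have "exp (- 2 * t * E n) \<le> Z t n" by (simp add: sum_distrib_right[symmetric] sum1)
        then have "- 2 * t * E n \<le> ln (Z t n)" using Z_pos[of t n] by (simp add: ln_ge_iff)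
        moreover have "ln (Z t n) \<le> R n" using upper_small[of t n] True False elim by auto
        moreover have "t * E n \<le> t * R n" "0 \<le> t * R n" using True R[of n] by (auto intro: mult_left_mono)
        ultimately have "- (2 * (t * R n) + R n) \<le> ln (Z t n)" "ln (Z t n) \<le> 2 * (t * R n) + R n"
          using R[of n] by linarith+
        then show ?thesis using True by (simp add: abs_le_iff algebra_simps)
      next
        case False
        define s where "s = - t"
        have s: "s > 0" using False by (simp add: s_def)
        have "Z t n \<le> (\<Sum>x\<in>W n. p x * exp (2 * s * E n))"
          unfolding Z_def
        proof (intro sum_mono mult_left_mono)
          fix x assume x: "x \<in> W n"
          have "s * - (real n * V n x) \<le> s * (2 * E n)" using elim(3) x s by (intro mult_left_mono) auto
          then show "exp (real n * t * V n x) \<le> exp (2 * s * E n)"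
            by (simp add: s_def mult.left_commute mult.assoc)
          show "0 \<le> p x" using pos[OF x] by simp
        qed
        then have "Z t n \<le> exp (2 * s * E n)" by (simp add: sum_distrib_right[symmetric] sum1)
        then have up: "ln (Z t n) \<le> 2 * s * E n" using Z_pos[of t n] by (simp add: ln_le_iff_le_exp)
        have "ln (Z 1 n) \<le> R n" using upper_small[of 1 n] elim by auto
        then have Z1: "Z 1 n \<le> exp (R n)" using Z_pos[of 1 n] by (simp add: ln_le_iff_le_exp)
        \<comment> \<open>The inequality \<open>exp (- s u) \<ge> 1 + s - s exp u\<close> expresses the convexity of the moments between \<open>t = - s\<close>, \<open>0\<close> and \<open>1\<close>; the moment at \<open>1\<close> is at most \<open>exp (R n)\<close>.\<close>
        have "1 \<le> 1 + s - s * (Z 1 n * exp (- R n))"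
        proof -
          have "Z 1 n * exp (- R n) \<le> exp (R n) * exp (- R n)" using Z1 by (intro mult_right_mono) auto
          then have "Z 1 n * exp (- R n) \<le> 1" by (simp add: exp_minus)
          then show ?thesis using s mult_left_mono[of "Z 1 n * exp (- R n)" 1 s] by simp
        qed
        also have "\<dots> = (\<Sum>x\<in>W n. p x * (1 + s - s * exp (real n * V n x - R n)))"
        proof -
          have "(\<Sum>x\<in>W n. p x * (1 + s - s * exp (real n * V n x - R n))) =
              (\<Sum>x\<in>W n. (1 + s) * p x - s * exp (- R n) * (p x * exp (real n * 1 * V n x)))"
            by (intro sum.cong refl) (simp add: exp_diff exp_minus field_simps)
          also have "\<dots> = (1 + s) * sum p (W n) - s * exp (- R n) * Z 1 n"
            by (simp only: sum_subtractf sum_distrib_left[symmetric] Z_def)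
          finally show ?thesis by (simp add: sum1)
        qed
        also have "\<dots> \<le> (\<Sum>x\<in>W n. p x * (exp (real n * t * V n x) * exp (s * R n)))"
        proof (intro sum_mono mult_left_mono)
          fix x assume x: "x \<in> W n"
          let ?u = "real n * V n x - R n"
          have "1 + - (s * ?u) \<le> exp (- (s * ?u))" "s * (1 + ?u) \<le> s * exp ?u"
            using s exp_ge_add_one_self[of "- (s * ?u)"]
            by (simp_all only: mult_left_mono[OF exp_ge_add_one_self[of ?u]] less_imp_le)
          then have "1 + s - s * exp ?u \<le> exp (- (s * ?u))" by (simp add: distrib_left)
          also have "- (s * ?u) = real n * t * V n x + s * R n" by (simp add: s_def algebra_simps)
          finally show "1 + s - s * exp ?u \<le> exp (real n * t * V n x) * exp (s * R n)"
            by (simp add: exp_add)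
          show "0 \<le> p x" using pos[OF x] by simp
        qed
        also have "\<dots> = Z t n * exp (s * R n)" by (simp add: Z_def sum_distrib_right mult.assoc)
        finally have "exp (- (s * R n)) \<le> Z t n" by (simp add: exp_minus field_simps)
        then have "- (s * R n) \<le> ln (Z t n)" using Z_pos[of t n] by (simp add: ln_ge_iff)
        moreover have "s * E n \<le> s * R n" "0 \<le> s * R n" using s R[of n] by (auto intro: mult_left_mono)
        ultimately have "- (2 * (s * R n) + R n) \<le> ln (Z t n)" "ln (Z t n) \<le> 2 * (s * R n) + R n"
          using R[of n] up by linarith+
        then show ?thesis using False by (simp add: s_def abs_le_iff algebra_simps)
      qed
      then have "\<bar>ln (Z t n)\<bar> / real n \<le> (2 * \<bar>t\<bar> + 1) * R n / real n" by (rule divide_right_mono) simp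
      then show ?case by simp
    qed
    moreover have "(\<lambda>n. (2 * \<bar>t\<bar> + 1) * (R n / real n)) \<longlonglongrightarrow> 0"
      using tendsto_mult_right_zero[OF R_lim] .
    ultimately have "(\<lambda>n. 1 / real n * ln (Z t n)) \<longlonglongrightarrow> 0" by (rule Lim_null_comparison)
    then show ?thesis using False by (simp add: Z_def)
  next
    case True
    have "(\<lambda>n. 1 / real n * ln (Z t n)) \<longlonglongrightarrow> (1 - t) * I"
    proof (rule tendstoI)
      fix r :: real assume r: "r > 0"
      \<comment> \<open>Both bounds involve at most three error terms, each of which is at most \<open>n t \<delta> = n r / 4\<close>.\<close>
      define \<delta> where "\<delta> = r / (4 * t)"
      have \<delta>: "\<delta> > 0" using r True by (simp add: \<delta>_def)
      have "\<forall>\<^sub>F n in sequentially. R n / real n < \<delta>" using order_tendstoD(2)[OF R_lim \<delta>] .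
      then show "\<forall>\<^sub>F n in sequentially. dist (1 / real n * ln (Z t n)) ((1 - t) * I) < r"
        using approx e_le p_ge kraft low[OF \<delta>] eventually_gt_at_top[of 0]
      proof eventually_elim
        case (elim n)
        have n: "real n > 0" using elim by simp
        have Rn: "R n < real n * \<delta>" using elim(1) n by (simp add: field_simps)
        have "Z t n \<le> (\<Sum>x\<in>W n. exp ((1 - t) * (real n * I) + (2 * t - 1) * E n) * exp (- (real n * e n x)))"
          unfolding Z_def
        proof (rule sum_mono)
          fix x assume x: "x \<in> W n"
          have e: "0 \<le> real n * e n x" "real n * e n x \<le> real n * c n x"
            using elim(3) x by (auto intro: mult_left_mono)
          have "real n * V n x \<le> E n - real n * e n x - ln (p x)"
            using elim(2) x e by (auto simp: abs_le_iff)
          then have "t * (real n * V n x) \<le> t * (E n - real n * e n x - ln (p x))"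
            using True by (intro mult_left_mono) auto
          moreover have "real n * e n x \<le> t * (real n * e n x)"
            using True e(1) mult_right_mono[of 1 t "real n * e n x"] by simp
          moreover have "(t - 1) * (real n * I - E n) \<le> (t - 1) * ln (p x)"
            using elim(4) x True by (intro mult_left_mono) auto
          ultimately have "ln (p x) + t * (real n * V n x) \<le>
              (1 - t) * (real n * I) + (2 * t - 1) * E n + - (real n * e n x)"
            by (simp add: algebra_simps)
          then show "p x * exp (real n * t * V n x) \<le>
              exp ((1 - t) * (real n * I) + (2 * t - 1) * E n) * exp (- (real n * e n x))"
            unfolding summand[OF x] exp_add[symmetric] by simp
        qed
        also have "\<dots> \<le> exp ((1 - t) * (real n * I) + (2 * t - 1) * E n) * exp (K n)"
          unfolding sum_distrib_left[symmetric] using elim(5) by (intro mult_left_mono) auto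
        finally have "ln (Z t n) \<le> (1 - t) * (real n * I) + (2 * t - 1) * E n + K n"
          using Z_pos[of t n] by (simp add: ln_le_iff_le_exp exp_add)
        also have "\<dots> \<le> (1 - t) * (real n * I) + 2 * t * R n"
        proof -
          have "(2 * t - 1) * E n \<le> (2 * t - 1) * (R n - K n)"
            using True by (intro mult_left_mono) (auto simp: R_def)
          moreover have "0 \<le> (2 * t - 2) * K n" using True K0[of n] by simp
          ultimately show ?thesis using R[of n] by (simp add: algebra_simps)
        qed
        also have "\<dots> < (1 - t) * (real n * I) + real n * r"
        proof -
          have "2 * t * R n < 2 * t * (real n * \<delta>)" using Rn True by (intro mult_strict_left_mono) auto
          also have "\<dots> = real n * r / 2" using True by (simp add: \<delta>_def)
          also have "\<dots> \<le> real n * r" using n r by simp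
          finally show ?thesis by simp
        qed
        finally have up: "ln (Z t n) < real n * ((1 - t) * I + r)" by (simp add: algebra_simps)
        obtain x where x: "x \<in> W n" "ln (p x) \<le> real n * (I + \<delta>)" "real n * c n x \<le> real n * \<delta>"
          using elim(6) by blast
        have "p x * exp (real n * t * V n x) \<le> Z t n"
          unfolding Z_def using pos fin by (intro member_le_sum x) (auto intro: less_imp_le)
        then have "exp (ln (p x) + t * (real n * V n x)) \<le> Z t n" using summand[OF x(1)] by simp
        then have Zge: "ln (p x) + t * (real n * V n x) \<le> ln (Z t n)" using Z_pos[of t n] by (simp add: ln_ge_iff)
        have "- E n - real n * \<delta> - ln (p x) \<le> real n * V n x"
          using elim(2) x by (auto simp: abs_le_iff)
        then have "t * (- E n - real n * \<delta> - ln (p x)) \<le> t * (real n * V n x)"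
          using True by (intro mult_left_mono) auto
        moreover have "t * E n \<le> t * (real n * \<delta>)"
          using Rn R[of n] True by (intro mult_left_mono) auto
        ultimately have "- 2 * (t * (real n * \<delta>)) - t * ln (p x) \<le> t * (real n * V n x)"
          unfolding right_diff_distrib mult_minus_right by linarith
        moreover have "(t - 1) * ln (p x) \<le> (t - 1) * (real n * (I + \<delta>))"
          using x True by (intro mult_left_mono) auto
        moreover have "0 < real n * \<delta>" using n \<delta> by simp
        ultimately have "(1 - t) * (real n * I) - 4 * t * (real n * \<delta>) < ln (Z t n)"
          using Zge True mult_strict_right_mono[of 1 t "real n * \<delta>"] by (simp add: algebra_simps)
        then have lo: "real n * ((1 - t) * I - r) < ln (Z t n)" using True by (simp add: \<delta>_def algebra_simps)
        have "(1 - t) * I - r < ln (Z t n) / real n" using lo n by (simp add: pos_less_divide_eq mult.commute)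
        moreover have "ln (Z t n) / real n < (1 - t) * I + r" using up n by (simp add: pos_divide_less_eq mult.commute)
        ultimately show ?case by (simp add: dist_real_def abs_less_iff)
      qed
    qed
    then show ?thesis using True by (simp add: Z_def)
  qed
qed

section \<open>Words of nearly minimal energy\<close>

context normalized_potential
begin

lemma inf_ergodic_eq: "inf_ergodic g = (INF \<eta>\<in>ergodic_measures. \<integral>x. \<phi> x \<partial>\<eta>)"
  by (simp add: inf_ergodic_def \<phi>_def[abs_def])

lemma ergodic_potential_measure: "\<eta> \<in> ergodic_measures \<Longrightarrow> potential_measure g \<eta>"
  by unfold_locales (simp add: ergodic_measures_def)

lemma bdd_below_ergodic: "bdd_below ((\<lambda>\<eta>. \<integral>x. \<phi> x \<partial>\<eta>) ` ergodic_measures)"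
proof -
  obtain M where M: "\<And>x. \<bar>\<phi> x\<bar> \<le> M" using bounded_phi by blast
  show ?thesis
  proof (rule bdd_belowI2)
    fix \<eta> :: "(nat \<Rightarrow> 'a) measure" assume "\<eta> \<in> ergodic_measures"
    then interpret \<eta>: potential_measure g \<eta> by (rule ergodic_potential_measure)
    have "- M \<le> \<phi> x" for x using M[of x] by linarith
    then have "(\<integral>x. - M \<partial>\<eta>) \<le> (\<integral>x. \<phi> x \<partial>\<eta>)" by (intro integral_mono \<eta>.integrable_phi) auto
    then show "- M \<le> (\<integral>x. \<phi> x \<partial>\<eta>)" using \<eta>.prob_space by simp
  qed
qed

lemma inf_ergodic_le_orbit: "x \<noteq> [] \<Longrightarrow> inf_ergodic g \<le> (\<integral>y. \<phi> y \<partial>orbit_measure x)"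
  unfolding inf_ergodic_eq by (rule cINF_lower[OF bdd_below_ergodic orbit_measure_ergodic])

lemma inf_ergodic_neg: "inf_ergodic g < 0"
proof -
  let ?x = "[undefined] :: 'a list"
  have "(\<integral>y. \<phi> y \<partial>orbit_measure ?x) = \<phi> (periodic_ext ?x)"
    by (simp add: integral_orbit_measure[OF measurable_phi])
  then show ?thesis using inf_ergodic_le_orbit[of ?x] phi_neg[of "periodic_ext ?x"] by simp
qed

text \<open>
  Some point has a Birkhoff sum no larger than its mean under a nearly minimizing ergodic measure.  Periodizing a
  long prefix of this point changes the sum by at most the distortion.
\<close>

lemma ex_word_small_birkhoff:
  assumes P: "gibbs_law P" and "\<delta> > 0"
  shows "\<exists>w. w \<noteq> [] \<and> birkhoff_sum (length w) (periodic_ext w) \<le> real (length w) * (inf_ergodic g + \<delta>)"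
proof -
  have "\<exists>\<eta>\<in>ergodic_measures. (\<integral>x. \<phi> x \<partial>\<eta>) < inf_ergodic g + \<delta> / 2"
  proof -
    have "ergodic_measures \<noteq> ({} :: (nat \<Rightarrow> 'a) measure set)"
      using orbit_measure_ergodic[of "[undefined] :: 'a list"] by auto
    then show ?thesis
      using cINF_less_iff[OF _ bdd_below_ergodic, of "inf_ergodic g + \<delta> / 2"] \<open>\<delta> > 0\<close>
      by (simp add: inf_ergodic_eq)
  qed
  then obtain \<eta> where \<eta>: "\<eta> \<in> ergodic_measures" "(\<integral>x. \<phi> x \<partial>\<eta>) < inf_ergodic g + \<delta> / 2" by blast
  interpret \<eta>: potential_measure g \<eta> by (rule ergodic_potential_measure[OF \<eta>(1)])
  have "\<forall>\<^sub>F m in sequentially. distortion m / real m < \<delta> / 4"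
    by (rule order_tendstoD(2)[OF distortion_sublinear]) (use \<open>\<delta> > 0\<close> in simp)
  from eventually_happens[OF eventually_conj[OF this eventually_gt_at_top[of 0]]]
  obtain m where m: "m > 0" "distortion m / real m < \<delta> / 4" by auto
  have "\<exists>y. birkhoff_sum m y \<le> real m * (\<integral>x. \<phi> x \<partial>\<eta>)"
  proof (rule ccontr)
    assume "\<not> ?thesis"
    then have gt: "real m * (\<integral>x. \<phi> x \<partial>\<eta>) < birkhoff_sum m y" for y by (simp add: not_le)
    have "(\<integral>y. real m * (\<integral>x. \<phi> x \<partial>\<eta>) \<partial>\<eta>) < (\<integral>y. birkhoff_sum m y \<partial>\<eta>)"
      using gt \<eta>.emeasure_space_1
      by (intro \<eta>.integral_less_AE_space \<eta>.integral_birkhoff_sum) auto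
    then show False using \<eta>.prob_space by (simp add: \<eta>.integral_birkhoff_sum)
  qed
  then obtain y where y: "birkhoff_sum m y \<le> real m * (\<integral>x. \<phi> x \<partial>\<eta>)" by blast
  define w where "w = prefix_of y m"
  have "y \<in> cylinder w" by (simp add: w_def in_cylinder_iff)
  from gibbs_law_log[OF P this] gibbs_law_log[OF P periodic_ext_in_cylinder[of w]]
  have "birkhoff_sum m (periodic_ext w) \<le> birkhoff_sum m y + 2 * distortion m"
    by (simp add: w_def abs_le_iff)
  also have "\<dots> \<le> real m * (inf_ergodic g + \<delta> / 2) + 2 * (real m * (\<delta> / 4))"
  proof -
    have "real m * (\<integral>x. \<phi> x \<partial>\<eta>) \<le> real m * (inf_ergodic g + \<delta> / 2)" using \<eta>(2) by (intro mult_left_mono) auto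
    moreover have "distortion m \<le> real m * (\<delta> / 4)" using m by (simp add: field_simps)
    ultimately show ?thesis using y by linarith
  qed
  also have "\<dots> = real m * (inf_ergodic g + \<delta>)" by (simp add: algebra_simps)
  finally have "birkhoff_sum m (periodic_ext w) \<le> real m * (inf_ergodic g + \<delta>)" .
  moreover have "length w = m" "w \<noteq> []" using m(1) by (auto simp: w_def simp flip: length_greater_0_conv)
  ultimately show ?thesis by auto
qed

lemma birkhoff_sum_add: "birkhoff_sum (m + n) x = birkhoff_sum m x + birkhoff_sum n ((shift ^^ m) x)"
proof (induction n)
  case (Suc n)
  have "(shift ^^ n) ((shift ^^ m) x) = (shift ^^ (m + n)) x"
    by (simp add: funpow_shift ac_simps)
  then show ?case using Suc by (simp add: birkhoff_sum_def)
qed (simp add: birkhoff_sum_def)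

lemma birkhoff_sum_nonpos: "birkhoff_sum n x \<le> 0"
  unfolding birkhoff_sum_def using phi_neg by (intro sum_nonpos) (auto intro: less_imp_le)

lemma shift_multiple_period: "(shift ^^ (q * length w)) (periodic_ext w) = periodic_ext w"
  by (auto simp: funpow_shift periodic_ext_def)

text \<open>
  Incomplete periods cost at most the constant \<open>- length w * a\<close>, since \<open>\<phi>\<close> is negative.
\<close>

lemma birkhoff_sum_periodic:
  assumes "w \<noteq> []" "birkhoff_sum (length w) (periodic_ext w) \<le> real (length w) * a" "a \<le> 0"
  shows "birkhoff_sum n (periodic_ext w) \<le> real n * a - real (length w) * a"
proof -
  let ?m = "length w" and ?q = "n div length w" and ?r = "n mod length w"
  have "birkhoff_sum (q * ?m) (periodic_ext w) \<le> real (q * ?m) * a" for q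
  proof (induction q)
    case (Suc q)
    have "birkhoff_sum (Suc q * ?m) (periodic_ext w) =
        birkhoff_sum (q * ?m) (periodic_ext w) + birkhoff_sum ?m (periodic_ext w)"
      using birkhoff_sum_add[of "q * ?m" ?m "periodic_ext w"]
      by (simp only: shift_multiple_period mult_Suc add.commute[of ?m])
    also have "\<dots> \<le> real (q * ?m) * a + real ?m * a" using Suc assms(2) by (rule add_mono)
    finally show ?case by (simp add: algebra_simps)
  qed (simp add: birkhoff_sum_def)
  from this[of ?q] have "birkhoff_sum (?q * ?m) (periodic_ext w) \<le> real (?q * ?m) * a" .
  moreover have "birkhoff_sum (?q * ?m + ?r) (periodic_ext w) \<le> birkhoff_sum (?q * ?m) (periodic_ext w)"
    unfolding birkhoff_sum_add using birkhoff_sum_nonpos by simp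
  moreover have "real (?q * ?m) * a \<le> (real n - real ?m) * a"
  proof (rule mult_right_mono_neg[OF _ assms(3)])
    have "?r < ?m" using assms(1) by simp
    moreover have "real n = real (?q * ?m) + real ?r" by (metis div_mult_mod_eq of_nat_add)
    ultimately show "real n - real ?m \<le> real (?q * ?m)" by simp
  qed
  ultimately show ?thesis by (simp add: left_diff_distrib)
qed

text \<open>
  A block of the word either lies inside a periodic sequence, which leaves \<open>length w\<close> possibilities, or starts at
  one of the last \<open>k\<close> positions.
\<close>

lemma empirical_entropy_periodic:
  assumes "w \<noteq> []" "n > 0" "k > 0"
  shows "empirical_entropy (prefix_of (periodic_ext w) n) k \<le> ln (real (length w + k))"
proof -
  let ?x = "prefix_of (periodic_ext w) n" and ?m = "length w"
  have ne: "?x \<noteq> []" using assms(2) by (metis length_prefix_of less_numeral_extra(3) list.size(3))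
  interpret Q: stationary_law UNIV "cyl_prob (orbit_measure ?x)" by (rule stationary_empirical[OF ne])
  define B where "B = (\<lambda>i. prefix_of ((shift ^^ i) (periodic_ext w)) k) ` {..<?m} \<union>
    (\<lambda>i. prefix_of ((shift ^^ i) (periodic_ext ?x)) k) ` {n - k..<n}"
  have finB: "finite B" by (simp add: B_def)
  have "card B \<le> card {..<?m} + card {n - k..<n}"
    unfolding B_def by (intro order_trans[OF card_Un_le] add_mono card_image_le) auto
  then have cardB: "card B \<le> ?m + k" by simp
  have inB: "v \<in> B" if v: "v \<in> words UNIV k" "cyl_prob (orbit_measure ?x) v > 0" for v
  proof -
    have lv: "length v = k" using v by (simp add: words_UNIV)
    have "\<exists>i<n. (shift ^^ i) (periodic_ext ?x) \<in> cylinder v"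
    proof (rule ccontr)
      assume "\<not> ?thesis"
      then have "cyl_prob (orbit_measure ?x) v = 0"
        using ne by (simp add: cyl_prob_def measure_orbit_measure)
      then show False using v by simp
    qed
    then obtain i where i: "i < n" "prefix_of ((shift ^^ i) (periodic_ext ?x)) k = v"
      using lv by (auto simp: in_cylinder_iff)
    show ?thesis
    proof (cases "i + k \<le> n")
      case True
      have "prefix_of ((shift ^^ i) (periodic_ext ?x)) k = prefix_of ((shift ^^ (i mod ?m)) (periodic_ext w)) k"
        using True by (auto simp: prefix_of_eq_iff funpow_shift periodic_ext_def mod_simps)
      then show ?thesis using i assms(1) unfolding B_def by auto
    next
      case False
      then show ?thesis using i unfolding B_def by auto
    qed
  qed
  have "Q.H k \<le> ln (card B)" by (rule Q.entropy_le_ln_card[OF finB inB])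
  also have "\<dots> \<le> ln (real (?m + k))"
  proof (cases "card B = 0")
    case True
    then show ?thesis using assms by (simp add: Suc_leI ln_ge_zero)
  next
    case False
    then show ?thesis using cardB by simp
  qed
  finally show ?thesis by (simp add: empirical_entropy_def)
qed

lemma near_minimal_words:
  assumes P: "gibbs_law P" and k: "filterlim k at_top sequentially" and "\<delta> > 0"
  shows "\<forall>\<^sub>F n in sequentially. \<exists>x\<in>words UNIV n.
    ln (P x) \<le> real n * (inf_ergodic g + \<delta>) \<and> real n * (empirical_entropy x (k n) / real (k n)) \<le> real n * \<delta>"
proof -
  \<comment> \<open>The second entry keeps the energy bound nonpositive, as needed for periodization.\<close>
  define \<delta>' where "\<delta>' = min (\<delta> / 4) (- inf_ergodic g)"
  have \<delta>': "\<delta>' > 0" "\<delta>' \<le> \<delta> / 4" "inf_ergodic g + \<delta>' \<le> 0"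
    using inf_ergodic_neg \<open>\<delta> > 0\<close> by (auto simp: \<delta>'_def)
  obtain w where w: "w \<noteq> []"
    "birkhoff_sum (length w) (periodic_ext w) \<le> real (length w) * (inf_ergodic g + \<delta>')"
    using ex_word_small_birkhoff[OF P \<delta>'(1)] by blast
  define C where "C = - real (length w) * (inf_ergodic g + \<delta>')"
  have "(\<lambda>n. C / real n + distortion n / real n) \<longlonglongrightarrow> 0 + 0"
    by (intro tendsto_add lim_const_over_n distortion_sublinear)
  then have 1: "\<forall>\<^sub>F n in sequentially. C / real n + distortion n / real n < \<delta> / 4"
    by (rule order_tendstoD(2)) (use \<open>\<delta> > 0\<close> in simp)
  have "(\<lambda>j. ln (real (length w + j)) / real j) \<longlonglongrightarrow> 0"
  proof (rule Lim_null_comparison)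
    show "\<forall>\<^sub>F j in sequentially. norm (ln (real (length w + j)) / real j) \<le> 2 * (ln (real j) / real j)"
      using eventually_ge_at_top[of "length w + 2"]
    proof eventually_elim
      case (elim j)
      then have "length w + j \<le> j * j" using mult_le_mono1[of 2 j j] by linarith
      then have "real (length w + j) \<le> real j * real j" by (metis of_nat_le_iff of_nat_mult)
      then have "ln (real (length w + j)) \<le> ln (real j * real j)"
        using elim by (subst ln_le_cancel_iff) auto
      also have "\<dots> = 2 * ln (real j)" using elim by (simp add: ln_mult)
      finally have "ln (real (length w + j)) / real j \<le> 2 * ln (real j) / real j"
        by (rule divide_right_mono) simp
      moreover have "0 \<le> ln (real (length w + j))" using elim by (intro ln_ge_zero) simp
      ultimately show ?case by simp
    qed
    show "(\<lambda>j. 2 * (ln (real j) / real j)) \<longlonglongrightarrow> 0"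
      using tendsto_mult_right_zero[OF lim_ln_over_n] .
  qed
  from filterlim_compose[OF this k]
  have 2: "\<forall>\<^sub>F n in sequentially. ln (real (length w + k n)) / real (k n) < \<delta>"
    using \<open>\<delta> > 0\<close> by (rule order_tendstoD)
  have 3: "\<forall>\<^sub>F n in sequentially. k n > 0"
    by (rule eventually_compose_filterlim[OF eventually_gt_at_top k])
  show ?thesis
    using 1 2 3 eventually_gt_at_top[of 0]
  proof eventually_elim
    case (elim n)
    let ?x = "prefix_of (periodic_ext w) n"
    have "periodic_ext w \<in> cylinder ?x" by (simp add: in_cylinder_iff)
    from gibbs_law_log[OF P this]
    have "ln (P ?x) \<le> birkhoff_sum n (periodic_ext w) + distortion n" by (simp add: abs_le_iff)
    also have "birkhoff_sum n (periodic_ext w) \<le> real n * (inf_ergodic g + \<delta>') + C"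
      using birkhoff_sum_periodic[OF w \<delta>'(3), of n] by (simp add: C_def)
    also have "real n * (inf_ergodic g + \<delta>') + C + distortion n \<le> real n * (inf_ergodic g + \<delta>)"
    proof -
      have "C + distortion n \<le> real n * (\<delta> / 4)" using elim by (simp add: field_simps)
      moreover have "real n * \<delta>' \<le> real n * (\<delta> / 4)" using \<delta>' by (intro mult_left_mono) auto
      moreover have "real n * (\<delta> / 4) + real n * (\<delta> / 4) \<le> real n * \<delta>" using \<open>\<delta> > 0\<close> by simp
      ultimately show ?thesis unfolding distrib_left by linarith
    qed
    finally have "ln (P ?x) \<le> real n * (inf_ergodic g + \<delta>)" by simp
    moreover have "empirical_entropy ?x (k n) / real (k n) \<le> \<delta>"
    proof -
      have "empirical_entropy ?x (k n) / real (k n) \<le> ln (real (length w + k n)) / real (k n)"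
        using empirical_entropy_periodic[OF w(1), of n "k n"] elim by (intro divide_right_mono) auto
      then show ?thesis using elim by linarith
    qed
    ultimately show ?case by (intro bexI[of _ ?x] conjI mult_left_mono) (auto simp: words_UNIV)
  qed
qed

section \<open>Legendre duality\<close>

lemma P_Delta_eq_max: "P_Delta g t = max 0 ((1 - t) * inf_ergodic g)"
  using less_imp_le[OF inf_ergodic_neg] mult_nonneg_nonpos[of "1 - t" "inf_ergodic g"]
    mult_nonpos_nonpos[of "1 - t" "inf_ergodic g"]
  by (auto simp: P_Delta_def max_def not_less)

lemma convex_P_Delta: "convex_on UNIV (P_Delta g)"
proof (rule convex_onI)
  fix u x y :: real assume u: "0 < u" "u < 1"
  let ?l = "\<lambda>t. (1 - t) * inf_ergodic g"
  have "?l ((1 - u) * x + u * y) = (1 - u) * ?l x + u * ?l y" by (simp add: algebra_simps)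
  also have "\<dots> \<le> (1 - u) * max 0 (?l x) + u * max 0 (?l y)"
    using u by (intro add_mono mult_left_mono) auto
  finally show "P_Delta g ((1 - u) *\<^sub>R x + u *\<^sub>R y) \<le> (1 - u) * P_Delta g x + u * P_Delta g y"
    using u unfolding P_Delta_eq_max by (simp add: max.coboundedI1)
qed simp

lemma legendre_dual_J_P: "legendre_dual (J_fun g) (P_Delta g)"
proof -
  define L where "L = - inf_ergodic g"
  have L: "0 \<le> L" using less_imp_le[OF inf_ergodic_neg] by (simp add: L_def)
  have J: "J_fun g u = (if 0 \<le> u \<and> u \<le> L then ereal u else \<infinity>)" for u
    by (simp add: J_fun_def L_def)
  have P: "P_Delta g t = (if t > 1 then (t - 1) * L else 0)" for t
    by (simp add: P_Delta_def L_def algebra_simps)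
  have "ereal (P_Delta g t) = (SUP u. ereal (t * u) - J_fun g u)" for t
  proof (rule antisym)
    define u where "u = (if t > 1 then L else 0)"
    have "ereal (P_Delta g t) = ereal (t * u) - J_fun g u"
      using L by (simp add: P J u_def algebra_simps)
    then show "ereal (P_Delta g t) \<le> (SUP u. ereal (t * u) - J_fun g u)"
      by (rule SUP_upper2[OF UNIV_I eq_refl])
    show "(SUP u. ereal (t * u) - J_fun g u) \<le> ereal (P_Delta g t)"
    proof (rule SUP_least)
      fix u
      show "ereal (t * u) - J_fun g u \<le> ereal (P_Delta g t)"
      proof (cases "0 \<le> u \<and> u \<le> L")
        case True
        have "(t - 1) * u \<le> P_Delta g t"
          using True mult_left_mono[of u L "t - 1"] mult_nonpos_nonneg[of "t - 1" u] by (auto simp: P)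
        then show ?thesis using True by (simp add: J algebra_simps)
      qed (auto simp: J)
    qed
  qed
  moreover have "J_fun g u = (SUP t. ereal (t * u - P_Delta g t))" for u
  proof (cases "0 \<le> u \<and> u \<le> L")
    case True
    have "ereal (t * u - P_Delta g t) \<le> ereal u" for t
      using True mult_right_mono[of t 1 u] mult_nonneg_nonpos[of "t - 1" "u - L"]
      by (auto simp: P algebra_simps)
    moreover have "ereal u = ereal (1 * u - P_Delta g 1)" by (simp add: P)
    ultimately have "(SUP t. ereal (t * u - P_Delta g t)) = ereal u"
      by (intro antisym SUP_least) (auto intro: SUP_upper2[of 1])
    then show ?thesis using True by (simp add: J)
  next
    case False
    have "(SUP t. ereal (t * u - P_Delta g t)) = \<infinity>"
    proof (rule SUP_PInfty)
      fix n :: nat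
      show "\<exists>t\<in>UNIV. ereal (real n) \<le> ereal (t * u - P_Delta g t)"
      proof (cases "u < 0")
        case True
        then have "real n / u \<le> 0" by (simp add: divide_nonneg_neg)
        then show ?thesis using True by (intro bexI[of _ "real n / u"]) (auto simp: P)
      next
        case u: False
        then have uL: "u > L" using False by simp
        define t where "t = 2 + real n / (u - L)"
        have t: "t > 1" using uL by (simp add: t_def add_pos_nonneg)
        have "t * u - P_Delta g t = t * (u - L) + L" using t by (simp add: P algebra_simps)
        also have "t * (u - L) = 2 * (u - L) + real n" using uL by (simp add: t_def distrib_right)
        finally show ?thesis using uL L by (intro bexI[of _ t]) auto
      qed
    qed
    then show ?thesis using False by (simp add: J)
  qed
  ultimately show ?thesis by (simp add: legendre_dual_def)
qed

text \<open>
  Over a single letter the normalization would force \<open>g = 1\<close>.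
\<close>

lemma two_letters: "CARD('a) \<ge> 2"
proof (rule ccontr)
  assume "\<not> CARD('a) \<ge> 2"
  then have "CARD('a) = 1" using zero_less_card_finite[where 'a='a] by linarith
  then obtain a :: 'a where a: "UNIV = {a}" by (metis card_1_singletonE)
  have "g (case_nat a undefined) = 1" using sum_g[of undefined] unfolding a by simp
  then show False using g_less_1[of "case_nat a undefined"] by simp
qed

end

section \<open>Exponential moments of the empirical divergences\<close>

text \<open>
  The logarithm of the number of types is of order \<open>c ^ k n * ln n\<close>, where \<open>c ^ k n \<le> n powr (1 - \<epsilon>)\<close>.
\<close>

lemma block_length_growth:
  fixes k :: "nat \<Rightarrow> nat" and c \<epsilon> :: real
  assumes c: "c \<ge> 2" and \<epsilon>: "0 < \<epsilon>" "\<epsilon> < 1"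
    and le: "\<forall>\<^sub>F n in sequentially. real (k n) \<le> (1 - \<epsilon>) / ln c * ln (real n)"
  shows "\<forall>\<^sub>F n in sequentially. k n \<le> n"
    and "(\<lambda>n. (c ^ k n * ln (real (Suc n)) + real (k n) * ln c) / real n) \<longlonglongrightarrow> 0"
proof -
  have lc: "ln c > 0" using c by simp
  have pow: "\<forall>\<^sub>F n in sequentially. c ^ k n \<le> real n powr (1 - \<epsilon>) \<and> real (k n) * ln c \<le> ln (real n)"
    using le eventually_gt_at_top[of 0]
  proof eventually_elim
    case (elim n)
    then have kl: "real (k n) * ln c \<le> (1 - \<epsilon>) * ln (real n)" using lc by (simp add: field_simps)
    have "c ^ k n = exp (real (k n) * ln c)" using c by (simp add: exp_of_nat_mult)
    also have "\<dots> \<le> exp ((1 - \<epsilon>) * ln (real n))" using kl by simp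
    also have "\<dots> = real n powr (1 - \<epsilon>)" using elim by (simp add: powr_def)
    finally have "c ^ k n \<le> real n powr (1 - \<epsilon>)" .
    moreover have "(1 - \<epsilon>) * ln (real n) \<le> 1 * ln (real n)" using elim \<epsilon> by (intro mult_right_mono) auto
    ultimately show ?case using kl by simp
  qed
  show "\<forall>\<^sub>F n in sequentially. k n \<le> n"
    using pow eventually_gt_at_top[of 0]
  proof eventually_elim
    case (elim n)
    have "real (k n) \<le> 2 ^ k n" by (simp add: less_imp_le of_nat_less_two_power)
    also have "\<dots> \<le> c ^ k n" using c by (intro power_mono) auto
    also have "\<dots> \<le> real n powr (1 - \<epsilon>)" using elim by simp
    also have "\<dots> \<le> real n powr 1" using elim \<epsilon> by (intro powr_mono) auto
    finally show ?case using elim by simp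
  qed
  have "\<forall>\<^sub>F n in sequentially. norm ((c ^ k n * ln (real (Suc n)) + real (k n) * ln c) / real n)
      \<le> 3 * (ln (real n) / real n powr \<epsilon>)"
    using pow eventually_ge_at_top[of 2]
  proof eventually_elim
    case (elim n)
    have n: "real n \<ge> 2" using elim by simp
    have ln0: "ln (real n) \<ge> 0" using n by simp
    have "Suc n \<le> n * n" using elim mult_le_mono1[of 2 n n] by linarith
    then have "real (Suc n) \<le> real n * real n" by (metis of_nat_le_iff of_nat_mult)
    then have "ln (real (Suc n)) \<le> ln (real n * real n)" using n by (subst ln_le_cancel_iff) auto
    also have "\<dots> = 2 * ln (real n)" using n by (simp add: ln_mult)
    finally have l: "ln (real (Suc n)) \<le> 2 * ln (real n)" .
    have "c ^ k n * ln (real (Suc n)) \<le> real n powr (1 - \<epsilon>) * (2 * ln (real n))"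
      using elim l c by (intro mult_mono) auto
    moreover have "ln (real n) \<le> real n powr (1 - \<epsilon>) * ln (real n)"
      using ln0 n \<epsilon> mult_right_mono[of 1 "real n powr (1 - \<epsilon>)" "ln (real n)"] ge_one_powr_ge_zero[of "real n" "1 - \<epsilon>"]
      by simp
    ultimately have "c ^ k n * ln (real (Suc n)) + real (k n) * ln c \<le> 3 * (real n powr (1 - \<epsilon>) * ln (real n))"
      using elim by linarith
    then have "(c ^ k n * ln (real (Suc n)) + real (k n) * ln c) / real n \<le> 3 * (real n powr (1 - \<epsilon>) * ln (real n)) / real n"
      by (rule divide_right_mono) simp
    also have "\<dots> = 3 * (ln (real n) / real n powr \<epsilon>)"
      using n by (simp add: powr_diff)
    finally show ?case using c lc by (simp add: abs_of_nonneg)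
  qed
  moreover have "(\<lambda>n. 3 * (ln (real n) / real n powr \<epsilon>)) \<longlonglongrightarrow> 0"
    using tendsto_mult_right_zero[OF lim_ln_over_power[OF \<epsilon>(1)]] .
  ultimately show "(\<lambda>n. (c ^ k n * ln (real (Suc n)) + real (k n) * ln c) / real n) \<longlonglongrightarrow> 0"
    by (rule Lim_null_comparison)
qed

context normalized_potential
begin

lemma error_bound_nonneg: "0 \<le> error_bound k n"
  by (simp add: error_bound_def osc_nonneg distortion_nonneg)

lemma error_bound_sublinear:
  assumes "filterlim k at_top sequentially"
  shows "(\<lambda>n. error_bound (k n) n / real n) \<longlonglongrightarrow> 0"
proof -
  have "(\<lambda>n. osc (k n) + distortion (k n) / real (k n) + distortion n / real n) \<longlonglongrightarrow> 0 + 0 + 0"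
    by (intro tendsto_add filterlim_compose[OF osc_tendsto_0 assms]
        filterlim_compose[OF distortion_sublinear assms] distortion_sublinear)
  then have "(\<lambda>n. osc (k n) + distortion (k n) / real (k n) + distortion n / real n) \<longlonglongrightarrow> 0" by simp
  moreover have "\<forall>\<^sub>F n in sequentially. osc (k n) + distortion (k n) / real (k n) + distortion n / real n =
      error_bound (k n) n / real n"
    using eventually_gt_at_top[of 0] by eventually_elim (simp add: error_bound_def add_divide_distrib)
  ultimately show ?thesis by (rule Lim_transform_eventually)
qed

end

text \<open>
  Both statistics satisfy the hypotheses of \<open>tilted_sum_limit\<close> with the same bounds \<open>E\<close> and \<open>K\<close>.  They differ
  only in the entropy term, which is the increment \<open>e\<close> for \<open>Delta_hat\<close> and the mean \<open>c\<close> for \<open>D_hat\<close>.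
\<close>

theorem (in potential_measure) empirical_divergence_limits:
  fixes k :: "nat \<Rightarrow> nat" and \<epsilon> t :: real
  assumes gibbs: "gibbs_law (cyl_prob \<nu>)"
    and k_inf: "filterlim k at_top sequentially"
    and \<epsilon>: "0 < \<epsilon>" "\<epsilon> < 1"
    and k_le: "\<forall>\<^sub>F n in sequentially. real (k n) \<le> (1 - \<epsilon>) / ln (real CARD('a)) * ln (real n)"
  shows "(\<lambda>n. 1 / real n * ln (\<integral>x. exp (real n * t * Delta_hat (k n) (prefix_of x n) \<nu>) \<partial>\<nu>))
      \<longlonglongrightarrow> P_Delta g t"
    and "(\<lambda>n. 1 / real n * ln (\<integral>x. exp (real n * t * (D_hat (k n) (prefix_of x n) \<nu> / real (k n))) \<partial>\<nu>))
      \<longlonglongrightarrow> P_Delta g t"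
proof -
  let ?P = "cyl_prob \<nu>" and ?W = "\<lambda>n. words UNIV n :: 'a list set"
  define E where "E n = error_bound (k n) n" for n
  define K where "K n = real CARD('a) ^ k n * ln (real (Suc n)) + real (k n) * ln (real CARD('a))" for n
  define e where "e n x = empirical_increment x (k n - 1)" for n and x :: "'a list"
  define c where "c n x = empirical_entropy x (k n) / real (k n)" for n and x :: "'a list"
  have card2: "real CARD('a) \<ge> 2" using two_letters by (simp add: numeral_le_real_of_nat_iff)
  have E0: "0 \<le> E n" for n by (simp add: E_def error_bound_nonneg)
  have K0: "0 \<le> K n" for n using card2 by (simp add: K_def)
  have E_lim: "(\<lambda>n. E n / real n) \<longlonglongrightarrow> 0"
    unfolding E_def by (rule error_bound_sublinear[OF k_inf])
  have K_lim: "(\<lambda>n. K n / real n) \<longlonglongrightarrow> 0"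
    unfolding K_def by (rule block_length_growth(2)[OF card2 \<epsilon> k_le])
  have "\<forall>\<^sub>F n in sequentially. 2 \<le> k n"
    by (rule eventually_compose_filterlim[OF eventually_ge_at_top k_inf])
  then have good: "\<forall>\<^sub>F n in sequentially. 2 \<le> k n \<and> k n \<le> n"
    using block_length_growth(1)[OF card2 \<epsilon> k_le] by (rule eventually_conj)
  have pos: "\<And>w. 0 < ?P w" using gibbs_law_pos[OF gibbs] .
  have word: "x \<noteq> [] \<and> length x = n" if "x \<in> ?W n" "2 \<le> k n \<and> k n \<le> n" for x n
    using that by (auto simp: words_UNIV)
  have e_c: "0 \<le> e n x \<and> e n x \<le> c n x" if "x \<in> ?W n" "2 \<le> k n \<and> k n \<le> n" for x n
    using empirical_increment_bounds[of x "k n - 1"] word[OF that] that(2)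
    by (auto simp: e_def c_def field_simps)
  have D: "\<bar>real n * (D_hat (k n) x \<nu> / real (k n)) + real n * c n x + ln (?P x)\<bar> \<le> E n"
    and D0: "0 \<le> real n * (D_hat (k n) x \<nu> / real (k n))"
    if "x \<in> ?W n" "2 \<le> k n \<and> k n \<le> n" for x n
    using D_hat_approx[OF gibbs, of x "k n" n] word[OF that] that(2)
      D_hat_nonneg[of x "k n" \<nu>, OF _ _ pos law.stationary_law_axioms]
    by (auto simp: c_def E_def)
  have \<Delta>: "\<bar>real n * Delta_hat (k n) x \<nu> + real n * e n x + ln (?P x)\<bar> \<le> E n"
    if "x \<in> ?W n" "2 \<le> k n \<and> k n \<le> n" for x n
    using Delta_hat_approx[OF gibbs, of x "k n - 1" n] word[OF that] that(2)
    by (auto simp: e_def E_def)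
  have \<Delta>0: "- 2 * E n \<le> real n * Delta_hat (k n) x \<nu>"
    if "x \<in> ?W n" "2 \<le> k n \<and> k n \<le> n" for x n
  proof -
    have "real n * e n x \<le> real n * c n x" using e_c[OF that] by (intro mult_left_mono) auto
    then show ?thesis using D[OF that] D0[OF that] \<Delta>[OF that] unfolding abs_le_iff by linarith
  qed
  have p_ge: "real n * inf_ergodic g - E n \<le> ln (?P x)" if "x \<in> ?W n" "2 \<le> k n \<and> k n \<le> n" for x n
  proof -
    have "real n * inf_ergodic g \<le> real n * (\<integral>y. \<phi> y \<partial>orbit_measure x)"
      using inf_ergodic_le_orbit word[OF that] by (intro mult_left_mono) auto
    moreover have "real n * (\<integral>y. \<phi> y \<partial>orbit_measure x) - distortion n \<le> ln (?P x)"
      using log_prob_orbit_measure[OF gibbs, of x] word[OF that] by (simp add: abs_le_iff)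
    moreover have "distortion n \<le> E n"
      by (simp add: E_def error_bound_def osc_nonneg distortion_nonneg)
    ultimately show ?thesis by linarith
  qed
  have kraft: "(\<Sum>x\<in>?W n. exp (- (real n * e n x))) \<le> exp (K n)" if "2 \<le> k n \<and> k n \<le> n" for n
  proof -
    let ?C = "real CARD('a)"
    have "(\<Sum>x\<in>?W n. exp (- (real n * e n x))) \<le>
        real (Suc n) ^ (CARD('a) ^ Suc (k n - 1)) * ?C ^ (k n - 1)"
      unfolding e_def using that by (intro sum_exp_empirical_increment_le[of n "n - (k n - 1)"]) auto
    also have "\<dots> \<le> real (Suc n) ^ (CARD('a) ^ k n) * ?C ^ k n"
      using that card2 by (intro mult_mono power_increasing) auto
    also have "\<dots> = exp (K n)"
      using card2 by (simp add: K_def exp_add exp_of_nat_mult flip: of_nat_power)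
    finally show ?thesis .
  qed
  have low: "\<forall>\<^sub>F n in sequentially. \<exists>x\<in>?W n. ln (?P x) \<le> real n * (inf_ergodic g + \<delta>) \<and> real n * c n x \<le> real n * \<delta>"
    if "\<delta> > 0" for \<delta>
    unfolding c_def by (rule near_minimal_words[OF gibbs k_inf that])
  have lowe: "\<forall>\<^sub>F n in sequentially. \<exists>x\<in>?W n. ln (?P x) \<le> real n * (inf_ergodic g + \<delta>) \<and> real n * e n x \<le> real n * \<delta>"
    if "\<delta> > 0" for \<delta>
    using low[OF that] good
  proof eventually_elim
    case (elim n)
    then obtain x where x: "x \<in> ?W n" "ln (?P x) \<le> real n * (inf_ergodic g + \<delta>)" "real n * c n x \<le> real n * \<delta>"
      by blast
    have "real n * e n x \<le> real n * c n x" using e_c[OF x(1) elim(2)] by (intro mult_left_mono) auto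
    then show ?case using x by (intro bexI[of _ x]) auto
  qed
  note lim = tilted_sum_limit[where W = ?W and p = ?P and E = E and K = K and I = "inf_ergodic g" and e = e,
      OF finite_words[OF finite] pos law.sum_law E0 K0 E_lim K_lim]
  have P: "P_Delta g t = (if t > 1 then (1 - t) * inf_ergodic g else 0)" by (simp add: P_Delta_def)
  show "(\<lambda>n. 1 / real n * ln (\<integral>x. exp (real n * t * Delta_hat (k n) (prefix_of x n) \<nu>) \<partial>\<nu>))
      \<longlonglongrightarrow> P_Delta g t"
    unfolding P integral_prefix[of "\<lambda>x. exp (real _ * t * Delta_hat (k _) x \<nu>)"]
    by (rule lim[where c = e], (rule eventually_mono[OF good], use \<Delta> e_c \<Delta>0 p_ge kraft in blast)+, rule lowe)
  show "(\<lambda>n. 1 / real n * ln (\<integral>x. exp (real n * t * (D_hat (k n) (prefix_of x n) \<nu> / real (k n))) \<partial>\<nu>))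
      \<longlonglongrightarrow> P_Delta g t"
  proof -
    have V: "- 2 * E n \<le> real n * (D_hat (k n) x \<nu> / real (k n))" if "x \<in> ?W n" "2 \<le> k n \<and> k n \<le> n" for x n
      using D0[OF that] E0[of n] by linarith
    show ?thesis
      unfolding P integral_prefix[of "\<lambda>x. exp (real _ * t * (D_hat (k _) x \<nu> / real (k _)))"]
      by (rule lim[where c = c], (rule eventually_mono[OF good], use D e_c V p_ge kraft in blast)+, rule low)
  qed
qed

theorem proposition3p5:
  fixes g :: "(nat \<Rightarrow> 'a::finite) \<Rightarrow> real"
    and \<rho> :: "(nat \<Rightarrow> 'a) measure"
    and k :: "nat \<Rightarrow> nat"
    and \<epsilon> :: real
  assumes "g_measure g \<rho>"
    and "\<And>n. k n > 0"
    and "filterlim k at_top sequentially"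
    and "0 < \<epsilon>" and "\<epsilon> < 1"
    and "eventually (\<lambda>n. real (k n) \<le> (1 - \<epsilon>) / ln (real CARD('a)) * ln (real n)) sequentially"
  shows "convex_on UNIV (P_Delta g) \<and> legendre_dual (J_fun g) (P_Delta g) \<and>
    (\<forall>t::real.
      (\<lambda>n. 1 / real n *
         ln (\<integral>x. exp (real n * t * Delta_hat (k n) (prefix_of x n) \<rho>) \<partial>\<rho>))
        \<longlonglongrightarrow> P_Delta g t \<and>
      (\<lambda>n. 1 / real n *
         ln (\<integral>x. exp (real n * t * (D_hat (k n) (prefix_of x n) \<rho> / real (k n))) \<partial>\<rho>))
        \<longlonglongrightarrow> P_Delta g t)"
proof -
  interpret normalized_potential g
    using assms(1) by unfold_locales (simp add: g_measure_def)
  have eq: "equilibrium_state \<phi> \<rho>"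
    using assms(1) by (simp add: g_measure_def \<phi>_def[abs_def])
  interpret potential_measure g \<rho>
    using eq by unfold_locales (simp add: equilibrium_state_def)
  show ?thesis
    using convex_P_Delta legendre_dual_J_P
      empirical_divergence_limits[OF equilibrium_state_gibbs_law[OF eq] assms(3-6)]
    by blast
qed

end
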